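(* Let $p:[0,1]\times\mathbb{R}^3\to\mathbb{R}^+$ be a smooth map which is bounded with bounded derivatives, and let $u\in C^{1,2}_{b,div}([0,1]\times\mathbb{R}^3)$ be a solution of $$\partial_t u+(u\cdot\nabla)u=-\nabla p+\frac{\Delta u}{2},\qquad \mathrm{div}\,u=0.$$ Let $(e_1,e_2,e_3)$ be the canonical orthonormal basis of $\mathbb{R}^3$ and assume that $p(t,x+ae_3)=p(t,x)$ for all $a\in\mathbb{R}$, $t\in[0,1]$, $x\in\mathbb{R}^3$. Then the process $(\langle v^{P_u}_t,e_3\rangle)_t$ is an $(\mathcal{F}^{P_u}_t)$-local martingale on $(W,\mathcal{B}(W)^{P_u},P_u)$.
   Context: $W:=C([0,1],\mathbb{R}^3)$ with the uniform norm and Borel sigma-field $\mathcal{B}(W)$; $(W_t)_{t\in[0,1]}$ is the evaluation process $W_t(\omega)=\omega(t)$. For a Borel probability $\nu$ on $W$, $\mathcal{B}(W)^\nu$ is the $\nu$-completion of $\mathcal{B}(W)$ and $(\mathcal{F}^\nu_t)$ is the $\nu$-usual augmentation of the natural filtration of $(W_t)$. $C^{1,2}_{b,div}([0,1]\times\mathbb{R}^3):=\{u\in C^{1,2}([0,1]\times\mathbb{R}^3;\mathbb{R}^3)\cap C_b([0,1]\times\mathbb{R}^3;\mathbb{R}^3):\ \mathrm{div}\,u(t,\cdot)=0\text{ for all }t\in[0,1]\}$. For such $u$, $P_u$ is the probability measure equivalent to the standard Wiener measure $\mu$ on $W$ (law of standard Brownian motion, $W_0=0$ $\mu$-a.s.)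 with density $$\frac{dP_u}{d\mu}:=\exp\left(-\int_0^1 u(1-t,W_t)\,dW_t-\frac12\int_0^1|u(1-t,W_t)|^2\,dt\right).$$ Under $P_u$, $(W_t)$ is a semi-martingale whose martingale part is a Brownian motion and whose drift is $v^{P_u}_t=-u(1-t,W_t)$ (this continuous version of the drift is used). $\langle\cdot,\cdot\rangle$ is the Euclidean inner product of $\mathbb{R}^3$. *)

theory Defs
  imports "HOL-Probability.Probability"
begin

type_synonym path = "real \<Rightarrow> real^3"

text \<open>A path is a function on \<^term>\<open>{0..1::real}\<close>, encoded extensionally
  (it is \<^term>\<open>undefined\<close> outside the interval); see \<open>mspace_W_metric\<close> and
  \<open>mdist_W_metric\<close> below.\<close>

definition W_metric :: "path metric" where
  "W_metric = cfunspace (top_of_set {0..1}) euclidean_metric"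

definition borel_W :: "path measure" where
  "borel_W = sigma (mspace W_metric) {U. openin (mtopology_of W_metric) U}"

lemma mspace_W_metric: "mspace W_metric = {\<omega> \<in> extensional {0..1}. continuous_on {0..1} \<omega>}"
proof -
  have "bounded (\<omega> ` {0..1})" if "continuous_on {0..1} \<omega>" for \<omega> :: path
    using compact_continuous_image[OF that] compact_imp_bounded by blast
  then show ?thesis
    unfolding W_metric_def
    by (auto simp: Met_TC.mbounded_def euclidean_metric_def bounded_subset_cball
        Met_TC.fspace_def cball_def Met_TC.mcball_def)
qed

lemma mdist_W_metric:
  assumes "\<omega> \<in> mspace W_metric" "\<omega>' \<in> mspace W_metric"
  shows "mdist W_metric \<omega> \<omega>' = (SUP t\<in>{0..1}. norm (\<omega> t - \<omega>' t))"
  using assms unfolding W_metric_def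
  by (subst mdist_cfunspace_eq_mdist_funspace) (auto simp: Met_TC.fdist_def Met_TC.fspace_def dist_norm)

lemma space_borel_W: "space borel_W = mspace W_metric"
  by (simp add: borel_W_def space_measure_of_conv)

text \<open>Filtrations are indexed by all real times, as in the library; only times in
  \<^term>\<open>{0..1::real}\<close> matter. After time 1 the natural filtration is constant, so the
  right-limit at time 1 is harmless. Before time 0 the augmented filtration consists of null sets
  and their complements, and stopping times with values in \<^term>\<open>{0..1::real}\<close>
  satisfy the condition of \<^const>\<open>stopping_time\<close> trivially there.\<close>

definition natural_filtration :: "real \<Rightarrow> path measure" where
  "natural_filtration t = sigma (space borel_W)
     {(\<lambda>\<omega>. \<omega> r) -` B \<inter> space borel_W | r B. r \<in> {0..1} \<and> r \<le> t \<and> B \<in> sets borel}"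

definition usual_augmentation :: "path measure \<Rightarrow> real \<Rightarrow> path measure" where
  "usual_augmentation \<nu> t = sigma (space borel_W)
     (\<Inter>s\<in>{t<..}. sigma_sets (space borel_W)
        (sets (natural_filtration s) \<union> null_sets (completion \<nu>)))"

definition adapted :: "(real \<Rightarrow> 'a measure) \<Rightarrow> (real \<Rightarrow> 'a \<Rightarrow> real) \<Rightarrow> bool" where
  "adapted F X \<longleftrightarrow> (\<forall>t\<in>{0..1}. X t \<in> borel_measurable (F t))"

definition cadlag :: "(real \<Rightarrow> real) \<Rightarrow> bool" where
  "cadlag x \<longleftrightarrow> (\<forall>t\<in>{0..<1}. (x \<longlongrightarrow> x t) (at_right t)) \<and>
                (\<forall>t\<in>{0<..1}. \<exists>l. (x \<longlongrightarrow> l) (at_left t))"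

definition martingale ::
  "'a measure \<Rightarrow> (real \<Rightarrow> 'a measure) \<Rightarrow> (real \<Rightarrow> 'a \<Rightarrow> real) \<Rightarrow> bool" where
  "martingale M F X \<longleftrightarrow>
     adapted F X \<and>
     (\<forall>t\<in>{0..1}. integrable M (X t)) \<and>
     (\<forall>s\<in>{0..1}. \<forall>t\<in>{0..1}. s \<le> t \<longrightarrow>
        (AE \<omega> in M. real_cond_exp M (F s) (X t) \<omega> = X s \<omega>))"

text \<open>On the closed time interval, "localizing" means that almost surely the stopping times
  eventually equal the terminal time 1 (and not merely that they tend to 1): this is what
  \<open>T\<^sub>n \<up> \<infinity>\<close> amounts to when times beyond 1 are identified with 1. The factor
  \<open>1{T\<^sub>n > 0}\<close> is the usual device that avoids integrability of \<open>X\<^sub>0\<close>.\<close>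

definition local_martingale ::
  "'a measure \<Rightarrow> (real \<Rightarrow> 'a measure) \<Rightarrow> (real \<Rightarrow> 'a \<Rightarrow> real) \<Rightarrow> bool" where
  "local_martingale M F X \<longleftrightarrow>
     prob_space M \<and> filtration (space M) F \<and> (\<forall>t\<in>{0..1}. subalgebra M (F t)) \<and>
     adapted F X \<and> (\<forall>\<omega>\<in>space M. cadlag (\<lambda>t. X t \<omega>)) \<and>
     (\<exists>T :: nat \<Rightarrow> 'a \<Rightarrow> real.
        (\<forall>n. stopping_time F (T n)) \<and>
        (\<forall>n. \<forall>\<omega>\<in>space M. T n \<omega> \<in> {0..1}) \<and>
        (\<forall>\<omega>\<in>space M. incseq (\<lambda>n. T n \<omega>)) \<and>
        (AE \<omega> in M. \<forall>\<^sub>F n in sequentially. T n \<omega> = 1) \<and>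
        (\<forall>n. martingale M F
           (\<lambda>t \<omega>. indicator {\<omega>. T n \<omega> > 0} \<omega> * X (min t (T n \<omega>)) \<omega>)))"

definition wiener_measure :: "path measure \<Rightarrow> bool" where
  "wiener_measure \<mu> \<longleftrightarrow>
     prob_space \<mu> \<and> sets \<mu> = sets borel_W \<and>
     (AE \<omega> in \<mu>. \<omega> 0 = 0) \<and>
     (\<forall>s t. 0 \<le> s \<and> s < t \<and> t \<le> 1 \<longrightarrow>
        distributed \<mu> lborel (\<lambda>\<omega>. \<omega> t - \<omega> s)
          (\<lambda>x. ennreal (\<Prod>i\<in>UNIV. normal_density 0 (sqrt (t - s)) (x $ i)))) \<and>
     (\<forall>N (s :: nat \<Rightarrow> real). s 0 = 0 \<and> (\<forall>k<N. s k < s (Suc k)) \<and> s N \<le> 1 \<longrightarrow>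
        prob_space.indep_vars \<mu> (\<lambda>_. borel) (\<lambda>k \<omega>. \<omega> (s (Suc k)) - \<omega> (s k)) {..<N})"

definition simple_integrand ::
  "path measure \<Rightarrow> nat \<Rightarrow> (nat \<Rightarrow> real) \<Rightarrow> (nat \<Rightarrow> path \<Rightarrow> real^3) \<Rightarrow> bool" where
  "simple_integrand \<mu> N s \<xi> \<longleftrightarrow>
     s 0 = 0 \<and> (\<forall>k<N. s k < s (Suc k)) \<and> s N = 1 \<and>
     (\<forall>k<N. \<xi> k \<in> borel_measurable (usual_augmentation \<mu> (s k)) \<and>
            bounded (\<xi> k ` space \<mu>))"

definition simple_process ::
  "nat \<Rightarrow> (nat \<Rightarrow> real) \<Rightarrow> (nat \<Rightarrow> path \<Rightarrow> real^3) \<Rightarrow> real \<Rightarrow> path \<Rightarrow> real^3" where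
  "simple_process N s \<xi> t \<omega> = (\<Sum>k<N. indicator {s k<..s (Suc k)} t *\<^sub>R \<xi> k \<omega>)"

definition simple_integral ::
  "nat \<Rightarrow> (nat \<Rightarrow> real) \<Rightarrow> (nat \<Rightarrow> path \<Rightarrow> real^3) \<Rightarrow> path \<Rightarrow> real" where
  "simple_integral N s \<xi> \<omega> = (\<Sum>k<N. \<xi> k \<omega> \<bullet> (\<omega> (s (Suc k)) - \<omega> (s k)))"

text \<open>\<open>I\<close> is a (Borel measurable) version of the Ito integral of \<open>H\<close> over the unit interval
  against the evaluation process: an \<open>L\<^sup>2\<close>-limit of the integrals of simple predictable
  processes that converge to \<open>H\<close> in \<open>L\<^sup>2(dt \<otimes> d\<mu>)\<close>. It is determined up to \<open>\<mu>\<close>-null sets.\<close>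

definition is_ito_integral ::
  "path measure \<Rightarrow> (real \<Rightarrow> path \<Rightarrow> real^3) \<Rightarrow> (path \<Rightarrow> real) \<Rightarrow> bool" where
  "is_ito_integral \<mu> H I \<longleftrightarrow>
     I \<in> borel_measurable \<mu> \<and>
     (\<exists>N s \<xi>.
        (\<forall>n::nat. simple_integrand \<mu> (N n) (s n) (\<xi> n)) \<and>
        (\<lambda>n. \<integral>\<^sup>+\<omega>. (\<integral>\<^sup>+t\<in>{0..1}.
            ennreal ((norm (simple_process (N n) (s n) (\<xi> n) t \<omega> - H t \<omega>))\<^sup>2) \<partial>lborel)
          \<partial>completion \<mu>) \<longlonglongrightarrow> 0 \<and>
        (\<lambda>n. \<integral>\<^sup>+\<omega>. ennreal ((simple_integral (N n) (s n) (\<xi> n) \<omega> - I \<omega>)\<^sup>2)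
          \<partial>completion \<mu>) \<longlonglongrightarrow> 0)"

abbreviation slab :: "(real \<times> (real^3)) set" where
  "slab \<equiv> {0..1} \<times> UNIV"

text \<open>A direction is \<^const>\<open>None\<close> (time) or \<^term>\<open>Some i\<close> (the \<open>i\<close>-th space coordinate).
  Time derivatives are one-sided at the end points 0 and 1.\<close>

definition dt :: "(real \<Rightarrow> real^3 \<Rightarrow> 'b::real_normed_vector) \<Rightarrow> real \<Rightarrow> real^3 \<Rightarrow> 'b" where
  "dt f t x = vector_derivative (\<lambda>s. f s x) (at t within {0..1})"

definition dx :: "3 \<Rightarrow> (real \<Rightarrow> real^3 \<Rightarrow> 'b::real_normed_vector) \<Rightarrow> real \<Rightarrow> real^3 \<Rightarrow> 'b" where
  "dx i f t x = vector_derivative (\<lambda>h. f t (x + h *\<^sub>R axis i 1)) (at 0)"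

definition partial ::
  "3 option \<Rightarrow> (real \<Rightarrow> real^3 \<Rightarrow> 'b::real_normed_vector) \<Rightarrow> real \<Rightarrow> real^3 \<Rightarrow> 'b" where
  "partial d = (case d of None \<Rightarrow> dt | Some i \<Rightarrow> dx i)"

definition has_partial :: "3 option \<Rightarrow> (real \<Rightarrow> real^3 \<Rightarrow> 'b::real_normed_vector) \<Rightarrow> bool" where
  "has_partial d f \<longleftrightarrow> (\<forall>t\<in>{0..1}. \<forall>x. case d of
      None \<Rightarrow> (\<lambda>s. f s x) differentiable (at t within {0..1})
    | Some i \<Rightarrow> (\<lambda>h. f t (x + h *\<^sub>R axis i 1)) differentiable (at 0))"

definition cont_slab :: "(real \<Rightarrow> real^3 \<Rightarrow> 'b::real_normed_vector) \<Rightarrow> bool" where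
  "cont_slab f \<longleftrightarrow> continuous_on slab (\<lambda>(t, x). f t x)"

definition bounded_slab :: "(real \<Rightarrow> real^3 \<Rightarrow> 'b::real_normed_vector) \<Rightarrow> bool" where
  "bounded_slab f \<longleftrightarrow> bounded ((\<lambda>(t, x). f t x) ` slab)"

definition smooth_bounded :: "(real \<Rightarrow> real^3 \<Rightarrow> 'b::real_normed_vector) \<Rightarrow> bool" where
  "smooth_bounded f \<longleftrightarrow> (\<forall>ds. cont_slab (foldr partial ds f) \<and>
     bounded_slab (foldr partial ds f) \<and> (\<forall>d. has_partial d (foldr partial ds f)))"

definition C12 :: "(real \<Rightarrow> real^3 \<Rightarrow> 'b::real_normed_vector) \<Rightarrow> bool" where
  "C12 f \<longleftrightarrow> cont_slab f \<and>
     has_partial None f \<and> cont_slab (dt f) \<and>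
     (\<forall>i. has_partial (Some i) f \<and> cont_slab (dx i f)) \<and>
     (\<forall>i j. has_partial (Some j) (dx i f) \<and> cont_slab (dx j (dx i f)))"

definition grad :: "(real \<Rightarrow> real^3 \<Rightarrow> real) \<Rightarrow> real \<Rightarrow> real^3 \<Rightarrow> real^3" where
  "grad f t x = (\<chi> i. dx i f t x)"

definition divergence :: "(real \<Rightarrow> real^3 \<Rightarrow> real^3) \<Rightarrow> real \<Rightarrow> real^3 \<Rightarrow> real" where
  "divergence u t x = (\<Sum>i\<in>UNIV. dx i u t x $ i)"

definition laplacian ::
  "(real \<Rightarrow> real^3 \<Rightarrow> 'b::real_normed_vector) \<Rightarrow> real \<Rightarrow> real^3 \<Rightarrow> 'b" where
  "laplacian u t x = (\<Sum>i\<in>UNIV. dx i (dx i u) t x)"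

definition advection :: "(real \<Rightarrow> real^3 \<Rightarrow> real^3) \<Rightarrow> real \<Rightarrow> real^3 \<Rightarrow> real^3" where
  "advection u t x = (\<Sum>i\<in>UNIV. u t x $ i *\<^sub>R dx i u t x)"

definition C12_b_div :: "(real \<Rightarrow> real^3 \<Rightarrow> real^3) set" where
  "C12_b_div = {u. C12 u \<and> bounded_slab u \<and> (\<forall>t\<in>{0..1}. \<forall>x. divergence u t x = 0)}"

definition navier_stokes ::
  "(real \<Rightarrow> real^3 \<Rightarrow> real^3) \<Rightarrow> (real \<Rightarrow> real^3 \<Rightarrow> real) \<Rightarrow> bool" where
  "navier_stokes u p \<longleftrightarrow> (\<forall>t\<in>{0..1}. \<forall>x.
     dt u t x + advection u t x = - grad p t x + (1/2) *\<^sub>R laplacian u t x \<and>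
     divergence u t x = 0)"

text \<open>\<open>I\<close> stands for a version of the Ito integral of \<open>u(1-t,W\<^sub>t)\<close>.\<close>

definition P_measure ::
  "path measure \<Rightarrow> (real \<Rightarrow> real^3 \<Rightarrow> real^3) \<Rightarrow> (path \<Rightarrow> real) \<Rightarrow> path measure" where
  "P_measure \<mu> u I = density \<mu> (\<lambda>\<omega>. ennreal (exp (- I \<omega>
     - (1/2) * (LBINT t:{0..1}. (norm (u (1 - t) (\<omega> t)))\<^sup>2))))"

definition drift :: "(real \<Rightarrow> real^3 \<Rightarrow> real^3) \<Rightarrow> real \<Rightarrow> path \<Rightarrow> real^3" where
  "drift u t \<omega> = - u (1 - t) (\<omega> t)"

end

theory Submission
  imports Defs
begin

text \<open>
  Because the pressure does not depend on the third coordinate, the third component of the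
  Navier-Stokes equation contains no pressure term: reversed in time, \<open>f(t,x) = u\<^sub>3(1-t,x)\<close>
  solves the backward equation \<open>\<partial>\<^sub>tf + \<Delta>f/2 - u(1-t,\<cdot>)\<cdot>\<nabla>f = 0\<close>. Under \<open>P\<^sub>u\<close> the evaluation
  process is a Brownian motion with drift \<open>-u(1-t,W\<^sub>t)\<close>, whose generator is
  \<open>\<Delta>/2 - u(1-t,\<cdot>)\<cdot>\<nabla>\<close>; hence \<open>f(t,W\<^sub>t)\<close>, which is minus the third component of the drift, has no
  drift of its own. As \<open>u\<close> is bounded, this process is a true martingale and the constant time 1
  localizes it.

  Girsanov's theorem and Ito's formula enter through their discrete counterparts on the grids
  \<open>k/N\<close>, with mesh \<open>h = 1/N\<close>.

  The Ito integral in the density of \<open>P\<^sub>u\<close> is given as an abstract \<open>L\<^sup>2\<close> limit. The isometry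
  \<open>ito_isometry\<close> shows that the limit does not depend on the approximating simple
  processes, so it is also the almost sure limit of the Riemann sums of \<open>u(1-t,W\<^sub>t)\<close> along a
  subsequence (\<open>L_tendsto_subseq\<close>). Hence the density is the limit of the products \<open>Z\<close> of the
  factors \<open>exp(-b\<cdot>\<Delta>W - |b|\<^sup>2h/2)\<close>. These products are bounded in \<open>L\<^sup>2\<close>, so expectations pass to the
  limit (\<open>L2_bounded_AE_convergence\<close>, \<open>Z_limit\<close>).

  Each factor turns the Gaussian law of \<open>\<Delta>W\<close>, conditionally on the past, into the Gaussian law with
  mean \<open>-bh\<close> (\<open>gauss_exponential_tilt\<close>, \<open>Z_step\<close>). A second order Taylor expansion and the backward
  equation show that the conditional mean of the increment of \<open>f(t,W\<^sub>t)\<close> over one step is then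
  \<open>o(h)\<close> (\<open>one_step_estimate\<close>). The error is uniform only on balls, since the derivatives of \<open>u\<close>
  need not be bounded; the sum of the increments is therefore stopped when the path leaves a ball.
  Adding up at most \<open>1/h\<close> steps, letting \<open>h\<close> tend to 0 and then the radius to infinity gives
  \<open>martingale_identity\<close>: the increments of \<open>f(t,W\<^sub>t)\<close> are orthogonal under \<open>P\<^sub>u\<close> to the events of
  the past.
\<close>

section \<open>Gaussian measures on three-dimensional space\<close>

lemma prod_Basis_vec3:
  fixes g :: "real^3 \<Rightarrow> 'a::comm_monoid_mult"
  shows "(\<Prod>b\<in>Basis. g b) = (\<Prod>i\<in>UNIV. g (axis i 1))"
proof -
  have B: "(Basis :: (real^3) set) = (\<lambda>i. axis i 1) ` UNIV"
    by (auto simp: Basis_vec_def)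
  have "inj (\<lambda>i::3. axis i (1::real))"
    by (auto simp: inj_on_def axis_eq_axis)
  from prod.reindex[OF this, of g] show ?thesis
    unfolding B by (simp only: o_def)
qed

text \<open>Lebesgue measure on \<open>real^3\<close> is the image of a product measure indexed by the basis vectors, so
  Fubini applies once the coordinates are reindexed by the basis.\<close>

lemma
  fixes f :: "3 \<Rightarrow> real \<Rightarrow> real"
  assumes "\<And>i. integrable lborel (f i)"
  shows integrable_prod_coords: "integrable lborel (\<lambda>x::real^3. \<Prod>i\<in>UNIV. f i (x $ i))"
    and integral_prod_coords: "(\<integral>x. (\<Prod>i\<in>UNIV. f i ((x::real^3) $ i)) \<partial>lborel) = (\<Prod>i\<in>UNIV. integral\<^sup>L lborel (f i))"
proof -
  interpret product_sigma_finite "\<lambda>_::real^3. lborel :: real measure"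
    by standard
  define ix where "ix = (\<lambda>b::real^3. THE i. b = axis i 1)"
  have ix: "ix (axis i 1) = i" for i
    unfolding ix_def by (auto simp: axis_eq_axis)
  define F where "F = (\<lambda>b. f (ix b))"
  have F: "integrable lborel (F b)" for b unfolding F_def by (rule assms)
  have [measurable]: "F b \<in> borel_measurable borel" for b using borel_measurable_integrable[OF F] by simp
  have eq: "(\<Prod>i\<in>UNIV. f i ((x::real^3) $ i)) = (\<Prod>b\<in>Basis. F b (x \<bullet> b))" for x
    by (simp add: prod_Basis_vec3 F_def ix inner_axis)
  have m: "(\<lambda>x. \<Prod>b\<in>Basis. F b (x \<bullet> b)) \<in> borel_measurable (borel :: (real^3) measure)" by measurable
  have T: "(\<lambda>f. \<Sum>b\<in>Basis. f b *\<^sub>R b) \<in> measurable (\<Pi>\<^sub>M b\<in>Basis. lborel) (borel :: (real^3) measure)"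
    by measurable
  have c: "(\<Prod>b\<in>Basis. F b ((\<Sum>c\<in>Basis. y c *\<^sub>R c) \<bullet> b)) = (\<Prod>b\<in>Basis. F b (y b))" for y :: "real^3 \<Rightarrow> real"
    by (intro prod.cong refl) simp
  show "integrable lborel (\<lambda>x::real^3. \<Prod>i\<in>UNIV. f i (x $ i))"
    unfolding eq by (subst lborel_eq, subst integrable_distr_eq[OF T m], unfold c)
      (intro product_integrable_prod F, auto)
  have "(\<integral>x. (\<Prod>i\<in>UNIV. f i ((x::real^3) $ i)) \<partial>lborel) = (\<Prod>b\<in>Basis. integral\<^sup>L lborel (F b))"
    unfolding eq by (subst lborel_eq, subst integral_distr[OF T m], unfold c)
      (intro product_integral_prod F, auto)
  then show "(\<integral>x. (\<Prod>i\<in>UNIV. f i ((x::real^3) $ i)) \<partial>lborel) = (\<Prod>i\<in>UNIV. integral\<^sup>L lborel (f i))"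
    by (simp add: prod_Basis_vec3 F_def ix)
qed

definition gauss_density :: "real \<Rightarrow> real^3 \<Rightarrow> real" where
  "gauss_density h x = (\<Prod>i\<in>UNIV. normal_density 0 (sqrt h) (x $ i))"

definition gauss :: "real \<Rightarrow> (real^3) measure" where
  "gauss h = density lborel (\<lambda>x. ennreal (gauss_density h x))"

lemma sets_gauss [simp, measurable_cong]: "sets (gauss h) = sets borel"
  and space_gauss [simp]: "space (gauss h) = UNIV"
  by (simp_all add: gauss_def)

lemma gauss_density_nonneg [simp]: "0 \<le> gauss_density h x"
  by (auto simp: gauss_density_def intro!: prod_nonneg)

lemma measurable_gauss_density [measurable]: "gauss_density h \<in> borel_measurable borel"
  unfolding gauss_density_def by measurable

context
  fixes h :: real
  assumes h: "h > 0"
begin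

text \<open>All moments needed below are mixed moments of the coordinates, and these factor into
  one-dimensional normal moments.\<close>

lemma
  shows integrable_gauss_monomial: "integrable (gauss h) (\<lambda>z. \<Prod>k\<in>UNIV. (z $ k) ^ m k)"
    and integral_gauss_monomial: "(\<integral>z. (\<Prod>k\<in>UNIV. (z $ k) ^ m k) \<partial>gauss h)
           = (\<Prod>k\<in>UNIV. \<integral>x. normal_density 0 (sqrt h) x * x ^ m k \<partial>lborel)"
proof -
  have i: "integrable lborel (\<lambda>x. normal_density 0 (sqrt h) x * x ^ m k)" for k
    using integrable_normal_moment[of "sqrt h" 0 "m k"] h by simp
  have *: "gauss_density h z * (\<Prod>k\<in>UNIV. (z $ k) ^ m k)
       = (\<Prod>k\<in>UNIV. normal_density 0 (sqrt h) (z $ k) * (z $ k) ^ m k)" for z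
    by (simp add: gauss_density_def prod.distrib)
  show "integrable (gauss h) (\<lambda>z. \<Prod>k\<in>UNIV. (z $ k) ^ m k)"
    unfolding gauss_def by (subst integrable_density) (auto simp: * intro!: integrable_prod_coords i)
  show "(\<integral>z. (\<Prod>k\<in>UNIV. (z $ k) ^ m k) \<partial>gauss h)
           = (\<Prod>k\<in>UNIV. \<integral>x. normal_density 0 (sqrt h) x * x ^ m k \<partial>lborel)"
    unfolding gauss_def by (subst integral_density) (auto simp: * intro!: integral_prod_coords i)
qed

lemma prob_space_gauss: "prob_space (gauss h)"
proof
  have "integrable (gauss h) (\<lambda>z. 1::real)" "(\<integral>z. (1::real) \<partial>gauss h) = 1"
    using integrable_gauss_monomial[of "\<lambda>_. 0"] integral_gauss_monomial[of "\<lambda>_. 0"] h by auto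
  then show "emeasure (gauss h) (space (gauss h)) = 1"
    using nn_integral_eq_integral[of "gauss h" "\<lambda>_. 1::real"] by simp
qed

lemma
  shows integrable_gauss_coord_power: "integrable (gauss h) (\<lambda>z. (z $ i) ^ a)"
    and integral_gauss_coord_power: "(\<integral>z. (z $ i) ^ a \<partial>gauss h)
       = (\<integral>x. normal_density 0 (sqrt h) x * x ^ a \<partial>lborel)"
proof -
  have *: "(\<Prod>k\<in>UNIV. (z $ k) ^ (if k = i then a else 0)) = (z $ i) ^ a" for z :: "real^3"
  proof -
    have "(\<Prod>k\<in>UNIV. (z $ k) ^ (if k = i then a else 0)) = (\<Prod>k\<in>UNIV. if k = i then (z $ k) ^ a else 1)"
      by (intro prod.cong) auto
    then show ?thesis by simp
  qed
  show "integrable (gauss h) (\<lambda>z. (z $ i) ^ a)"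
    using integrable_gauss_monomial[of "\<lambda>k. if k = i then a else 0"] by (simp only: *)
  have "(\<integral>z. (z $ i) ^ a \<partial>gauss h) = (\<Prod>k\<in>UNIV. \<integral>x. normal_density 0 (sqrt h) x * x ^ (if k = i then a else 0) \<partial>lborel)"
    using integral_gauss_monomial[of "\<lambda>k. if k = i then a else 0"] by (simp only: *)
  also have "\<dots> = (\<Prod>k\<in>UNIV. if k = i then \<integral>x. normal_density 0 (sqrt h) x * x ^ a \<partial>lborel else 1)"
    using h by (intro prod.cong) auto
  finally show "(\<integral>z. (z $ i) ^ a \<partial>gauss h) = (\<integral>x. normal_density 0 (sqrt h) x * x ^ a \<partial>lborel)"
    by simp
qed

lemma integral_gauss_coord: "(\<integral>z. z $ i \<partial>gauss h) = 0"
  using integral_gauss_coord_power[of i 1] integral_normal_moment_odd[of "sqrt h" 0 0] h by simp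

lemma integrable_gauss_coord: "integrable (gauss h) (\<lambda>z. z $ i)"
  using integrable_gauss_coord_power[of i 1] by simp

lemma integral_gauss_coord_sq: "(\<integral>z. (z $ i)\<^sup>2 \<partial>gauss h) = h"
  using integral_gauss_coord_power[of i 2] integral_normal_moment_even[of "sqrt h" 0 1] h
  by (simp add: power2_eq_square)

lemma integral_gauss_coord_4: "(\<integral>z. (z $ i)^4 \<partial>gauss h) = 3 * h\<^sup>2"
proof -
  have "fact 4 = (24::real)" by (simp add: fact_numeral)
  then show ?thesis
  using integral_gauss_coord_power[of i 4] integral_normal_moment_even[of "sqrt h" 0 2] h
  by (simp add: power_divide power2_eq_square field_simps)
qed

lemma integral_gauss_coord_mult:
  assumes ij: "i \<noteq> j"
  shows "(\<integral>z. z $ i * z $ j \<partial>gauss h) = 0"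
proof -
  have p: "(\<Prod>k\<in>UNIV. if k = i then A else if k = j then B else 1) = A * (B::real)" for A B
  proof -
    have "(\<Prod>k\<in>UNIV. if k = i then A else if k = j then B else 1)
      = (\<Prod>k\<in>UNIV. (if k = i then A else 1) * (if k = j then B else 1))"
      using ij by (intro prod.cong) auto
    then show ?thesis by (simp add: prod.distrib)
  qed
  have *: "(\<Prod>k\<in>UNIV. (z $ k) ^ (if k = i then 1 else if k = j then 1 else 0)) = z $ i * z $ j" for z :: "real^3"
    by (subst p[symmetric], intro prod.cong) auto
  have "(\<integral>z. z $ i * z $ j \<partial>gauss h) = (\<Prod>k\<in>UNIV. \<integral>x. normal_density 0 (sqrt h) x * x ^ (if k = i then 1 else if k = j then 1 else 0) \<partial>lborel)"
    using integral_gauss_monomial[of "\<lambda>k. if k = i then 1 else if k = j then 1 else 0"] by (simp only: *)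
  also have "\<dots> = (\<Prod>k\<in>UNIV. if k = i then 0 else if k = j then 0 else 1)"
    using h integral_normal_moment_odd[of "sqrt h" 0 0] by (intro prod.cong) auto
  also have "\<dots> = 0" unfolding p by simp
  finally show ?thesis .
qed

lemma integrable_gauss_coord_mult: "integrable (gauss h) (\<lambda>z. z $ i * z $ j)"
proof (rule Bochner_Integration.integrable_bound)
  show "integrable (gauss h) (\<lambda>z. (z $ i)^2 + (z $ j)^2)"
    by (intro Bochner_Integration.integrable_add integrable_gauss_coord_power)
  show "AE z in gauss h. norm (z $ i * z $ j) \<le> norm ((z $ i)^2 + (z $ j)^2)"
  proof (rule AE_I2)
    fix z :: "real^3"
    have "2 * \<bar>z $ i\<bar> * \<bar>z $ j\<bar> \<le> \<bar>z $ i\<bar>\<^sup>2 + \<bar>z $ j\<bar>\<^sup>2" by (rule sum_squares_bound)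
    then have "\<bar>z $ i\<bar> * \<bar>z $ j\<bar> \<le> (z $ i)^2 + (z $ j)^2" using mult_nonneg_nonneg[of "\<bar>z $ i\<bar>" "\<bar>z $ j\<bar>"] by (simp del: mult_nonneg_nonneg)
    then show "norm (z $ i * z $ j) \<le> norm ((z $ i)^2 + (z $ j)^2)" by (simp add: abs_mult)
  qed
qed measurable

lemma integral_gauss_inner: "(\<integral>z. a \<bullet> z \<partial>gauss h) = 0"
  unfolding inner_vec_def by (simp add: integrable_gauss_coord integral_gauss_coord)

lemma integral_gauss_inner_mult: "(\<integral>z. (a \<bullet> z) * (b \<bullet> z) \<partial>gauss h) = h * (a \<bullet> b)"
proof -
  have *: "(a \<bullet> z) * (b \<bullet> z) = (\<Sum>i\<in>UNIV. \<Sum>j\<in>UNIV. (a $ i * b $ j) * (z $ i * z $ j))" for z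
    by (simp add: inner_vec_def sum_product mult_ac)
  have **: "(\<integral>z. z $ i * z $ j \<partial>gauss h) = (if i = j then h else 0)" for i j
    using integral_gauss_coord_mult[of i j] integral_gauss_coord_sq[of i] by (auto simp: power2_eq_square)
  have "(\<integral>z. (a \<bullet> z) * (b \<bullet> z) \<partial>gauss h) = (\<Sum>i\<in>UNIV. \<Sum>j\<in>UNIV. (a $ i * b $ j) * (if i = j then h else 0))"
    unfolding * by (subst Bochner_Integration.integral_sum, intro Bochner_Integration.integrable_sum integrable_mult_right integrable_gauss_coord_mult)
      (simp add: ** integrable_gauss_coord_mult)
  also have "\<dots> = h * (a \<bullet> b)"
    by (simp add: inner_vec_def sum_distrib_left if_distrib mult_ac cong: if_cong)
  finally show ?thesis .
qed

text \<open>Completing the square.\<close>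

lemma gauss_density_shift:
  "gauss_density h (z - h *\<^sub>R \<beta>) * exp (- (\<beta> \<bullet> (z - h *\<^sub>R \<beta>)) - (1/2) * (norm \<beta>)\<^sup>2 * h) = gauss_density h z"
proof -
  have n2: "(norm \<beta>)\<^sup>2 = (\<Sum>i\<in>UNIV. (\<beta> $ i)\<^sup>2)"
    unfolding power2_norm_eq_inner inner_vec_def by (simp add: power2_eq_square)
  have e: "exp (- (\<beta> \<bullet> y) - (1/2) * (norm \<beta>)\<^sup>2 * h)
     = (\<Prod>i\<in>UNIV. exp (- (\<beta> $ i * y $ i) - (1/2) * (\<beta> $ i)\<^sup>2 * h))" for y
    unfolding exp_sum[OF finite, symmetric]
    by (simp add: inner_vec_def sum_subtractf sum_negf n2 sum_distrib_left sum_distrib_right mult_ac)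
  have "normal_density 0 (sqrt h) (x - h * b) * exp (- (b * (x - h * b)) - (1/2) * b\<^sup>2 * h) = normal_density 0 (sqrt h) x" for x b
  proof -
    have "- (x - h * b)\<^sup>2 / (2 * h) + (- (b * (x - h * b)) - (1/2) * b\<^sup>2 * h) = - x\<^sup>2 / (2 * h)"
      using h by (simp add: field_simps power2_eq_square)
    then show ?thesis using h by (simp add: normal_density_def mult_exp_exp)
  qed
  then show ?thesis unfolding e gauss_density_def
    by (simp add: prod.distrib[symmetric])
qed

text \<open>The one-step form of Girsanov's theorem: the exponential weight of a Brownian increment over a
  time \<open>h\<close> does nothing but shift its mean by \<open>-h\<beta>\<close>.\<close>

lemma gauss_exponential_tilt:
  "density (gauss h) (\<lambda>z. ennreal (exp (- (\<beta> \<bullet> z) - (1/2) * (norm \<beta>)\<^sup>2 * h)))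
     = distr (gauss h) borel (\<lambda>z. z - h *\<^sub>R \<beta>)"
proof -
  let ?e = "\<lambda>z. exp (- (\<beta> \<bullet> z) - (1/2) * (norm \<beta>)\<^sup>2 * h)"
  have "density (gauss h) (\<lambda>z. ennreal (?e z)) = density lborel (\<lambda>z. ennreal (gauss_density h z * ?e z))"
    unfolding gauss_def by (subst density_density_eq) (auto simp: ennreal_mult)
  also have "\<dots> = density (distr lborel borel ((+) (- (h *\<^sub>R \<beta>)))) (\<lambda>z. ennreal (gauss_density h z * ?e z))"
    by (simp add: lborel_distr_plus)
  also have "\<dots> = distr (density lborel (\<lambda>z. ennreal (gauss_density h (- (h *\<^sub>R \<beta>) + z) * ?e (- (h *\<^sub>R \<beta>) + z)))) borel ((+) (- (h *\<^sub>R \<beta>)))"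
    by (subst density_distr) auto
  also have "\<dots> = distr (gauss h) borel (\<lambda>z. z - h *\<^sub>R \<beta>)"
    using gauss_density_shift[of _ \<beta>] by (simp add: gauss_def cong: distr_cong)
  finally show ?thesis .
qed

lemma nn_integral_gauss_exp: "(\<integral>\<^sup>+z. ennreal (exp (- (\<beta> \<bullet> z) - (1/2) * (norm \<beta>)\<^sup>2 * h)) \<partial>gauss h) = 1"
proof -
  interpret prob_space "gauss h" by (rule prob_space_gauss)
  let ?e = "\<lambda>z. ennreal (exp (- (\<beta> \<bullet> z) - (1/2) * (norm \<beta>)\<^sup>2 * h))"
  have "(\<integral>\<^sup>+z. ?e z \<partial>gauss h) = emeasure (density (gauss h) ?e) UNIV"
    by (subst emeasure_density) auto
  also have "\<dots> = 1" unfolding gauss_exponential_tilt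
    by (subst emeasure_distr) (auto simp: emeasure_space_1[simplified])
  finally show ?thesis .
qed

text \<open>The square of the weight for \<open>\<beta>\<close> is, up to a constant, the weight for \<open>2\<beta>\<close>.\<close>

lemma nn_integral_gauss_exp_sq:
  "(\<integral>\<^sup>+z. ennreal ((exp (- (\<beta> \<bullet> z) - (1/2) * (norm \<beta>)\<^sup>2 * h))\<^sup>2) \<partial>gauss h) = ennreal (exp ((norm \<beta>)\<^sup>2 * h))"
proof -
  have *: "ennreal ((exp (- (\<beta> \<bullet> z) - (1/2) * (norm \<beta>)\<^sup>2 * h))\<^sup>2)
    = ennreal (exp ((norm \<beta>)\<^sup>2 * h)) * ennreal (exp (- ((2 *\<^sub>R \<beta>) \<bullet> z) - (1/2) * (norm (2 *\<^sub>R \<beta>))\<^sup>2 * h))" for z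
    by (simp add: ennreal_mult[symmetric] power2_eq_square mult_exp_exp algebra_simps)
  show ?thesis unfolding * by (subst nn_integral_cmult) (auto simp only: nn_integral_gauss_exp[of "2 *\<^sub>R \<beta>"] mult_1_right, measurable)
qed

lemma integral_gauss_tilt:
  fixes g :: "real^3 \<Rightarrow> real"
  assumes [measurable]: "g \<in> borel_measurable borel"
  shows "(\<integral>z. exp (- (\<beta> \<bullet> z) - (1/2) * (norm \<beta>)\<^sup>2 * h) * g z \<partial>gauss h) = (\<integral>z. g (z - h *\<^sub>R \<beta>) \<partial>gauss h)"
proof -
  let ?e = "\<lambda>z. exp (- (\<beta> \<bullet> z) - (1/2) * (norm \<beta>)\<^sup>2 * h)"
  have "(\<integral>z. g (z - h *\<^sub>R \<beta>) \<partial>gauss h) = (\<integral>z. g z \<partial>density (gauss h) (\<lambda>z. ennreal (?e z)))"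
    unfolding gauss_exponential_tilt by (subst integral_distr) auto
  also have "\<dots> = (\<integral>z. ?e z * g z \<partial>gauss h)"
    by (subst integral_density) auto
  finally show ?thesis by simp
qed

end

section \<open>Path space and filtrations\<close>

text \<open>Evaluation is continuous for the uniform metric.\<close>

lemma measurable_eval:
  assumes t: "t \<in> {0..1}"
  shows "(\<lambda>\<omega>. \<omega> t) \<in> borel_measurable borel_W"
proof -
  interpret MS: Metric_space "mspace W_metric" "mdist W_metric" by simp
  have op: "openin (mtopology_of W_metric) ((\<lambda>\<omega>. \<omega> t) -` U \<inter> mspace W_metric)" if U: "open U" for U :: "(real^3) set"
    unfolding mtopology_of_def MS.openin_mtopology
  proof (intro conjI allI impI)
    fix \<omega> assume w: "\<omega> \<in> (\<lambda>\<omega>. \<omega> t) -` U \<inter> mspace W_metric"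
    then obtain e where e: "e > 0" "ball (\<omega> t) e \<subseteq> U" using U by (auto simp: open_contains_ball)
    have "\<omega>' t \<in> ball (\<omega> t) e" if "\<omega>' \<in> MS.mball \<omega> e" for \<omega>'
    proof -
      have m: "\<omega> \<in> mspace W_metric" "\<omega>' \<in> mspace W_metric" "mdist W_metric \<omega> \<omega>' < e"
        using that w by (auto simp: MS.in_mball)
      have "continuous_on {0..1} (\<lambda>s. norm (\<omega> s - \<omega>' s))"
        using m by (auto simp: mspace_W_metric intro!: continuous_intros)
      then have "bdd_above ((\<lambda>s. norm (\<omega> s - \<omega>' s)) ` {0..1})"
        by (intro bounded_imp_bdd_above compact_imp_bounded compact_continuous_image) auto
      then have "norm (\<omega> t - \<omega>' t) \<le> mdist W_metric \<omega> \<omega>'"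
        unfolding mdist_W_metric[OF m(1,2)] by (rule cSUP_upper[OF t])
      then show ?thesis using m by (auto simp: dist_norm)
    qed
    then show "\<exists>r>0. MS.mball \<omega> r \<subseteq> (\<lambda>\<omega>. \<omega> t) -` U \<inter> mspace W_metric"
      using e(1) subsetD[OF e(2)] by (intro exI[of _ e]) (auto simp: MS.in_mball)
  qed auto
  show ?thesis
  proof (rule borel_measurableI)
    fix U :: "(real^3) set" assume "open U"
    from op[OF this] show "(\<lambda>\<omega>. \<omega> t) -` U \<inter> space borel_W \<in> sets borel_W"
      using openin_subset[of "mtopology_of W_metric"] unfolding space_borel_W unfolding borel_W_def
      by (subst sets_measure_of) (auto simp: subset_eq intro!: sigma_sets.Basic)
  qed
qed

lemma space_natural [simp]: "space (natural_filtration t) = space borel_W"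
  by (simp add: natural_filtration_def space_measure_of_conv)

lemma sets_natural: "sets (natural_filtration t) = sigma_sets (space borel_W)
     {(\<lambda>\<omega>. \<omega> r) -` B \<inter> space borel_W | r B. r \<in> {0..1} \<and> r \<le> t \<and> B \<in> sets borel}"
  unfolding natural_filtration_def by (rule sets_measure_of) auto

lemma measurable_eval_natural:
  assumes "r \<in> {0..1}" "r \<le> t"
  shows "(\<lambda>\<omega>. \<omega> r) \<in> borel_measurable (natural_filtration t)"
proof (rule measurableI)
  fix B :: "(real^3) set" assume "B \<in> sets borel"
  then show "(\<lambda>\<omega>. \<omega> r) -` B \<inter> space (natural_filtration t) \<in> sets (natural_filtration t)"
    using assms unfolding space_natural sets_natural by (intro sigma_sets.Basic) blast
qed simp

lemma sets_natural_mono: "s \<le> t \<Longrightarrow> sets (natural_filtration s) \<subseteq> sets (natural_filtration t)"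
  unfolding sets_natural by (rule sigma_sets_mono') (use order_trans in blast)

lemma sets_natural_borel_W: "sets (natural_filtration t) \<subseteq> sets borel_W"
  unfolding sets_natural using measurable_sets[OF measurable_eval]
  by (intro sets.sigma_sets_subset) auto

text \<open>Events of an augmented sigma-algebra are handled through honest events that differ from them by
  a null set.\<close>

lemma sigma_sets_null_sets_modification:
  assumes sp: "space N = space \<nu>" and sub: "sets N \<subseteq> sets (completion \<nu>)"
    and A: "A \<in> sigma_sets (space N) (sets N \<union> null_sets (completion \<nu>))"
  shows "\<exists>A'\<in>sets N. AE \<omega> in completion \<nu>. \<omega> \<in> A \<longleftrightarrow> \<omega> \<in> A'"
  using A
proof induction
  case (Basic a)
  then show ?case
  proof
    assume "a \<in> null_sets (completion \<nu>)"
    then show ?thesis by (intro bexI[of _ "{}"]) (auto dest: AE_not_in)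
  qed auto
next
  case Empty
  then show ?case by (intro bexI[of _ "{}"]) auto
next
  case (Compl a)
  then obtain A' where "A' \<in> sets N" "AE \<omega> in completion \<nu>. \<omega> \<in> a \<longleftrightarrow> \<omega> \<in> A'" by blast
  then show ?case
    by (intro bexI[of _ "space N - A'"]) auto
next
  case (Union a)
  then obtain A' where A': "\<And>i. A' i \<in> sets N" "\<And>i. AE \<omega> in completion \<nu>. \<omega> \<in> a i \<longleftrightarrow> \<omega> \<in> A' i" by metis
  have "AE \<omega> in completion \<nu>. \<forall>i. \<omega> \<in> a i \<longleftrightarrow> \<omega> \<in> A' i" using A'(2) by (subst AE_all_countable) auto
  then show ?case using A'(1)
    by (intro bexI[of _ "\<Union>i. A' i"]) auto
qed

definition augmented :: "path measure \<Rightarrow> real \<Rightarrow> path set set" where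
  "augmented \<nu> s = sigma_sets (space borel_W) (sets (natural_filtration s) \<union> null_sets (completion \<nu>))"

locale path_measure =
  fixes \<nu> :: "path measure"
  assumes sets_\<nu>: "sets \<nu> = sets borel_W"
begin

lemma space_\<nu>: "space \<nu> = space borel_W"
  using sets_\<nu> by (rule sets_eq_imp_space_eq)

lemma augmented_sub: "augmented \<nu> s \<subseteq> sets (completion \<nu>)"
proof -
  have "sets (natural_filtration s) \<union> null_sets (completion \<nu>) \<subseteq> sets (completion \<nu>)"
    using sets_natural_borel_W[of s] sets_\<nu> by (auto simp: null_sets_def)
  from sets.sigma_sets_subset[OF this] show ?thesis
    by (simp add: augmented_def space_\<nu>)
qed

lemma space_usual [simp]: "space (usual_augmentation \<nu> t) = space borel_W"
  by (simp add: usual_augmentation_def space_measure_of_conv)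

text \<open>The generating family in the definition of the augmentation is already a sigma-algebra.\<close>

lemma sets_usual: "sets (usual_augmentation \<nu> t) = (\<Inter>s\<in>{t<..}. augmented \<nu> s)"
proof -
  have pow: "augmented \<nu> s \<subseteq> Pow (space borel_W)" for s
    using augmented_sub[of s] sets.space_closed[of "completion \<nu>"] by (auto simp: space_\<nu>)
  have sub: "(\<Inter>s\<in>{t<..}. augmented \<nu> s) \<subseteq> Pow (space borel_W)"
    using pow[of "t + 1"] by force
  have "sigma_algebra (space borel_W) (\<Inter>s\<in>{t<..}. augmented \<nu> s)"
    unfolding sigma_algebra_iff2
  proof (intro conjI ballI allI impI INT_I)
    show "(\<Inter>s\<in>{t<..}. augmented \<nu> s) \<subseteq> Pow (space borel_W)" by (rule sub)
  next
    fix s show "{} \<in> augmented \<nu> s" by (simp add: augmented_def sigma_sets.Empty)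
  next
    fix a s assume "a \<in> (\<Inter>s\<in>{t<..}. augmented \<nu> s)" "s \<in> {t<..}"
    then have "a \<in> augmented \<nu> s" by blast
    then show "space borel_W - a \<in> augmented \<nu> s" by (simp add: augmented_def sigma_sets.Compl)
  next
    fix A :: "nat \<Rightarrow> path set" and s assume "range A \<subseteq> (\<Inter>s\<in>{t<..}. augmented \<nu> s)" "s \<in> {t<..}"
    then have "A i \<in> augmented \<nu> s" for i by blast
    then show "(\<Union>i. A i) \<in> augmented \<nu> s" by (simp add: augmented_def sigma_sets.Union)
  qed
  from sigma_algebra.sigma_sets_eq[OF this]
  show ?thesis
    unfolding usual_augmentation_def augmented_def[symmetric]
    by (subst sets_measure_of[OF sub]) simp
qed

lemma usual_sub_augmented: "s < r \<Longrightarrow> sets (usual_augmentation \<nu> s) \<subseteq> augmented \<nu> r"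
  unfolding sets_usual by auto

lemma sets_usual_completion: "sets (usual_augmentation \<nu> s) \<subseteq> sets (completion \<nu>)"
  using usual_sub_augmented[of s "s+1"] augmented_sub[of "s+1"] by auto

lemma natural_sub_usual: "sets (natural_filtration s) \<subseteq> sets (usual_augmentation \<nu> s)"
  unfolding sets_usual augmented_def
  by (auto intro!: sigma_sets.Basic dest: sets_natural_mono[OF less_imp_le, THEN subsetD])

lemma usual_mono: "s \<le> t \<Longrightarrow> sets (usual_augmentation \<nu> s) \<subseteq> sets (usual_augmentation \<nu> t)"
  unfolding sets_usual by auto

lemma subalgebra_usual: "subalgebra (completion \<nu>) (usual_augmentation \<nu> t)"
  using sets_usual_completion by (simp add: subalgebra_def space_\<nu>)

lemma filtration_usual: "filtration (space borel_W) (usual_augmentation \<nu>)"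
  by standard (use usual_mono in auto)

lemma usual_modification:
  assumes "A \<in> sets (usual_augmentation \<nu> s)" "s < r"
  shows "\<exists>A'\<in>sets (natural_filtration r). AE \<omega> in completion \<nu>. \<omega> \<in> A \<longleftrightarrow> \<omega> \<in> A'"
  using usual_sub_augmented[OF assms(2)] assms(1) sets_natural_borel_W[of r]
  by (intro sigma_sets_null_sets_modification) (auto simp: augmented_def space_\<nu> sets_\<nu>)

lemma measurable_eval_usual:
  "r \<in> {0..1} \<Longrightarrow> r \<le> t \<Longrightarrow> (\<lambda>\<omega>. \<omega> r) \<in> borel_measurable (usual_augmentation \<nu> t)"
  using measurable_eval_natural[of r t] natural_sub_usual[of t]
  by (auto simp: measurable_def)

lemma measurable_usual_mono:
  "f \<in> measurable (usual_augmentation \<nu> s) N \<Longrightarrow> s \<le> t \<Longrightarrow> f \<in> measurable (usual_augmentation \<nu> t) N"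
  using usual_mono[of s t] by (auto simp: measurable_def)

lemma measurable_usual_completion:
  "f \<in> measurable (usual_augmentation \<nu> s) N \<Longrightarrow> f \<in> measurable (completion \<nu>) N"
  using measurable_from_subalg[OF subalgebra_usual] .

end

section \<open>Independence of Brownian increments from the augmented past\<close>

lemma measure_eq_via_closed_sets:
  fixes N1 N2 :: "'a::metric_space measure"
  assumes s: "sets N1 = sets borel" "sets N2 = sets borel" and f: "finite_measure N1"
    and eq: "\<And>C. closed C \<Longrightarrow> emeasure N1 C = emeasure N2 C"
  shows "N1 = N2"
proof (rule measure_eqI_generator_eq[where E="Collect closed" and \<Omega>=UNIV and A="\<lambda>_. UNIV"])
  show "Int_stable (Collect (closed :: 'a set \<Rightarrow> bool))" by (auto simp: Int_stable_def)
  have "sets borel = sigma_sets (UNIV::'a set) (Collect closed)"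
    by (simp add: borel_eq_closed sets_measure_of)
  then show "sets N1 = sigma_sets UNIV (Collect closed)" "sets N2 = sigma_sets UNIV (Collect closed)"
    using s by auto
  show "emeasure N1 UNIV \<noteq> \<infinity>" using f by (simp add: finite_measure.emeasure_finite)
qed (auto intro: eq)

text \<open>Indicators of closed sets are decreasing limits of continuous functions of the distance to the
  set. This is what allows the passage from \<open>F\<^sub>r\<close>, \<open>r > s\<close>, to the right limit \<open>F\<^sub>s\<close> below.\<close>

lemma measure_eq_via_continuous:
  fixes N1 N2 :: "'a::metric_space measure"
  assumes s: "sets N1 = sets borel" "sets N2 = sets borel" and f: "finite_measure N1" "finite_measure N2"
    and eq: "\<And>g :: 'a \<Rightarrow> real. continuous_on UNIV g \<Longrightarrow> (\<And>x. 0 \<le> g x \<and> g x \<le> 1) \<Longrightarrow> integral\<^sup>L N1 g = integral\<^sup>L N2 g"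
  shows "N1 = N2"
proof (rule measure_eq_via_closed_sets[OF s f(1)])
  interpret N1: finite_measure N1 by fact
  interpret N2: finite_measure N2 by fact
  fix C :: "'a set" assume C: "closed C"
  show "emeasure N1 C = emeasure N2 C"
  proof (cases "C = {}")
    case False
    define g where "g = (\<lambda>k::nat. \<lambda>x. max 0 (1 - real k * infdist x C))"
    have g: "continuous_on UNIV (g k)" "0 \<le> g k x \<and> g k x \<le> 1" for k x
      by (auto simp: g_def infdist_nonneg intro!: continuous_intros)
    have lim: "(\<lambda>k. g k x) \<longlonglongrightarrow> indicator C x" for x
    proof (cases "x \<in> C")
      case True then show ?thesis by (simp add: g_def)
    next
      case x: False
      then have p: "infdist x C > 0" using C False infdist_pos_not_in_closed by blast
      obtain K where K: "1 < real K * infdist x C" using p ex_less_of_nat_mult by blast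
      have "g k x = 0" if "k \<ge> K" for k
      proof -
        have "real K * infdist x C \<le> real k * infdist x C" using that p by (intro mult_right_mono) auto
        then show ?thesis using K by (simp add: g_def)
      qed
      then have "\<forall>\<^sub>F k in sequentially. g k x = indicator C x"
        using x by (auto simp: eventually_sequentially)
      then show ?thesis by (rule tendsto_eventually)
    qed
    have *: "(\<lambda>k. integral\<^sup>L N (g k)) \<longlonglongrightarrow> measure N C" if N: "sets N = sets borel" "finite_measure N" for N
    proof -
      interpret finite_measure N by fact
      have [measurable_cong]: "sets N = sets borel" by fact
      have [measurable]: "g k \<in> borel_measurable borel" for k using g(1) by (rule borel_measurable_continuous_onI)
      have [measurable]: "C \<in> sets borel" using C by simp
      have "(\<lambda>k. integral\<^sup>L N (g k)) \<longlonglongrightarrow> integral\<^sup>L N (indicator C)"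
        by (rule integral_dominated_convergence[where w="\<lambda>_. 1"]) (use g lim in auto)
      then show ?thesis using N C sets_eq_imp_space_eq[OF N(1)] by (simp add: measure_def)
    qed
    have "measure N1 C = measure N2 C"
      by (rule LIMSEQ_unique[OF *]) (use *[of N2] s f eq[OF g] in auto)
    then show ?thesis by (simp add: N1.emeasure_eq_measure N2.emeasure_eq_measure)
  qed simp
qed

locale wiener =
  fixes \<mu> :: "path measure"
  assumes wiener: "wiener_measure \<mu>"
begin

abbreviation "M \<equiv> completion \<mu>"
abbreviation "F \<equiv> usual_augmentation \<mu>"

sublocale path_measure \<mu>
  using wiener by unfold_locales (auto simp: wiener_measure_def)

sublocale base: prob_space \<mu>
  using wiener unfolding wiener_measure_def by (elim conjE)

sublocale prob_space M
  by (rule base.prob_space_completion)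

lemma space_M: "space M = space borel_W" by (simp add: space_\<nu>)

lemma measurable_eval_\<mu>: "t \<in> {0..1} \<Longrightarrow> (\<lambda>\<omega>. \<omega> t) \<in> borel_measurable \<mu>"
  using measurable_eval measurable_cong_sets[OF sets_\<nu> refl] by blast

lemma start_0: "AE \<omega> in \<mu>. \<omega> 0 = 0"
  using wiener unfolding wiener_measure_def by (elim conjE)

lemma distr_increment:
  assumes "0 \<le> s" "s < t" "t \<le> 1"
  shows "distr M borel (\<lambda>\<omega>. \<omega> t - \<omega> s) = gauss (t - s)"
proof -
  have d: "distributed \<mu> lborel (\<lambda>\<omega>. \<omega> t - \<omega> s) (\<lambda>x. ennreal (gauss_density (t - s) x))"
    using wiener assms unfolding wiener_measure_def gauss_density_def by blast
  have m: "(\<lambda>\<omega>. \<omega> t - \<omega> s) \<in> borel_measurable \<mu>"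
    using assms by (intro borel_measurable_diff measurable_eval_\<mu>) auto
  have "distr M borel (\<lambda>\<omega>. \<omega> t - \<omega> s) = distr \<mu> borel (\<lambda>\<omega>. \<omega> t - \<omega> s)"
    by (rule distr_completion[OF m])
  also have "\<dots> = distr \<mu> lborel (\<lambda>\<omega>. \<omega> t - \<omega> s)" by (rule distr_cong) auto
  also have "\<dots> = gauss (t - s)" using distributed_distr_eq_density[OF d] by (simp add: gauss_def)
  finally show ?thesis .
qed

text \<open>An intersection-stable generator of the past, on which independence can be read off from finitely
  many increments.\<close>

definition cylinders :: "real \<Rightarrow> path set set" where
  "cylinders s = {{\<omega>\<in>space borel_W. \<forall>r\<in>J. \<omega> r \<in> B r} | J B. finite J \<and> J \<subseteq> {0..s} \<and> (\<forall>r. B r \<in> sets borel)}"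

lemma Int_stable_cylinders: "Int_stable (cylinders s)"
  unfolding Int_stable_def
proof safe
  fix a b assume "a \<in> cylinders s" "b \<in> cylinders s"
  then obtain J1 B1 J2 B2 where
    1: "finite J1" "J1 \<subseteq> {0..s}" "\<And>r. B1 r \<in> sets borel" "a = {\<omega>\<in>space borel_W. \<forall>r\<in>J1. \<omega> r \<in> B1 r}" and
    2: "finite J2" "J2 \<subseteq> {0..s}" "\<And>r. B2 r \<in> sets borel" "b = {\<omega>\<in>space borel_W. \<forall>r\<in>J2. \<omega> r \<in> B2 r}"
    unfolding cylinders_def by auto
  define B where "B = (\<lambda>r. (if r \<in> J1 then B1 r else UNIV) \<inter> (if r \<in> J2 then B2 r else UNIV))"
  have "x \<in> B r \<longleftrightarrow> (r \<in> J1 \<longrightarrow> x \<in> B1 r) \<and> (r \<in> J2 \<longrightarrow> x \<in> B2 r)" for x r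
    by (simp add: B_def)
  then have "a \<inter> b = {\<omega>\<in>space borel_W. \<forall>r\<in>J1 \<union> J2. \<omega> r \<in> B r}"
    unfolding 1(4) 2(4) by blast
  moreover have "B r \<in> sets borel" for r unfolding B_def using 1(3)[of r] 2(3)[of r] by auto
  moreover have "finite (J1 \<union> J2)" "J1 \<union> J2 \<subseteq> {0..s}" using 1(1,2) 2(1,2) by auto
  ultimately show "a \<inter> b \<in> cylinders s" unfolding cylinders_def
    by (intro CollectI exI[of _ "J1 \<union> J2"] exI[of _ B]) simp
qed

lemma cylinders_sub: "s \<le> 1 \<Longrightarrow> cylinders s \<subseteq> sets borel_W"
proof
  fix a assume s: "s \<le> 1" and "a \<in> cylinders s"
  then obtain J B where 1: "finite J" "J \<subseteq> {0..s}" "\<And>r. B r \<in> sets borel" "a = {\<omega>\<in>space borel_W. \<forall>r\<in>J. \<omega> r \<in> B r}"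
    unfolding cylinders_def by auto
  have "{\<omega>\<in>space borel_W. \<omega> r \<in> B r} \<in> sets borel_W" if "r \<in> J" for r
  proof -
    have "r \<in> {0..1}" using 1 s that by auto
    from measurable_sets[OF measurable_eval[OF this] 1(3)[of r]] show ?thesis
      by (simp add: vimage_def Int_def conj_commute)
  qed
  then show "a \<in> sets borel_W" unfolding 1
    by (intro sets.sets_Collect_finite_All \<open>finite J\<close>)
qed

lemma sets_natural_cylinders:
  assumes s: "s \<in> {0..1}"
  shows "sets (natural_filtration s) \<subseteq> sigma_sets (space borel_W) (cylinders s)"
  unfolding sets_natural
proof (rule sigma_sets_mono', safe)
  fix r :: real and B :: "(real^3) set" assume r: "r \<in> {0..1}" "r \<le> s" "B \<in> sets borel"
  have "(\<lambda>\<omega>. \<omega> r) -` B \<inter> space borel_W = {\<omega>\<in>space borel_W. \<forall>q\<in>{r}. \<omega> q \<in> (\<lambda>_. B) q}" by auto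
  then show "(\<lambda>\<omega>. \<omega> r) -` B \<inter> space borel_W \<in> cylinders s"
    unfolding cylinders_def using r by (intro CollectI exI[of _ "{r}"] exI[of _ "\<lambda>_. B"]) auto
qed

text \<open>Sort the finitely many times, together with 0, \<open>s\<close> and \<open>t\<close>. Since the path starts at 0 almost
  surely, the cylinder is almost surely an event of the increments up to \<open>s\<close>, and these are
  independent of the last increment.\<close>

lemma cylinder_indep:
  assumes st: "0 \<le> s" "s < t" "t \<le> 1" and a: "a \<in> cylinders s" and C: "C \<in> sets borel"
  shows "base.prob (a \<inter> ((\<lambda>\<omega>. \<omega> t - \<omega> s) -` C \<inter> space \<mu>))
    = base.prob a * base.prob ((\<lambda>\<omega>. \<omega> t - \<omega> s) -` C \<inter> space \<mu>)"
proof -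
  obtain J B where J: "finite J" "J \<subseteq> {0..s}" and B: "\<And>r. B r \<in> sets borel" and a_eq: "a = {\<omega>\<in>space borel_W. \<forall>r\<in>J. \<omega> r \<in> B r}"
    using a unfolding cylinders_def by auto
  define J' where "J' = insert 0 (insert s J)"
  have J': "finite J'" "J' \<subseteq> {0..s}" "J' \<noteq> {}" using J st by (auto simp: J'_def)
  define L where "L = sorted_list_of_set J'"
  define n where "n = length L"
  have L: "set L = J'" "sorted_wrt (<) L" using J' by (auto simp: L_def)
  have n: "n > 0" using L J' by (auto simp: n_def)
  define S where "S = (\<lambda>k. if k < n then L ! k else t)"
  have Lin: "L ! k \<in> {0..s}" if "k < n" for k
    using L J' that nth_mem[of k L] by (auto simp: n_def)
  have incL: "L ! i < L ! j" if "i < j" "j < n" for i j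
    using L(2) that unfolding sorted_wrt_iff_nth_less n_def by blast
  have Sinc: "S k < S (Suc k)" if "k < n" for k
    using that incL[of k "Suc k"] Lin[of k] st by (auto simp: S_def)
  have S0: "S 0 = 0"
  proof -
    have "0 \<in> set L" unfolding L by (simp add: J'_def)
    then obtain i where i: "i < n" "L ! i = 0" by (auto simp: in_set_conv_nth n_def)
    then show ?thesis using incL[of 0 i] Lin[of 0] n by (cases i) (auto simp: S_def)
  qed
  have Sl: "S (n - 1) = s"
  proof -
    have "s \<in> set L" unfolding L by (simp add: J'_def)
    then obtain i where i: "i < n" "L ! i = s" by (auto simp: in_set_conv_nth n_def)
    have "i = n - 1"
    proof (rule ccontr)
      assume "i \<noteq> n - 1"
      then have "L ! i < L ! (n - 1)" using i n by (intro incL) auto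
      then show False using i Lin[of "n - 1"] n by auto
    qed
    then show ?thesis using i by (simp add: S_def)
  qed
  have Sn: "S n = t" by (simp add: S_def)
  define X where "X = (\<lambda>k \<omega>. (\<omega> (S (Suc k)) - \<omega> (S k)) :: real^3)"
  have "base.indep_vars (\<lambda>_. borel) X {..<n}"
    using wiener S0 Sinc Sn st unfolding wiener_measure_def X_def by blast
  from base.indep_var_restrict[OF this, of "{..<n-1}" "{n-1}"]
  have iv: "base.indep_var (PiM {..<n-1} (\<lambda>_. borel)) (\<lambda>\<omega>. restrict (\<lambda>i. X i \<omega>) {..<n-1})
     (PiM {n-1} (\<lambda>_. borel)) (\<lambda>\<omega>. restrict (\<lambda>i. X i \<omega>) {n-1})"
    using n by auto
  define C' where "C' = (\<lambda>y. y (n-1)) -` C \<inter> space (PiM {n-1} (\<lambda>_. borel :: (real^3) measure))"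
  have C': "C' \<in> sets (PiM {n-1} (\<lambda>_. borel))"
    unfolding C'_def using measurable_component_singleton[of "n-1" "{n-1}" "\<lambda>_. borel :: (real^3) measure"] C
    by (auto intro: measurable_sets)
  define idx where "idx = (\<lambda>r. SOME k. k < n \<and> L ! k = r)"
  have idx: "idx r < n" "L ! idx r = r" if "r \<in> J" for r
  proof -
    have "\<exists>k. k < n \<and> L ! k = r" using that L by (auto simp: J'_def n_def in_set_conv_nth[symmetric])
    from someI_ex[OF this] show "idx r < n" "L ! idx r = r" by (auto simp: idx_def)
  qed
  define B' where "B' = {x\<in>space (PiM {..<n-1} (\<lambda>_. borel)). \<forall>r\<in>J. (\<Sum>j<idx r. x j :: real^3) \<in> B r}"
  have B': "B' \<in> sets (PiM {..<n-1} (\<lambda>_. borel))"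
    unfolding B'_def
  proof (rule sets.sets_Collect_finite_All[OF _ \<open>finite J\<close>])
    fix r assume r: "r \<in> J"
    have [measurable]: "B r \<in> sets borel" by (rule B)
    have mj: "(\<lambda>x. x j) \<in> borel_measurable (PiM {..<n-1} (\<lambda>_. borel))" if "j < idx r" for j
      using that idx[OF r] measurable_component_singleton[of j "{..<n-1}" "\<lambda>_. borel :: (real^3) measure"] by auto
    have "(\<lambda>x. \<Sum>j<idx r. x j :: real^3) \<in> borel_measurable (PiM {..<n-1} (\<lambda>_. borel))"
      by (intro borel_measurable_sum mj) auto
    from measurable_sets[OF this B[of r]]
    show "{x \<in> space (PiM {..<n-1} (\<lambda>_. borel)). (\<Sum>j<idx r. x j :: real^3) \<in> B r} \<in> sets (PiM {..<n-1} (\<lambda>_. borel))"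
      by (simp add: vimage_def Int_def conj_commute)
  qed
  let ?A = "(\<lambda>\<omega>. restrict (\<lambda>i. X i \<omega>) {..<n-1}) -` B' \<inter> space \<mu>"
  let ?Y = "(\<lambda>\<omega>. \<omega> t - \<omega> s) -` C \<inter> space \<mu>"
  have eqA: "\<omega> \<in> a \<longleftrightarrow> \<omega> \<in> ?A" if w: "\<omega> 0 = 0" "\<omega> \<in> space \<mu>" for \<omega>
  proof -
    have "(\<Sum>j<idx r. (restrict (\<lambda>i. X i \<omega>) {..<n-1}) j) = \<omega> r" if r: "r \<in> J" for r
    proof -
      have "(\<Sum>j<idx r. (restrict (\<lambda>i. X i \<omega>) {..<n-1}) j) = (\<Sum>j<idx r. X j \<omega>)"
        using idx[OF r] by (intro sum.cong) auto
      also have "\<dots> = \<omega> (S (idx r)) - \<omega> (S 0)"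
        unfolding X_def by (rule sum_lessThan_telescope)
      finally show ?thesis using S0 w idx[OF r] by (simp add: S_def)
    qed
    then show ?thesis using w by (auto simp: a_eq B'_def space_\<nu> space_PiM)
  qed
  have am: "a \<in> sets \<mu>" using a cylinders_sub[of s] st by (auto simp: sets_\<nu>)
  have rv: "(\<lambda>\<omega>. restrict (\<lambda>i. X i \<omega>) {..<n-1}) \<in> measurable \<mu> (PiM {..<n-1} (\<lambda>_. borel))" "(\<lambda>\<omega>. \<omega> t - \<omega> s) \<in> borel_measurable \<mu>"
    using base.indep_var_rv1[OF iv] st by (auto intro!: borel_measurable_diff measurable_eval_\<mu>)
  have Am: "?A \<in> sets \<mu>" "?Y \<in> sets \<mu>" using measurable_sets[OF rv(1) B'] measurable_sets[OF rv(2) C] by auto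
  have ae: "AE \<omega> in \<mu>. \<omega> \<in> a \<longleftrightarrow> \<omega> \<in> ?A"
    using start_0 AE_space eqA by auto
  have "base.prob (a \<inter> ?Y) = base.prob (?A \<inter> ?Y)"
    by (rule base.finite_measure_eq_AE) (use ae am Am in auto)
  also have "?Y = (\<lambda>\<omega>. restrict (\<lambda>i. X i \<omega>) {n-1}) -` C' \<inter> space \<mu>"
    using n Sn Sl by (auto simp: C'_def space_PiM X_def)
  also have "?A \<inter> \<dots> = (\<lambda>x. (restrict (\<lambda>i. X i x) {..<n-1}, restrict (\<lambda>i. X i x) {n-1})) -` (B' \<times> C') \<inter> space \<mu>" by auto
  also have "base.prob \<dots> = base.prob ?A * base.prob ((\<lambda>\<omega>. restrict (\<lambda>i. X i \<omega>) {n-1}) -` C' \<inter> space \<mu>)"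
    by (rule base.indep_varD[OF iv B' C'])
  also have "(\<lambda>\<omega>. restrict (\<lambda>i. X i \<omega>) {n-1}) -` C' \<inter> space \<mu> = ?Y"
    using n Sn Sl by (auto simp: C'_def space_PiM X_def)
  also have "base.prob ?A = base.prob a"
    by (rule base.finite_measure_eq_AE) (use ae am Am in auto)
  finally show ?thesis .
qed

lemma natural_indep:
  assumes st: "0 \<le> s" "s < t" "t \<le> 1" and a: "a \<in> sets (natural_filtration s)" and C: "C \<in> sets borel"
  shows "base.prob (a \<inter> ((\<lambda>\<omega>. \<omega> t - \<omega> s) -` C \<inter> space \<mu>))
    = base.prob a * base.prob ((\<lambda>\<omega>. \<omega> t - \<omega> s) -` C \<inter> space \<mu>)"
proof -
  let ?Y = "{(\<lambda>\<omega>. \<omega> t - \<omega> s) -` C \<inter> space \<mu> | C. C \<in> sets borel}"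
  have m: "(\<lambda>\<omega>. \<omega> t - \<omega> s) \<in> borel_measurable \<mu>"
    using st by (intro borel_measurable_diff measurable_eval_\<mu>) auto
  have "base.indep_set (cylinders s) ?Y"
    by (rule base.indep_setI) (use cylinders_sub[of s] st sets_\<nu> cylinder_indep[OF st] measurable_sets[OF m] in auto)
  then have "base.indep_set (sigma_sets (space \<mu>) (cylinders s)) (sigma_sets (space \<mu>) ?Y)"
  proof (rule base.indep_set_sigma_sets[OF _ Int_stable_cylinders])
    show "Int_stable ?Y"
      unfolding Int_stable_def
    proof safe
      fix C D :: "(real^3) set" assume "C \<in> sets borel" "D \<in> sets borel"
      then show "\<exists>E. (\<lambda>\<omega>. \<omega> t - \<omega> s) -` C \<inter> space \<mu> \<inter> ((\<lambda>\<omega>. \<omega> t - \<omega> s) -` D \<inter> space \<mu>)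
        = (\<lambda>\<omega>. \<omega> t - \<omega> s) -` E \<inter> space \<mu> \<and> E \<in> sets borel"
        by (intro exI[of _ "C \<inter> D"]) auto
    qed
  qed
  moreover have "a \<in> sigma_sets (space \<mu>) (cylinders s)"
    using subsetD[OF sets_natural_cylinders a] st by (simp add: space_\<nu>)
  moreover have "(\<lambda>\<omega>. \<omega> t - \<omega> s) -` C \<inter> space \<mu> \<in> sigma_sets (space \<mu>) ?Y"
    using C by (intro sigma_sets.Basic) blast
  ultimately show ?thesis
    by (rule base.indep_setD)
qed

lemma measurable_eval_M: "t \<in> {0..1} \<Longrightarrow> (\<lambda>\<omega>. \<omega> t) \<in> borel_measurable M"
  by (rule measurable_completion[OF measurable_eval_\<mu>])

lemma natural_indep_integral:
  fixes g :: "real^3 \<Rightarrow> real"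
  assumes st: "0 \<le> s" "s < t" "t \<le> 1" and a: "a \<in> sets (natural_filtration s)"
    and g: "g \<in> borel_measurable borel"
  shows "(\<integral>\<omega>. indicator a \<omega> * g (\<omega> t - \<omega> s) \<partial>M) = prob a * (\<integral>z. g z \<partial>gauss (t - s))"
proof -
  have [measurable]: "g \<in> borel_measurable borel" by fact
  have [measurable]: "(\<lambda>\<omega>. \<omega> t - \<omega> s) \<in> borel_measurable \<mu>"
    using st by (intro borel_measurable_diff measurable_eval_\<mu>) auto
  have [measurable]: "a \<in> sets \<mu>" using a sets_natural_borel_W[of s] by (auto simp: sets_\<nu>)
  let ?Y = "\<lambda>\<omega>. \<omega> t - \<omega> s :: real^3"
  define N1 where "N1 = distr (density \<mu> (indicator a)) borel ?Y"
  define N2 where "N2 = density (distr \<mu> borel ?Y) (\<lambda>_. ennreal (base.prob a))"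
  have "N1 = N2"
  proof (rule measure_eqI)
    show "sets N1 = sets N2" by (simp add: N1_def N2_def)
    fix C assume "C \<in> sets N1"
    then have [measurable]: "C \<in> sets borel" by (simp add: N1_def)
    have "emeasure N1 C = emeasure \<mu> (a \<inter> (?Y -` C \<inter> space \<mu>))"
      unfolding N1_def by (subst emeasure_distr, simp, simp, subst emeasure_density)
        (auto simp: indicator_inter_arith[symmetric] nn_integral_indicator)
    also have "\<dots> = ennreal (base.prob a * base.prob (?Y -` C \<inter> space \<mu>))"
      unfolding base.emeasure_eq_measure natural_indep[OF st a \<open>C \<in> sets borel\<close>] ..
    also have "\<dots> = emeasure N2 C"
      unfolding N2_def by (subst emeasure_density) (auto simp: nn_integral_cmult_indicator emeasure_distr base.emeasure_eq_measure ennreal_mult)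
    finally show "emeasure N1 C = emeasure N2 C" .
  qed
  have "(\<integral>\<omega>. indicator a \<omega> * g (?Y \<omega>) \<partial>M) = (\<integral>\<omega>. indicator a \<omega> * g (?Y \<omega>) \<partial>\<mu>)"
    by (rule integral_completion) measurable
  also have "\<dots> = (\<integral>z. g z \<partial>N1)"
    unfolding N1_def by (subst integral_distr, simp, simp, subst integral_real_density[symmetric])
      (auto simp: ennreal_indicator)
  also have "\<dots> = base.prob a * (\<integral>z. g z \<partial>distr \<mu> borel ?Y)"
    unfolding \<open>N1 = N2\<close> N2_def by (subst integral_density) auto
  also have "distr \<mu> borel ?Y = gauss (t - s)"
    using distr_increment[OF st] by (subst (asm) distr_completion) auto
  finally show ?thesis by simp
qed

lemma integral_gauss_eq:
  fixes g :: "real^3 \<Rightarrow> real"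
  assumes st: "0 \<le> s" "s < t" "t \<le> 1" and [measurable]: "g \<in> borel_measurable borel"
  shows "(\<integral>z. g z \<partial>gauss (t - s)) = (\<integral>\<omega>. g (\<omega> t - \<omega> s) \<partial>M)"
  unfolding distr_increment[OF st, symmetric]
  using st by (subst integral_distr) (auto intro!: borel_measurable_diff measurable_eval_M)

text \<open>The augmentation is a right limit, so an event \<open>a\<close> of the past at \<open>s\<close> is only known to be a
  modification of events of the natural past at later times \<open>r\<close>. Independence from
  \<open>W\<^sub>t - W\<^sub>r\<close> survives the limit \<open>r \<down> s\<close> when it is tested with continuous functions of the increment.\<close>

lemma usual_indep_integral:
  fixes g :: "real^3 \<Rightarrow> real"
  assumes st: "0 \<le> s" "s < t" "t \<le> 1" and a: "a \<in> sets (F s)"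
    and g: "continuous_on UNIV g" "\<And>x. 0 \<le> g x \<and> g x \<le> 1"
  shows "(\<integral>\<omega>. indicator a \<omega> * g (\<omega> t - \<omega> s) \<partial>M) = prob a * (\<integral>\<omega>. g (\<omega> t - \<omega> s) \<partial>M)"
proof -
  have gm [measurable]: "g \<in> borel_measurable borel" by (rule borel_measurable_continuous_onI[OF g(1)])
  define r where "r = (\<lambda>n. s + (t - s) * inverse (real (Suc (Suc n))))"
  have r: "s < r n" "r n < t" for n
  proof -
    have "(t - s) * inverse (real (Suc (Suc n))) < (t - s) * 1"
      using st by (intro mult_strict_left_mono) (auto simp: field_simps)
    then have "r n < s + (t - s)" unfolding r_def by (simp del: of_nat_Suc)
    then show "r n < t" by simp
    show "s < r n" using st by (simp add: r_def)
  qed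
  have rlim: "r \<longlonglongrightarrow> s"
  proof -
    have "(\<lambda>n. inverse (real (Suc (Suc n)))) \<longlonglongrightarrow> 0"
      using LIMSEQ_inverse_real_of_nat by (rule LIMSEQ_Suc)
    then have "r \<longlonglongrightarrow> s + (t - s) * 0" unfolding r_def by (intro tendsto_intros)
    then show ?thesis by simp
  qed
  have [measurable]: "a \<in> sets M" using a sets_usual_completion[of s] by auto
  have e: "(\<integral>\<omega>. indicator a \<omega> * g (\<omega> t - \<omega> (r n)) \<partial>M) = prob a * (\<integral>\<omega>. g (\<omega> t - \<omega> (r n)) \<partial>M)" for n
  proof -
    obtain a' where a': "a' \<in> sets (natural_filtration (r n))" "AE \<omega> in M. \<omega> \<in> a \<longleftrightarrow> \<omega> \<in> a'"
      using usual_modification[OF a r(1)] by blast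
    have [measurable]: "a' \<in> sets M" using a' sets_natural_borel_W[of "r n"] by (auto simp: sets_\<nu>)
    have rr: "0 \<le> r n" "r n < t" "t \<le> 1" using r[of n] st by auto
    have [measurable]: "(\<lambda>\<omega>. \<omega> t - \<omega> (r n)) \<in> borel_measurable M"
      using rr by (intro borel_measurable_diff measurable_eval_M) auto
    have "(\<integral>\<omega>. indicator a \<omega> * g (\<omega> t - \<omega> (r n)) \<partial>M) = (\<integral>\<omega>. indicator a' \<omega> * g (\<omega> t - \<omega> (r n)) \<partial>M)"
      by (rule integral_cong_AE) (use a'(2) in \<open>auto simp: indicator_def\<close>)
    also have "\<dots> = prob a' * (\<integral>\<omega>. g (\<omega> t - \<omega> (r n)) \<partial>M)"
      unfolding natural_indep_integral[OF rr a'(1) gm] integral_gauss_eq[OF rr gm] ..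
    also have "prob a' = prob a" by (rule finite_measure_eq_AE) (use a'(2) in auto)
    finally show ?thesis .
  qed
  have r01: "r n \<in> {0..1}" for n using r[of n] st by auto
  have ww: "(\<lambda>n. g (\<omega> t - \<omega> (r n))) \<longlonglongrightarrow> g (\<omega> t - \<omega> s)" if w: "\<omega> \<in> space M" for \<omega>
  proof -
    have "continuous_on {0..1} \<omega>" using w unfolding space_M space_borel_W mspace_W_metric by simp
    then have "(\<lambda>n. \<omega> (r n)) \<longlonglongrightarrow> \<omega> s"
      by (rule continuous_on_tendsto_compose[OF _ rlim]) (use st r01 in \<open>auto intro!: always_eventually\<close>)
    then have "(\<lambda>n. \<omega> t - \<omega> (r n)) \<longlonglongrightarrow> \<omega> t - \<omega> s" by (intro tendsto_intros)
    then show ?thesis by (rule continuous_on_tendsto_compose[OF g(1)]) auto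
  qed
  have meas: "(\<lambda>\<omega>. g (\<omega> t - \<omega> (r n))) \<in> borel_measurable M" "(\<lambda>\<omega>. g (\<omega> t - \<omega> s)) \<in> borel_measurable M" for n
    using st r[of n] by (auto intro!: measurable_compose[OF _ gm] borel_measurable_diff measurable_eval_M)
  note [measurable] = meas
  have gb: "\<bar>g x\<bar> \<le> 1" for x using g(2)[of x] by auto
  have l1: "(\<lambda>n. \<integral>\<omega>. indicator a \<omega> * g (\<omega> t - \<omega> (r n)) \<partial>M) \<longlonglongrightarrow> (\<integral>\<omega>. indicator a \<omega> * g (\<omega> t - \<omega> s) \<partial>M)"
    by (rule integral_dominated_convergence[where w="\<lambda>_. 1"])
      (auto simp: indicator_def gb intro!: tendsto_intros ww)
  have l2: "(\<lambda>n. \<integral>\<omega>. g (\<omega> t - \<omega> (r n)) \<partial>M) \<longlonglongrightarrow> (\<integral>\<omega>. g (\<omega> t - \<omega> s) \<partial>M)"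
    by (rule integral_dominated_convergence[where w="\<lambda>_. 1"])
      (auto simp: gb intro!: tendsto_intros ww)
  show ?thesis
    by (rule LIMSEQ_unique[OF l1]) (unfold e, intro tendsto_intros l2)
qed

lemma usual_indep:
  assumes st: "0 \<le> s" "s < t" "t \<le> 1" and a: "a \<in> sets (F s)" and C: "C \<in> sets borel"
  shows "prob (a \<inter> ((\<lambda>\<omega>. \<omega> t - \<omega> s) -` C \<inter> space M))
    = prob a * prob ((\<lambda>\<omega>. \<omega> t - \<omega> s) -` C \<inter> space M)"
proof -
  have [measurable]: "(\<lambda>\<omega>. \<omega> t - \<omega> s) \<in> borel_measurable M"
    using st by (intro borel_measurable_diff measurable_eval_M) auto
  have [measurable]: "a \<in> sets M" using a sets_usual_completion[of s] by auto
  have [measurable]: "C \<in> sets borel" by fact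
  let ?Y = "\<lambda>\<omega>. \<omega> t - \<omega> s :: real^3"
  define N1 where "N1 = distr (density M (indicator a)) borel ?Y"
  define N2 where "N2 = density (distr M borel ?Y) (\<lambda>_. ennreal (prob a))"
  have e1: "emeasure N1 C = emeasure M (a \<inter> (?Y -` C \<inter> space M))" if [measurable]: "C \<in> sets borel" for C
  proof -
    have "?Y \<in> borel_measurable M"
      using st by (intro borel_measurable_diff measurable_eval_M) auto
    from measurable_sets[OF this that] have Y: "?Y -` C \<inter> space M \<in> sets M" .
    have "emeasure N1 C = (\<integral>\<^sup>+\<omega>. indicator a \<omega> * indicator (?Y -` C \<inter> space M) \<omega> \<partial>M)"
      unfolding N1_def by (subst emeasure_distr, simp, simp, subst emeasure_density) (use Y in auto)
    also have "\<dots> = (\<integral>\<^sup>+\<omega>. indicator (a \<inter> (?Y -` C \<inter> space M)) \<omega> \<partial>M)"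
      by (simp add: indicator_inter_arith)
    also have "\<dots> = emeasure M (a \<inter> (?Y -` C \<inter> space M))"
      by (rule nn_integral_indicator[OF sets.Int[OF \<open>a \<in> sets M\<close> Y]])
    finally show ?thesis .
  qed
  have e2: "emeasure N2 C = ennreal (prob a * prob (?Y -` C \<inter> space M))" if "C \<in> sets borel" for C
    using that unfolding N2_def by (subst emeasure_density) (auto simp: nn_integral_cmult_indicator emeasure_distr emeasure_eq_measure ennreal_mult)
  have "N1 = N2"
  proof (rule measure_eq_via_continuous)
    show "sets N1 = sets borel" "sets N2 = sets borel" by (auto simp: N1_def N2_def)
    show "finite_measure N1" "finite_measure N2"
      using e1[of UNIV] e2[of UNIV] by (auto intro!: finite_measureI simp: N1_def N2_def emeasure_eq_measure)
    fix g :: "real^3 \<Rightarrow> real" assume g: "continuous_on UNIV g" "\<And>x. 0 \<le> g x \<and> g x \<le> 1"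
    have gm [measurable]: "g \<in> borel_measurable borel" by (rule borel_measurable_continuous_onI[OF g(1)])
    have "(\<integral>z. g z \<partial>N1) = (\<integral>\<omega>. indicator a \<omega> * g (?Y \<omega>) \<partial>M)"
      unfolding N1_def by (subst integral_distr, simp, simp, subst integral_real_density[symmetric])
        (auto simp: ennreal_indicator)
    also have "\<dots> = prob a * (\<integral>\<omega>. g (?Y \<omega>) \<partial>M)" by (rule usual_indep_integral[OF st a g])
    also have "\<dots> = (\<integral>z. g z \<partial>N2)"
      unfolding N2_def by (subst integral_density) (auto simp: integral_distr)
    finally show "integral\<^sup>L N1 g = integral\<^sup>L N2 g" .
  qed
  then show ?thesis using e1[OF C] e2[OF C] by (simp add: emeasure_eq_measure)
qed

text \<open>Independence in the form in which it is used: relative to the past at \<open>s\<close>, an increment behaves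
  like an additional integration variable with a Gaussian law.\<close>

lemma joint_law:
  assumes st: "0 \<le> s" "s < t" "t \<le> 1"
  shows "distr M (F s \<Otimes>\<^sub>M borel) (\<lambda>\<omega>. (\<omega>, \<omega> t - \<omega> s)) = distr M (F s) (\<lambda>\<omega>. \<omega>) \<Otimes>\<^sub>M gauss (t - s)"
proof -
  let ?Y = "\<lambda>\<omega>. \<omega> t - \<omega> s :: real^3"
  have idm: "(\<lambda>\<omega>. \<omega>) \<in> measurable M (F s)"
    by (rule measurable_usual_completion[of _ s]) simp
  have Ym: "?Y \<in> borel_measurable M"
    using st by (intro borel_measurable_diff measurable_eval_M) auto
  interpret A: prob_space "distr M (F s) (\<lambda>\<omega>. \<omega>)" by (rule prob_space_distr[OF idm])
  interpret B: prob_space "gauss (t - s)" using st by (intro prob_space_gauss) auto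
  have pm: "(\<lambda>\<omega>. (\<omega>, ?Y \<omega>)) \<in> measurable M (F s \<Otimes>\<^sub>M borel)" using idm Ym by (rule measurable_Pair)
  show ?thesis
  proof (rule pair_measure_eqI[symmetric])
    fix A C assume "A \<in> sets (distr M (F s) (\<lambda>\<omega>. \<omega>))" "C \<in> sets (gauss (t - s))"
    then have A: "A \<in> sets (F s)" and C: "C \<in> sets borel" by auto
    have AM: "A \<inter> space M = A" using sets.sets_into_space[OF A] by (auto simp: space_\<nu>)
    have "emeasure (distr M (F s) (\<lambda>\<omega>. \<omega>)) A * emeasure (gauss (t - s)) C = ennreal (prob A * prob (?Y -` C \<inter> space M))"
      unfolding distr_increment[OF st, symmetric] emeasure_distr[OF Ym C] emeasure_distr[OF idm A]
      using AM by (simp add: emeasure_eq_measure ennreal_mult del: space_completion)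
    also have "\<dots> = emeasure M (A \<inter> (?Y -` C \<inter> space M))"
      unfolding usual_indep[OF st A C, symmetric] emeasure_eq_measure ..
    also have "A \<inter> (?Y -` C \<inter> space M) = (\<lambda>\<omega>. (\<omega>, ?Y \<omega>)) -` (A \<times> C) \<inter> space M" by auto
    also have "emeasure M \<dots> = emeasure (distr M (F s \<Otimes>\<^sub>M borel) (\<lambda>\<omega>. (\<omega>, ?Y \<omega>))) (A \<times> C)"
      using A C by (intro emeasure_distr[symmetric] pm) auto
    finally show "emeasure (distr M (F s) (\<lambda>\<omega>. \<omega>)) A * emeasure (gauss (t - s)) C
      = emeasure (distr M (F s \<Otimes>\<^sub>M borel) (\<lambda>\<omega>. (\<omega>, ?Y \<omega>))) (A \<times> C)" .
  qed (auto simp: A.sigma_finite_measure_axioms B.sigma_finite_measure_axioms intro!: sets_pair_measure_cong)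
qed

end

section \<open>The Ito isometry\<close>

context wiener begin

lemma measurable_incr_M:
  "0 \<le> s \<Longrightarrow> s \<le> t \<Longrightarrow> t \<le> 1 \<Longrightarrow> (\<lambda>\<omega>. \<omega> t - \<omega> s) \<in> borel_measurable M"
  by (intro borel_measurable_diff measurable_eval_M) auto

lemma measurable_incr_F:
  "0 \<le> s \<Longrightarrow> s \<le> t \<Longrightarrow> t \<le> 1 \<Longrightarrow> (\<lambda>\<omega>. \<omega> t - \<omega> s) \<in> borel_measurable (F t)"
  by (intro borel_measurable_diff measurable_eval_usual) auto

lemma
  assumes st: "0 \<le> s" "s < t" "t \<le> 1"
  shows nn_integral_indep: "\<And>\<Phi> :: path \<Rightarrow> real^3 \<Rightarrow> ennreal. (\<lambda>(\<omega>, z). \<Phi> \<omega> z) \<in> borel_measurable (F s \<Otimes>\<^sub>M borel) \<Longrightarrow>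
      (\<integral>\<^sup>+\<omega>. \<Phi> \<omega> (\<omega> t - \<omega> s) \<partial>M) = (\<integral>\<^sup>+\<omega>. (\<integral>\<^sup>+z. \<Phi> \<omega> z \<partial>gauss (t - s)) \<partial>M)"
    and integral_indep: "\<And>\<Phi> :: path \<Rightarrow> real^3 \<Rightarrow> real. (\<lambda>(\<omega>, z). \<Phi> \<omega> z) \<in> borel_measurable (F s \<Otimes>\<^sub>M borel) \<Longrightarrow>
      integrable M (\<lambda>\<omega>. \<Phi> \<omega> (\<omega> t - \<omega> s)) \<Longrightarrow>
      (\<integral>\<omega>. \<Phi> \<omega> (\<omega> t - \<omega> s) \<partial>M) = (\<integral>\<omega>. (\<integral>z. \<Phi> \<omega> z \<partial>gauss (t - s)) \<partial>M)"
proof -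
  let ?Y = "\<lambda>\<omega>. \<omega> t - \<omega> s :: real^3"
  have idm: "(\<lambda>\<omega>. \<omega>) \<in> measurable M (F s)"
    by (rule measurable_usual_completion[of _ s]) simp
  have Ym: "?Y \<in> borel_measurable M" using st by (intro measurable_incr_M) auto
  interpret A: prob_space "distr M (F s) (\<lambda>\<omega>. \<omega>)" by (rule prob_space_distr[OF idm])
  interpret B: prob_space "gauss (t - s)" using st by (intro prob_space_gauss) auto
  interpret AB: pair_sigma_finite "distr M (F s) (\<lambda>\<omega>. \<omega>)" "gauss (t - s)" ..
  have pm: "(\<lambda>\<omega>. (\<omega>, ?Y \<omega>)) \<in> measurable M (F s \<Otimes>\<^sub>M borel)" using idm Ym by (rule measurable_Pair)
  have sc: "sets (distr M (F s) (\<lambda>\<omega>. \<omega>) \<Otimes>\<^sub>M gauss (t - s)) = sets (F s \<Otimes>\<^sub>M borel)"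
    by (intro sets_pair_measure_cong) auto
  have sc2: "sets (F s \<Otimes>\<^sub>M gauss (t - s)) = sets (F s \<Otimes>\<^sub>M borel)"
    by (intro sets_pair_measure_cong) auto
  note jl = joint_law[OF st]
  { fix \<Phi> :: "path \<Rightarrow> real^3 \<Rightarrow> ennreal" assume m: "(\<lambda>(\<omega>, z). \<Phi> \<omega> z) \<in> borel_measurable (F s \<Otimes>\<^sub>M borel)"
    have m': "(\<lambda>\<omega>. \<integral>\<^sup>+z. \<Phi> \<omega> z \<partial>gauss (t - s)) \<in> borel_measurable (F s)"
      by (rule B.borel_measurable_nn_integral) (use m in \<open>simp add: measurable_cong_sets[OF sc2 refl]\<close>)
    have "(\<integral>\<^sup>+\<omega>. \<Phi> \<omega> (\<omega> t - \<omega> s) \<partial>M) = (\<integral>\<^sup>+x. (\<lambda>(\<omega>, z). \<Phi> \<omega> z) x \<partial>distr M (F s \<Otimes>\<^sub>M borel) (\<lambda>\<omega>. (\<omega>, ?Y \<omega>)))"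
      by (subst nn_integral_distr[OF pm]) (use m in simp_all)
    also have "\<dots> = (\<integral>\<^sup>+\<omega>. (\<integral>\<^sup>+z. \<Phi> \<omega> z \<partial>gauss (t - s)) \<partial>distr M (F s) (\<lambda>\<omega>. \<omega>))"
      unfolding jl by (subst B.nn_integral_fst[symmetric]) (use m in \<open>simp_all add: measurable_cong_sets[OF sc refl]\<close>)
    also have "\<dots> = (\<integral>\<^sup>+\<omega>. (\<integral>\<^sup>+z. \<Phi> \<omega> z \<partial>gauss (t - s)) \<partial>M)"
      by (rule nn_integral_distr[OF idm]) (use m' in simp)
    finally show "(\<integral>\<^sup>+\<omega>. \<Phi> \<omega> (\<omega> t - \<omega> s) \<partial>M) = (\<integral>\<^sup>+\<omega>. (\<integral>\<^sup>+z. \<Phi> \<omega> z \<partial>gauss (t - s)) \<partial>M)" . }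
  { fix \<Phi> :: "path \<Rightarrow> real^3 \<Rightarrow> real" assume m: "(\<lambda>(\<omega>, z). \<Phi> \<omega> z) \<in> borel_measurable (F s \<Otimes>\<^sub>M borel)"
     and i: "integrable M (\<lambda>\<omega>. \<Phi> \<omega> (\<omega> t - \<omega> s))"
    have m': "(\<lambda>\<omega>. \<integral>z. \<Phi> \<omega> z \<partial>gauss (t - s)) \<in> borel_measurable (F s)"
      by (rule B.borel_measurable_lebesgue_integral) (use m in \<open>simp add: measurable_cong_sets[OF sc2 refl]\<close>)
    have "integrable (distr M (F s \<Otimes>\<^sub>M borel) (\<lambda>\<omega>. (\<omega>, ?Y \<omega>))) (\<lambda>(\<omega>, z). \<Phi> \<omega> z)"
      by (subst integrable_distr_eq[OF pm m]) (use i in simp)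
    then have i': "integrable (distr M (F s) (\<lambda>\<omega>. \<omega>) \<Otimes>\<^sub>M gauss (t - s)) (\<lambda>(\<omega>, z). \<Phi> \<omega> z)" unfolding jl .
    have "(\<integral>\<omega>. \<Phi> \<omega> (\<omega> t - \<omega> s) \<partial>M) = (\<integral>x. (\<lambda>(\<omega>, z). \<Phi> \<omega> z) x \<partial>distr M (F s \<Otimes>\<^sub>M borel) (\<lambda>\<omega>. (\<omega>, ?Y \<omega>)))"
      by (subst integral_distr[OF pm m]) simp
    also have "\<dots> = (\<integral>\<omega>. (\<integral>z. \<Phi> \<omega> z \<partial>gauss (t - s)) \<partial>distr M (F s) (\<lambda>\<omega>. \<omega>))"
      unfolding jl by (subst AB.integral_fst[OF i', symmetric]) simp
    also have "\<dots> = (\<integral>\<omega>. (\<integral>z. \<Phi> \<omega> z \<partial>gauss (t - s)) \<partial>M)"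
      by (rule integral_distr[OF idm m'])
    finally show "(\<integral>\<omega>. \<Phi> \<omega> (\<omega> t - \<omega> s) \<partial>M) = (\<integral>\<omega>. (\<integral>z. \<Phi> \<omega> z \<partial>gauss (t - s)) \<partial>M)" . }
qed

lemma integrable_incr_norm_sq:
  assumes st: "0 \<le> s" "s \<le> t" "t \<le> 1"
  shows "integrable M (\<lambda>\<omega>. (norm (\<omega> t - \<omega> s))\<^sup>2)"
proof (cases "s = t")
  case False
  then have st': "0 \<le> s" "s < t" "t \<le> 1" using st by auto
  have "integrable (gauss (t - s)) (\<lambda>z. \<Sum>i\<in>UNIV. (z $ i)^2)"
    using st' by (intro Bochner_Integration.integrable_sum integrable_gauss_coord_power) auto
  then have "integrable (gauss (t - s)) (\<lambda>z. (norm z)\<^sup>2)"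
    unfolding power2_norm_eq_inner inner_vec_def by (simp add: power2_eq_square)
  then show ?thesis unfolding distr_increment[OF st', symmetric]
    by (subst (asm) integrable_distr_eq) (use st measurable_incr_M in auto)
qed simp

lemma integrable_mult_L2:
  fixes f g :: "path \<Rightarrow> real"
  assumes [measurable]: "f \<in> borel_measurable M" "g \<in> borel_measurable M"
    and i: "integrable M (\<lambda>\<omega>. (f \<omega>)\<^sup>2)" "integrable M (\<lambda>\<omega>. (g \<omega>)\<^sup>2)"
  shows "integrable M (\<lambda>\<omega>. f \<omega> * g \<omega>)"
proof (rule Bochner_Integration.integrable_bound[OF Bochner_Integration.integrable_add[OF i]])
  show "AE \<omega> in M. norm (f \<omega> * g \<omega>) \<le> norm ((f \<omega>)\<^sup>2 + (g \<omega>)\<^sup>2)"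
  proof (rule AE_I2)
    fix \<omega>
    have "2 * \<bar>f \<omega>\<bar> * \<bar>g \<omega>\<bar> \<le> \<bar>f \<omega>\<bar>\<^sup>2 + \<bar>g \<omega>\<bar>\<^sup>2" by (rule sum_squares_bound)
    then have "2 * (\<bar>f \<omega>\<bar> * \<bar>g \<omega>\<bar>) \<le> (f \<omega>)\<^sup>2 + (g \<omega>)\<^sup>2" by (simp add: mult.assoc)
    moreover have "0 \<le> \<bar>f \<omega>\<bar> * \<bar>g \<omega>\<bar>" by (intro mult_nonneg_nonneg) auto
    ultimately have "\<bar>f \<omega>\<bar> * \<bar>g \<omega>\<bar> \<le> (f \<omega>)\<^sup>2 + (g \<omega>)\<^sup>2" by linarith
    then show "norm (f \<omega> * g \<omega>) \<le> norm ((f \<omega>)\<^sup>2 + (g \<omega>)\<^sup>2)"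
      by (simp add: abs_mult)
  qed
qed measurable

text \<open>The integrand \<open>\<xi>\<close> is switched on only during \<open>]a,b]\<close>; degenerate intervals are allowed, so that
  intervals can be cut freely.\<close>

definition elementary :: "real \<Rightarrow> real \<Rightarrow> (path \<Rightarrow> real^3) \<Rightarrow> bool" where
  "elementary a b \<xi> \<longleftrightarrow> 0 \<le> a \<and> a \<le> b \<and> b \<le> 1 \<and> \<xi> \<in> borel_measurable (F a) \<and> bounded (\<xi> ` space M)"

abbreviation step_int :: "real \<Rightarrow> real \<Rightarrow> (path \<Rightarrow> real^3) \<Rightarrow> path \<Rightarrow> real" where
  "step_int a b \<xi> \<omega> \<equiv> \<xi> \<omega> \<bullet> (\<omega> b - \<omega> a)"

lemma elementary_bound:
  assumes "elementary a b \<xi>"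
  obtains K where "K \<ge> 0" "\<And>\<omega>. \<omega> \<in> space M \<Longrightarrow> norm (\<xi> \<omega>) \<le> K"
proof -
  have "bounded (\<xi> ` space M)" using assms by (simp add: elementary_def)
  then obtain K where "K > 0" "\<forall>x\<in>\<xi> ` space M. norm x \<le> K" unfolding bounded_pos by blast
  then show thesis by (intro that[of K]) auto
qed

lemma elementary_measurable_M: "elementary a b \<xi> \<Longrightarrow> \<xi> \<in> borel_measurable M"
  unfolding elementary_def by (elim conjE) (rule measurable_usual_completion)

lemma elementary_mono:
  assumes e: "elementary a b \<xi>" and le: "a \<le> a'" "a' \<le> b'" "b' \<le> 1"
  shows "elementary a' b' \<xi>"
proof -
  have "\<xi> \<in> borel_measurable (F a)" using e by (simp add: elementary_def)
  from measurable_usual_mono[OF this le(1)] show ?thesis using e le by (simp add: elementary_def)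
qed

lemma step_int_measurable_F:
  assumes e: "elementary a b \<xi>" and bc: "b \<le> c"
  shows "step_int a b \<xi> \<in> borel_measurable (F c)"
proof (rule borel_measurable_inner)
  have ab: "0 \<le> a" "a \<le> b" "b \<le> 1" and m: "\<xi> \<in> borel_measurable (F a)" using e by (simp_all add: elementary_def)
  show "\<xi> \<in> borel_measurable (F c)" using ab bc by (intro measurable_usual_mono[OF m]) simp
  show "(\<lambda>\<omega>. \<omega> b - \<omega> a) \<in> borel_measurable (F c)"
    by (rule measurable_usual_mono[OF measurable_incr_F[OF ab] bc])
qed

lemma step_int_measurable_M: "elementary a b \<xi> \<Longrightarrow> step_int a b \<xi> \<in> borel_measurable M"
  using measurable_usual_completion[OF step_int_measurable_F[OF _ order_refl]] .

lemma step_int_L2: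
  assumes e: "elementary a b \<xi>"
  shows "integrable M (\<lambda>\<omega>. (step_int a b \<xi> \<omega>)\<^sup>2)"
proof -
  obtain K where K: "K \<ge> 0" "\<And>\<omega>. \<omega> \<in> space M \<Longrightarrow> norm (\<xi> \<omega>) \<le> K" using elementary_bound[OF e] by blast
  have [measurable]: "step_int a b \<xi> \<in> borel_measurable M" using e by (rule step_int_measurable_M)
  show ?thesis
  proof (rule Bochner_Integration.integrable_bound)
    show "integrable M (\<lambda>\<omega>. K\<^sup>2 * (norm (\<omega> b - \<omega> a))\<^sup>2)"
      using e by (intro integrable_mult_right integrable_incr_norm_sq) (auto simp: elementary_def)
    show "AE \<omega> in M. norm ((step_int a b \<xi> \<omega>)\<^sup>2) \<le> norm (K\<^sup>2 * (norm (\<omega> b - \<omega> a))\<^sup>2)"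
    proof (rule AE_I2)
      fix \<omega> assume w: "\<omega> \<in> space M"
      have "\<bar>step_int a b \<xi> \<omega>\<bar> \<le> norm (\<xi> \<omega>) * norm (\<omega> b - \<omega> a)" by (rule Cauchy_Schwarz_ineq2)
      also have "\<dots> \<le> K * norm (\<omega> b - \<omega> a)" using K(2)[OF w] by (intro mult_right_mono) auto
      finally have "\<bar>step_int a b \<xi> \<omega>\<bar>\<^sup>2 \<le> (K * norm (\<omega> b - \<omega> a))\<^sup>2" by (intro power_mono) auto
      then show "norm ((step_int a b \<xi> \<omega>)\<^sup>2) \<le> norm (K\<^sup>2 * (norm (\<omega> b - \<omega> a))\<^sup>2)" by (simp add: power_mult_distrib)
    qed
  qed measurable
qed

lemma integrable_step_int_mult:
  "elementary a b \<xi> \<Longrightarrow> elementary c d \<eta> \<Longrightarrow> integrable M (\<lambda>\<omega>. step_int a b \<xi> \<omega> * step_int c d \<eta> \<omega>)"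
  by (intro integrable_mult_L2 step_int_measurable_M step_int_L2)

lemma integrable_elementary_inner:
  assumes "elementary a b \<xi>" "elementary c d \<eta>" shows "integrable M (\<lambda>\<omega>. \<xi> \<omega> \<bullet> \<eta> \<omega>)"
proof -
  obtain K where K: "K \<ge> 0" "\<And>\<omega>. \<omega> \<in> space M \<Longrightarrow> norm (\<xi> \<omega>) \<le> K" using elementary_bound[OF assms(1)] by blast
  obtain L where L: "L \<ge> 0" "\<And>\<omega>. \<omega> \<in> space M \<Longrightarrow> norm (\<eta> \<omega>) \<le> L" using elementary_bound[OF assms(2)] by blast
  have [measurable]: "\<xi> \<in> borel_measurable M" "\<eta> \<in> borel_measurable M" using assms elementary_measurable_M by auto
  have "\<bar>\<xi> \<omega> \<bullet> \<eta> \<omega>\<bar> \<le> K * L" if "\<omega> \<in> space M" for \<omega>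
    using Cauchy_Schwarz_ineq2[of "\<xi> \<omega>" "\<eta> \<omega>"] mult_mono[OF K(2)[OF that] L(2)[OF that]] K(1) by force
  then show ?thesis by (intro integrable_const_bound[where B="K * L"]) auto
qed

text \<open>Later increments are centered given the past.\<close>

lemma integral_past_times_step_int:
  assumes V: "V \<in> borel_measurable (F c)" "integrable M (\<lambda>\<omega>. (V \<omega>)\<^sup>2)" and e: "elementary c d \<eta>"
  shows "(\<integral>\<omega>. V \<omega> * step_int c d \<eta> \<omega> \<partial>M) = 0"
proof (cases "c = d")
  case False
  then have cd: "0 \<le> c" "c < d" "d \<le> 1" using e by (auto simp: elementary_def)
  have [measurable]: "V \<in> borel_measurable (F c)" "\<eta> \<in> borel_measurable (F c)" using V e by (auto simp: elementary_def)
  have m: "(\<lambda>(\<omega>, z). V \<omega> * (\<eta> \<omega> \<bullet> z)) \<in> borel_measurable (F c \<Otimes>\<^sub>M borel)" by measurable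
  have i: "integrable M (\<lambda>\<omega>. V \<omega> * step_int c d \<eta> \<omega>)"
    by (intro integrable_mult_L2 step_int_measurable_M step_int_L2 measurable_usual_completion[OF V(1)] V(2) e)
  have "(\<integral>\<omega>. V \<omega> * step_int c d \<eta> \<omega> \<partial>M) = (\<integral>\<omega>. (\<integral>z. V \<omega> * (\<eta> \<omega> \<bullet> z) \<partial>gauss (d - c)) \<partial>M)"
    by (rule integral_indep[OF cd m i])
  also have "\<dots> = 0" using cd by (simp add: integral_gauss_inner)
  finally show ?thesis .
qed simp

lemma integral_step_int_same:
  assumes e: "elementary c d \<xi>" "elementary c d \<eta>"
  shows "(\<integral>\<omega>. step_int c d \<xi> \<omega> * step_int c d \<eta> \<omega> \<partial>M) = (d - c) * (\<integral>\<omega>. \<xi> \<omega> \<bullet> \<eta> \<omega> \<partial>M)"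
proof (cases "c = d")
  case False
  then have cd: "0 \<le> c" "c < d" "d \<le> 1" using e by (auto simp: elementary_def)
  have [measurable]: "\<xi> \<in> borel_measurable (F c)" "\<eta> \<in> borel_measurable (F c)" using e by (auto simp: elementary_def)
  have m: "(\<lambda>(\<omega>, z). (\<xi> \<omega> \<bullet> z) * (\<eta> \<omega> \<bullet> z)) \<in> borel_measurable (F c \<Otimes>\<^sub>M borel)" by measurable
  have "(\<integral>\<omega>. step_int c d \<xi> \<omega> * step_int c d \<eta> \<omega> \<partial>M) = (\<integral>\<omega>. (\<integral>z. (\<xi> \<omega> \<bullet> z) * (\<eta> \<omega> \<bullet> z) \<partial>gauss (d - c)) \<partial>M)"
    by (rule integral_indep[OF cd m integrable_step_int_mult[OF e]])
  also have "\<dots> = (d - c) * (\<integral>\<omega>. \<xi> \<omega> \<bullet> \<eta> \<omega> \<partial>M)" using cd by (simp add: integral_gauss_inner_mult)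
  finally show ?thesis .
qed simp

definition overlap :: "real \<Rightarrow> real \<Rightarrow> real \<Rightarrow> real \<Rightarrow> real" where
  "overlap a b c d = max 0 (min b d - max a c)"

text \<open>Cut both intervals at their common end points. All pairs of disjoint pieces are orthogonal, which
  leaves the overlap.\<close>

lemma integral_step_int_overlap_aux:
  assumes e: "elementary a b \<xi>" "elementary c d \<eta>" and ac: "a \<le> c"
  shows "(\<integral>\<omega>. step_int a b \<xi> \<omega> * step_int c d \<eta> \<omega> \<partial>M) = overlap a b c d * (\<integral>\<omega>. \<xi> \<omega> \<bullet> \<eta> \<omega> \<partial>M)"
proof -
  have ab: "0 \<le> a" "a \<le> b" "b \<le> 1" "0 \<le> c" "c \<le> d" "d \<le> 1" using e by (auto simp: elementary_def)
  show ?thesis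
  proof (cases "b \<le> c")
    case True
    have "overlap a b c d = 0" using True ab by (auto simp: overlap_def)
    then show ?thesis
      using integral_past_times_step_int[OF step_int_measurable_F[OF e(1) True] step_int_L2[OF e(1)] e(2)] by simp
  next
    case False
    define m where "m = min b d"
    have m: "c \<le> m" "m \<le> b" "m \<le> d" "m = b \<or> m = d" "m \<le> 1" using False ab by (auto simp: m_def)
    have ov: "overlap a b c d = m - c" using m ab ac by (auto simp: overlap_def m_def)
    have e1: "elementary a c \<xi>" and e2: "elementary c m \<xi>" and e3: "elementary m b \<xi>"
      and f1: "elementary c m \<eta>" and f2: "elementary m d \<eta>"
      using e ab ac m False by (auto intro: elementary_mono[OF e(1)] elementary_mono[OF e(2)])
    have d1: "step_int a b \<xi> \<omega> = step_int a c \<xi> \<omega> + step_int c m \<xi> \<omega> + step_int m b \<xi> \<omega>" for \<omega> by (simp add: inner_diff_right)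
    have d2: "step_int c d \<eta> \<omega> = step_int c m \<eta> \<omega> + step_int m d \<eta> \<omega>" for \<omega> by (simp add: inner_diff_right)
    have "(\<lambda>\<omega>. step_int a b \<xi> \<omega> * step_int c d \<eta> \<omega>) = (\<lambda>\<omega>. step_int a c \<xi> \<omega> * step_int c d \<eta> \<omega> + step_int c m \<xi> \<omega> * step_int c m \<eta> \<omega>
        + step_int c m \<xi> \<omega> * step_int m d \<eta> \<omega> + step_int m b \<xi> \<omega> * step_int c d \<eta> \<omega>)"
      unfolding d1 unfolding d2 by (auto simp: algebra_simps)
    then have "(\<integral>\<omega>. step_int a b \<xi> \<omega> * step_int c d \<eta> \<omega> \<partial>M) = (\<integral>\<omega>. step_int a c \<xi> \<omega> * step_int c d \<eta> \<omega> \<partial>M)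
       + (\<integral>\<omega>. step_int c m \<xi> \<omega> * step_int c m \<eta> \<omega> \<partial>M) + (\<integral>\<omega>. step_int c m \<xi> \<omega> * step_int m d \<eta> \<omega> \<partial>M)
       + (\<integral>\<omega>. step_int m b \<xi> \<omega> * step_int c d \<eta> \<omega> \<partial>M)"
      using e e1 e2 e3 f1 f2 by (simp add: integrable_step_int_mult)
    also have "(\<integral>\<omega>. step_int a c \<xi> \<omega> * step_int c d \<eta> \<omega> \<partial>M) = 0"
      by (rule integral_past_times_step_int[OF step_int_measurable_F[OF e1] step_int_L2[OF e1] e(2)]) simp
    also have "(\<integral>\<omega>. step_int c m \<xi> \<omega> * step_int m d \<eta> \<omega> \<partial>M) = 0"
      by (rule integral_past_times_step_int[OF step_int_measurable_F[OF e2] step_int_L2[OF e2] f2]) simp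
    also have "(\<integral>\<omega>. step_int m b \<xi> \<omega> * step_int c d \<eta> \<omega> \<partial>M) = 0"
    proof (cases "m = b")
      case False
      then have "m = d" using m by auto
      then have "step_int c d \<eta> \<in> borel_measurable (F m)" using step_int_measurable_F[OF e(2)] by simp
      from integral_past_times_step_int[OF this step_int_L2[OF e(2)] e3] show ?thesis by (simp add: mult.commute)
    qed simp
    also have "(\<integral>\<omega>. step_int c m \<xi> \<omega> * step_int c m \<eta> \<omega> \<partial>M) = (m - c) * (\<integral>\<omega>. \<xi> \<omega> \<bullet> \<eta> \<omega> \<partial>M)"
      by (rule integral_step_int_same[OF e2 f1])
    finally show ?thesis unfolding ov by simp
  qed
qed

lemma integral_step_int_overlap:
  assumes e: "elementary a b \<xi>" "elementary c d \<eta>"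
  shows "(\<integral>\<omega>. step_int a b \<xi> \<omega> * step_int c d \<eta> \<omega> \<partial>M) = overlap a b c d * (\<integral>\<omega>. \<xi> \<omega> \<bullet> \<eta> \<omega> \<partial>M)"
proof (cases "a \<le> c")
  case True with integral_step_int_overlap_aux[OF e] show ?thesis by simp
next
  case False
  then show ?thesis using integral_step_int_overlap_aux[OF e(2,1)]
    by (simp add: mult.commute inner_commute overlap_def min.commute max.commute)
qed

lemma integral_indicator_overlap:
  "integrable lborel (\<lambda>t. indicator {a<..b} t * indicator {c<..d} t :: real)"
  "(\<integral>t. indicator {a<..b} t * indicator {c<..d} t \<partial>lborel) = overlap a b c d"
proof -
  have *: "(\<lambda>t. indicator {a<..b} t * indicator {c<..d} t :: real) = indicator {max a c<..min b d}"
    by (auto simp: indicator_def fun_eq_iff)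
  show "integrable lborel (\<lambda>t. indicator {a<..b} t * indicator {c<..d} t :: real)"
    unfolding * by (cases "max a c \<le> min b d") (auto simp del: max.bounded_iff)
  show "(\<integral>t. indicator {a<..b} t * indicator {c<..d} t \<partial>lborel) = overlap a b c d"
    unfolding * overlap_def by (cases "max a c \<le> min b d") (auto simp: max_def[of 0])
qed

text \<open>The intervals may overlap arbitrarily. In this form the isometry applies directly to the difference
  of two simple processes on different partitions, without a common refinement.\<close>

theorem ito_isometry:
  assumes J: "finite J" and e: "\<And>j. j \<in> J \<Longrightarrow> elementary (a j) (b j) (\<xi> j)"
  shows "(\<integral>\<^sup>+\<omega>. ennreal ((\<Sum>j\<in>J. step_int (a j) (b j) (\<xi> j) \<omega>)\<^sup>2) \<partial>M)
    = (\<integral>\<^sup>+\<omega>. (\<integral>\<^sup>+t\<in>{0..1}. ennreal ((norm (\<Sum>j\<in>J. indicator {a j<..b j} t *\<^sub>R \<xi> j \<omega>))\<^sup>2) \<partial>lborel) \<partial>M)"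
proof -
  let ?o = "\<lambda>i j. overlap (a i) (b i) (a j) (b j)"
  let ?S = "\<lambda>\<omega>. \<Sum>i\<in>J. \<Sum>j\<in>J. ?o i j * (\<xi> i \<omega> \<bullet> \<xi> j \<omega>)"
  have sq: "(\<Sum>j\<in>J. step_int (a j) (b j) (\<xi> j) \<omega>)\<^sup>2 = (\<Sum>i\<in>J. \<Sum>j\<in>J. step_int (a i) (b i) (\<xi> i) \<omega> * step_int (a j) (b j) (\<xi> j) \<omega>)" for \<omega>
    by (simp add: power2_eq_square sum_product)
  have iS: "integrable M ?S" using e by (intro Bochner_Integration.integrable_sum integrable_mult_right integrable_elementary_inner) auto
  have i1: "integrable M (\<lambda>\<omega>. (\<Sum>j\<in>J. step_int (a j) (b j) (\<xi> j) \<omega>)\<^sup>2)"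
    unfolding sq using e by (intro Bochner_Integration.integrable_sum integrable_step_int_mult) auto
  have ii: "integrable M (\<lambda>\<omega>. \<xi> i \<omega> \<bullet> \<xi> j \<omega>)"
    and ie: "integrable M (\<lambda>\<omega>. step_int (a i) (b i) (\<xi> i) \<omega> * step_int (a j) (b j) (\<xi> j) \<omega>)"
    and eo: "(\<integral>\<omega>. step_int (a i) (b i) (\<xi> i) \<omega> * step_int (a j) (b j) (\<xi> j) \<omega> \<partial>M) = ?o i j * (\<integral>\<omega>. \<xi> i \<omega> \<bullet> \<xi> j \<omega> \<partial>M)"
    if "i \<in> J" "j \<in> J" for i j
    using integrable_elementary_inner[OF e e] integrable_step_int_mult[OF e e] integral_step_int_overlap[OF e e] that by blast+
  have "(\<integral>\<omega>. (\<Sum>j\<in>J. step_int (a j) (b j) (\<xi> j) \<omega>)\<^sup>2 \<partial>M)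
    = (\<Sum>i\<in>J. \<Sum>j\<in>J. (\<integral>\<omega>. step_int (a i) (b i) (\<xi> i) \<omega> * step_int (a j) (b j) (\<xi> j) \<omega> \<partial>M))"
    unfolding sq by (simp add: Bochner_Integration.integral_sum Bochner_Integration.integrable_sum ie)
  also have "\<dots> = (\<Sum>i\<in>J. \<Sum>j\<in>J. ?o i j * (\<integral>\<omega>. \<xi> i \<omega> \<bullet> \<xi> j \<omega> \<partial>M))"
    by (intro sum.cong refl eo)
  also have "\<dots> = (\<integral>\<omega>. ?S \<omega> \<partial>M)"
    by (simp add: Bochner_Integration.integral_sum Bochner_Integration.integrable_sum ii)
  finally have E: "(\<integral>\<omega>. (\<Sum>j\<in>J. step_int (a j) (b j) (\<xi> j) \<omega>)\<^sup>2 \<partial>M) = (\<integral>\<omega>. ?S \<omega> \<partial>M)" .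
  have inner: "(\<integral>\<^sup>+t\<in>{0..1}. ennreal ((norm (\<Sum>j\<in>J. indicator {a j<..b j} t *\<^sub>R \<xi> j \<omega>))\<^sup>2) \<partial>lborel) = ennreal (?S \<omega>) \<and> 0 \<le> ?S \<omega>" for \<omega>
  proof -
    let ?q = "\<lambda>t. \<Sum>i\<in>J. \<Sum>j\<in>J. (\<xi> i \<omega> \<bullet> \<xi> j \<omega>) * (indicator {a i<..b i} t * indicator {a j<..b j} t)"
    have n: "(norm (\<Sum>j\<in>J. indicator {a j<..b j} t *\<^sub>R \<xi> j \<omega>))\<^sup>2 = ?q t" for t
      unfolding power2_norm_eq_inner inner_sum_left inner_sum_right by (simp add: mult_ac inner_commute)
    have z: "ennreal (?q t) * indicator {0..1} t = ennreal (?q t)" for t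
    proof (cases "t \<in> {0..1}")
      case False
      have "indicator {a i<..b i} t = (0::real)" if "i \<in> J" for i
        using e[OF that] False by (auto simp: elementary_def indicator_def)
      then have "?q t = 0" by simp
      then show ?thesis by simp
    qed simp
    have q0: "0 \<le> ?q t" for t unfolding n[symmetric] by simp
    have iq: "integrable lborel ?q"
      by (intro Bochner_Integration.integrable_sum integrable_mult_right integral_indicator_overlap)
    have "(\<integral>t. ?q t \<partial>lborel) = (\<Sum>i\<in>J. \<Sum>j\<in>J. (\<xi> i \<omega> \<bullet> \<xi> j \<omega>) * ?o i j)"
      by (simp add: Bochner_Integration.integral_sum Bochner_Integration.integrable_sum integral_indicator_overlap)
    then have S: "(\<integral>t. ?q t \<partial>lborel) = ?S \<omega>" by (simp add: mult.commute)
    have "(\<integral>\<^sup>+t. ennreal (?q t) \<partial>lborel) = ennreal (?S \<omega>)"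
      unfolding S[symmetric] by (rule nn_integral_eq_integral[OF iq]) (simp add: q0)
    moreover have "0 \<le> ?S \<omega>"
      unfolding S[symmetric] by (rule Bochner_Integration.integral_nonneg) (rule q0)
    ultimately show ?thesis unfolding n z by simp
  qed
  have "(\<integral>\<^sup>+\<omega>. ennreal ((\<Sum>j\<in>J. step_int (a j) (b j) (\<xi> j) \<omega>)\<^sup>2) \<partial>M) = ennreal (\<integral>\<omega>. ?S \<omega> \<partial>M)"
    unfolding E[symmetric] by (rule nn_integral_eq_integral[OF i1]) simp
  also have "\<dots> = (\<integral>\<^sup>+\<omega>. ennreal (?S \<omega>) \<partial>M)"
    by (rule nn_integral_eq_integral[symmetric, OF iS]) (use inner in auto)
  finally show ?thesis using inner by simp
qed

end

section \<open>Riemann sums of the Ito integral\<close>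

lemma norm_diff_sq_le:
  fixes x y z :: "'a::real_normed_vector"
  shows "(norm (x - z))\<^sup>2 \<le> 2 * (norm (x - y))\<^sup>2 + 2 * (norm (y - z))\<^sup>2"
proof -
  have "norm (x - z) \<le> norm (x - y) + norm (y - z)"
    using norm_triangle_ineq[of "x - y" "y - z"] by simp
  then have "(norm (x - z))\<^sup>2 \<le> (norm (x - y) + norm (y - z))\<^sup>2" by (intro power_mono) auto
  also have "\<dots> \<le> 2 * (norm (x - y))\<^sup>2 + 2 * (norm (y - z))\<^sup>2"
    using sum_squares_bound[of "norm (x - y)" "norm (y - z)"] by (simp add: power2_sum)
  finally show ?thesis .
qed

lemma ennreal_norm_diff_sq_le:
  fixes x y z :: "'a::real_normed_vector"
  shows "ennreal ((norm (x - z))\<^sup>2) \<le> 2 * ennreal ((norm (x - y))\<^sup>2) + 2 * ennreal ((norm (y - z))\<^sup>2)"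
proof -
  have "ennreal ((norm (x - z))\<^sup>2) \<le> ennreal (2 * (norm (x - y))\<^sup>2 + 2 * (norm (y - z))\<^sup>2)"
    by (intro ennreal_leI norm_diff_sq_le)
  also have "\<dots> = 2 * ennreal ((norm (x - y))\<^sup>2) + 2 * ennreal ((norm (y - z))\<^sup>2)"
    by (simp add: ennreal_plus ennreal_mult)
  finally show ?thesis .
qed

text \<open>The index is shifted so that no grid degenerates: \<open>grid n\<close> has \<open>n + 1\<close> steps.\<close>

definition grid :: "nat \<Rightarrow> nat \<Rightarrow> real" where
  "grid n k = real k / real (Suc n)"

text \<open>The index of the half-open grid interval \<open>]k/N,(k+1)/N]\<close> that contains \<open>t\<close>, for \<open>t\<close> in \<open>]0,1]\<close>.\<close>

definition cell :: "nat \<Rightarrow> real \<Rightarrow> nat" where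
  "cell n t = nat (\<lceil>t * real (Suc n)\<rceil> - 1)"

lemma grid_0 [simp]: "grid n 0 = 0" and grid_1 [simp]: "grid n (Suc n) = 1"
  by (simp_all add: grid_def del: of_nat_Suc)

lemma grid_mono: "j \<le> k \<Longrightarrow> grid n j \<le> grid n k"
  by (simp add: grid_def divide_right_mono)

lemma grid_less: "j < k \<Longrightarrow> grid n j < grid n k"
  by (simp add: grid_def divide_strict_right_mono)

lemma grid_01: "k \<le> Suc n \<Longrightarrow> grid n k \<in> {0..1}"
  by (simp add: grid_def divide_le_eq)

lemma grid_step: "grid n (Suc k) - grid n k = 1 / real (Suc n)"
  by (simp add: grid_def diff_divide_distrib[symmetric])

lemma cell:
  assumes "t \<in> {0<..1}"
  shows "cell n t < Suc n" "t \<in> {grid n (cell n t)<..grid n (Suc (cell n t))}"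
proof -
  let ?c = "\<lceil>t * real (Suc n)\<rceil>"
  have p: "t * real (Suc n) > 0" using assms by simp
  then have c1: "?c \<ge> 1" by (simp add: one_le_ceiling del: of_nat_Suc)
  then have k: "int (cell n t) = ?c - 1" by (simp add: cell_def)
  have "t * real (Suc n) \<le> 1 * real (Suc n)" using assms by (intro mult_right_mono) auto
  then have "?c \<le> int (Suc n)" by (simp add: ceiling_le_iff del: of_nat_Suc)
  then show "cell n t < Suc n" using k by linarith
  have kr: "real (cell n t) = of_int ?c - 1" using k by (metis of_int_1 of_int_diff of_int_of_nat_eq)
  have "real (cell n t) < t * real (Suc n)" "t * real (Suc n) \<le> real (Suc (cell n t))"
    using kr by linarith+
  then show "t \<in> {grid n (cell n t)<..grid n (Suc (cell n t))}"
    by (simp add: grid_def field_simps del: of_nat_Suc)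
qed

lemma cell_unique:
  assumes t: "t \<in> {0<..1}"
  shows "t \<in> {grid n k<..grid n (Suc k)} \<longleftrightarrow> k = cell n t"
proof
  assume k: "t \<in> {grid n k<..grid n (Suc k)}"
  note c = cell(2)[OF t, of n]
  show "k = cell n t"
  proof (rule ccontr)
    assume "k \<noteq> cell n t"
    then consider "Suc k \<le> cell n t" | "Suc (cell n t) \<le> k" by linarith
    then show False
      by cases (use k c grid_mono[of "Suc k" "cell n t" n] grid_mono[of "Suc (cell n t)" k n] in auto)
  qed
qed (use cell(2)[OF t] in simp)

lemma sum_cells:
  fixes c :: "nat \<Rightarrow> 'a::real_vector"
  assumes t: "t \<in> {0<..1}"
  shows "(\<Sum>k<Suc n. indicator {grid n k<..grid n (Suc k)} t *\<^sub>R c k) = c (cell n t)"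
proof -
  have "(\<Sum>k<Suc n. indicator {grid n k<..grid n (Suc k)} t *\<^sub>R c k) = (\<Sum>k<Suc n. if k = cell n t then c k else 0)"
  proof (intro sum.cong refl)
    fix k
    show "indicator {grid n k<..grid n (Suc k)} t *\<^sub>R c k = (if k = cell n t then c k else 0)"
      using cell_unique[OF t, of n k] by (cases "k = cell n t") (auto simp del: greaterThanAtMost_iff)
  qed
  also have "\<dots> = c (cell n t)" using cell(1)[OF t, of n] by (subst sum.delta) auto
  finally show ?thesis .
qed

lemma grid_cell_tendsto:
  assumes t: "t \<in> {0<..1}"
  shows "(\<lambda>n. grid n (cell n t)) \<longlonglongrightarrow> t"
proof (rule real_tendsto_sandwich[of "\<lambda>n. t - 1 / real (Suc n)" _ _ "\<lambda>_. t"])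
  show "\<forall>\<^sub>F n in sequentially. t - 1 / real (Suc n) \<le> grid n (cell n t)"
  proof (rule always_eventually, rule allI)
    fix n show "t - 1 / real (Suc n) \<le> grid n (cell n t)"
      using cell(2)[OF t, of n] grid_step[of n "cell n t"] by simp
  qed
  show "\<forall>\<^sub>F n in sequentially. grid n (cell n t) \<le> t"
    by (rule always_eventually, rule allI) (use cell(2)[OF t] in \<open>simp add: less_imp_le\<close>)
  have "(\<lambda>n. t - inverse (real (Suc n))) \<longlonglongrightarrow> t - 0" by (intro tendsto_intros LIMSEQ_inverse_real_of_nat)
  then show "(\<lambda>n. t - 1 / real (Suc n)) \<longlonglongrightarrow> t" by (simp add: inverse_eq_divide)
qed simp

context wiener begin

text \<open>The squared distance in \<open>L\<^sup>2(dt \<otimes> d\<mu>)\<close> that occurs in the definition of the Ito integral.\<close>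

definition sq_dist :: "(real \<Rightarrow> path \<Rightarrow> real^3) \<Rightarrow> (real \<Rightarrow> path \<Rightarrow> real^3) \<Rightarrow> ennreal" where
  "sq_dist H K = (\<integral>\<^sup>+\<omega>. (\<integral>\<^sup>+t\<in>{0..1}. ennreal ((norm (H t \<omega> - K t \<omega>))\<^sup>2) \<partial>lborel) \<partial>M)"

text \<open>Time 0 is left out because simple processes vanish there, whereas the process
  \<open>u(1-t,W\<^sub>t)\<close> is approximated by them only at positive times.\<close>

definition jointly_measurable :: "(real \<Rightarrow> path \<Rightarrow> real^3) \<Rightarrow> bool" where
  "jointly_measurable H \<longleftrightarrow> (\<lambda>(\<omega>, t). indicator {0<..1} t *\<^sub>R H t \<omega>) \<in> borel_measurable (M \<Otimes>\<^sub>M borel)"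

lemma set_nn_integral_Ioc:
  fixes f :: "real \<Rightarrow> ennreal"
  shows "(\<integral>\<^sup>+t\<in>{0..1}. f t \<partial>lborel) = (\<integral>\<^sup>+t\<in>{0<..1}. f t \<partial>lborel)"
proof (rule nn_integral_cong_AE)
  have "AE t in lborel. t \<noteq> (0::real)" by (rule AE_lborel_singleton)
  then show "AE t in lborel. f t * indicator {0..1} t = f t * indicator {0<..1} t"
    by eventually_elim (auto simp: indicator_def)
qed

lemma sq_dist_Ioc: "sq_dist H K = (\<integral>\<^sup>+\<omega>. (\<integral>\<^sup>+t\<in>{0<..1}. ennreal ((norm (H t \<omega> - K t \<omega>))\<^sup>2) \<partial>lborel) \<partial>M)"
  unfolding sq_dist_def set_nn_integral_Ioc ..

lemma joint_diff_measurable: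
  assumes "jointly_measurable H" "jointly_measurable K"
  shows "(\<lambda>(\<omega>, t). ennreal ((norm (H t \<omega> - K t \<omega>))\<^sup>2) * indicator {0<..1} t) \<in> borel_measurable (M \<Otimes>\<^sub>M borel)"
proof -
  have [measurable]: "(\<lambda>(\<omega>, t). indicator {0<..1} t *\<^sub>R H t \<omega>) \<in> borel_measurable (M \<Otimes>\<^sub>M borel)"
    "(\<lambda>(\<omega>, t). indicator {0<..1} t *\<^sub>R K t \<omega>) \<in> borel_measurable (M \<Otimes>\<^sub>M borel)"
    using assms unfolding jointly_measurable_def by auto
  have "(\<lambda>x. ennreal ((norm ((case x of (\<omega>, t) \<Rightarrow> indicator {0<..1} t *\<^sub>R H t \<omega>) - (case x of (\<omega>, t) \<Rightarrow> indicator {0<..1} t *\<^sub>R K t \<omega>)))\<^sup>2))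
      \<in> borel_measurable (M \<Otimes>\<^sub>M borel)"
    by measurable
  also have "(\<lambda>x. ennreal ((norm ((case x of (\<omega>, t) \<Rightarrow> indicator {0<..1} t *\<^sub>R H t \<omega>) - (case x of (\<omega>, t) \<Rightarrow> indicator {0<..1} t *\<^sub>R K t \<omega>)))\<^sup>2))
    = (\<lambda>(\<omega>, t). ennreal ((norm (H t \<omega> - K t \<omega>))\<^sup>2) * indicator {0<..1} t)"
    by (auto simp: fun_eq_iff indicator_def)
  finally show ?thesis .
qed

lemma joint_section_measurable:
  assumes "jointly_measurable H" "jointly_measurable K" "\<omega> \<in> space M"
  shows "(\<lambda>t. ennreal ((norm (H t \<omega> - K t \<omega>))\<^sup>2) * indicator {0<..1} t) \<in> borel_measurable lborel"
  using measurable_compose[OF measurable_Pair1'[OF assms(3)] joint_diff_measurable[OF assms(1,2)]] by simp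

lemma joint_inner_measurable:
  assumes "jointly_measurable H" "jointly_measurable K"
  shows "(\<lambda>\<omega>. \<integral>\<^sup>+t\<in>{0<..1}. ennreal ((norm (H t \<omega> - K t \<omega>))\<^sup>2) \<partial>lborel) \<in> borel_measurable M"
proof (rule lborel.borel_measurable_nn_integral)
  have sc: "sets (M \<Otimes>\<^sub>M lborel) = sets (M \<Otimes>\<^sub>M borel)" by (intro sets_pair_measure_cong) auto
  show "(\<lambda>(\<omega>, t). ennreal ((norm (H t \<omega> - K t \<omega>))\<^sup>2) * indicator {0<..1} t) \<in> borel_measurable (M \<Otimes>\<^sub>M lborel)"
    using joint_diff_measurable[OF assms] by (simp add: measurable_cong_sets[OF sc refl])
qed

lemma sq_dist_commute: "sq_dist H K = sq_dist K H"
  by (simp add: sq_dist_def norm_minus_commute)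

text \<open>The integral of a sum splits only for measurable functions, which is why joint measurability is
  carried along.\<close>

lemma sq_dist_triangle:
  assumes m: "jointly_measurable H" "jointly_measurable G" "jointly_measurable K"
  shows "sq_dist H K \<le> 2 * sq_dist H G + 2 * sq_dist G K"
proof -
  let ?D = "\<lambda>H K \<omega> t. ennreal ((norm (H t \<omega> - K t \<omega>))\<^sup>2) * indicator {0<..1} t"
  have "sq_dist H K \<le> (\<integral>\<^sup>+\<omega>. (\<integral>\<^sup>+t. 2 * ?D H G \<omega> t + 2 * ?D G K \<omega> t \<partial>lborel) \<partial>M)"
    unfolding sq_dist_Ioc
    by (intro nn_integral_mono) (auto simp: indicator_def intro: ennreal_norm_diff_sq_le)
  also have "\<dots> = (\<integral>\<^sup>+\<omega>. 2 * (\<integral>\<^sup>+t. ?D H G \<omega> t \<partial>lborel) + 2 * (\<integral>\<^sup>+t. ?D G K \<omega> t \<partial>lborel) \<partial>M)"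
  proof (rule nn_integral_cong)
    fix \<omega> assume w: "\<omega> \<in> space M"
    note [measurable] = joint_section_measurable[OF m(1,2) w] joint_section_measurable[OF m(2,3) w]
    show "(\<integral>\<^sup>+t. 2 * ?D H G \<omega> t + 2 * ?D G K \<omega> t \<partial>lborel) = 2 * (\<integral>\<^sup>+t. ?D H G \<omega> t \<partial>lborel) + 2 * (\<integral>\<^sup>+t. ?D G K \<omega> t \<partial>lborel)"
      by (subst nn_integral_add) (auto simp: nn_integral_cmult)
  qed
  also have "\<dots> = 2 * sq_dist H G + 2 * sq_dist G K"
    using joint_inner_measurable[OF m(1,2)] joint_inner_measurable[OF m(2,3)]
    unfolding sq_dist_Ioc by (subst nn_integral_add) (auto simp: nn_integral_cmult)
  finally show ?thesis .
qed

definition elementary_steps :: "nat \<Rightarrow> (nat \<Rightarrow> real) \<Rightarrow> (nat \<Rightarrow> path \<Rightarrow> real^3) \<Rightarrow> bool" where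
  "elementary_steps N s \<xi> \<longleftrightarrow> (\<forall>k<N. elementary (s k) (s (Suc k)) (\<xi> k))"

lemma elementary_steps_joint:
  assumes "elementary_steps N s \<xi>" shows "jointly_measurable (simple_process N s \<xi>)"
proof -
  have [measurable]: "\<xi> k \<in> borel_measurable M" if "k < N" for k
    using assms that elementary_measurable_M by (auto simp: elementary_steps_def)
  have "(\<lambda>(\<omega>, t). indicator {0<..1::real} t *\<^sub>R (\<Sum>k<N. indicator {s k<..s (Suc k)} t *\<^sub>R \<xi> k \<omega>)) \<in> borel_measurable (M \<Otimes>\<^sub>M borel)"
    unfolding split_beta'
    by (intro borel_measurable_sum borel_measurable_scaleR measurable_compose[OF measurable_fst]) (auto, measurable)
  then show ?thesis unfolding jointly_measurable_def simple_process_def .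
qed

lemma simple_integral_measurable:
  assumes "elementary_steps N s \<xi>" shows "simple_integral N s \<xi> \<in> borel_measurable M"
  unfolding simple_integral_def using assms
  by (intro borel_measurable_sum step_int_measurable_M) (auto simp: elementary_steps_def)

lemma simple_isometry:
  assumes e: "elementary_steps N s \<xi>" "elementary_steps N' s' \<xi>'"
  shows "(\<integral>\<^sup>+\<omega>. ennreal ((simple_integral N s \<xi> \<omega> - simple_integral N' s' \<xi>' \<omega>)\<^sup>2) \<partial>M)
    = sq_dist (simple_process N s \<xi>) (simple_process N' s' \<xi>')"
proof -
  define J where "J = {..<N} <+> {..<N'}"
  define a where "a = case_sum s s'"
  define b where "b = case_sum (\<lambda>k. s (Suc k)) (\<lambda>k. s' (Suc k))"
  define \<zeta> where "\<zeta> = case_sum \<xi> (\<lambda>k \<omega>. - \<xi>' k \<omega>)"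
  have "elementary (a j) (b j) (\<zeta> j)" if "j \<in> J" for j
  proof -
    have "elementary (s' k) (s' (Suc k)) (\<lambda>\<omega>. - \<xi>' k \<omega>)" if "k < N'" for k
    proof -
      have el: "elementary (s' k) (s' (Suc k)) (\<xi>' k)" using e(2) that by (simp add: elementary_steps_def)
      then obtain K where "\<And>\<omega>. \<omega> \<in> space M \<Longrightarrow> norm (\<xi>' k \<omega>) \<le> K" using elementary_bound by blast
      then have "bounded ((\<lambda>\<omega>. - \<xi>' k \<omega>) ` space M)" by (intro boundedI[of _ K]) auto
      then show ?thesis using el unfolding elementary_def by simp
    qed
    then show ?thesis using that e(1) by (auto simp: J_def a_def b_def \<zeta>_def elementary_steps_def)
  qed
  moreover have "finite J" by (simp add: J_def)
  moreover have "(\<Sum>j\<in>J. step_int (a j) (b j) (\<zeta> j) \<omega>) = simple_integral N s \<xi> \<omega> - simple_integral N' s' \<xi>' \<omega>" for \<omega>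
    unfolding J_def simple_integral_def
    by (simp add: sum.Plus o_def a_def b_def \<zeta>_def sum_negf)
  moreover have "(\<Sum>j\<in>J. indicator {a j<..b j} t *\<^sub>R \<zeta> j \<omega>) = simple_process N s \<xi> t \<omega> - simple_process N' s' \<xi>' t \<omega>" for t \<omega>
    unfolding J_def simple_process_def sum.Plus[OF finite_lessThan finite_lessThan] a_def b_def \<zeta>_def o_def sum.case
    by (simp only: scaleR_minus_right sum_negf diff_conv_add_uminus)
  ultimately show ?thesis
    using ito_isometry[of J a b \<zeta>] unfolding sq_dist_def by simp
qed

lemma simple_integrand_elems:
  assumes "simple_integrand \<mu> N s \<xi>" shows "elementary_steps N s \<xi>"
proof -
  have s: "s 0 = 0" "\<And>k. k < N \<Longrightarrow> s k < s (Suc k)" "s N = 1" and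
    x: "\<And>k. k < N \<Longrightarrow> \<xi> k \<in> borel_measurable (F (s k))" "\<And>k. k < N \<Longrightarrow> bounded (\<xi> k ` space \<mu>)"
    using assms by (auto simp: simple_integrand_def)
  have lo: "k \<le> N \<Longrightarrow> 0 \<le> s k" for k
  proof (induction k)
    case (Suc k) then show ?case using s(2)[of k] by simp
  qed (simp add: s)
  have hi: "k \<le> N \<Longrightarrow> s k \<le> 1" for k
  proof (induction k rule: inc_induct)
    case (step k) then show ?case using s(2)[of k] by simp
  qed (simp_all add: s)
  show ?thesis unfolding elementary_steps_def elementary_def
  proof (intro allI impI conjI)
    fix k assume k: "k < N"
    show "0 \<le> s k" "s k \<le> s (Suc k)" "s (Suc k) \<le> 1" using lo[of k] hi[of "Suc k"] s(2)[of k] k by auto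
    show "\<xi> k \<in> borel_measurable (F (s k))" "bounded (\<xi> k ` space M)" using x k by auto
  qed
qed

end

text \<open>The function \<open>b(t,x)\<close> stands for \<open>u(1-t,x)\<close>.\<close>

locale drifted = wiener +
  fixes b :: "real \<Rightarrow> real^3 \<Rightarrow> real^3" and B :: real and I :: "path \<Rightarrow> real"
  assumes cont_b: "continuous_on slab (\<lambda>(t, x). b t x)"
    and bound_b: "\<And>t x. t \<in> {0..1} \<Longrightarrow> norm (b t x) \<le> B"
    and ito: "is_ito_integral \<mu> (\<lambda>t \<omega>. b t (\<omega> t)) I"
begin

abbreviation b\<^sub>W :: "real \<Rightarrow> path \<Rightarrow> real^3" where "b\<^sub>W t \<omega> \<equiv> b t (\<omega> t)"

definition drift_at :: "nat \<Rightarrow> nat \<Rightarrow> path \<Rightarrow> real^3" where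
  "drift_at n k \<omega> = b (grid n k) (\<omega> (grid n k))"

abbreviation H :: "nat \<Rightarrow> real \<Rightarrow> path \<Rightarrow> real^3" where
  "H n \<equiv> simple_process (Suc n) (grid n) (drift_at n)"

abbreviation L :: "nat \<Rightarrow> path \<Rightarrow> real" where
  "L n \<equiv> simple_integral (Suc n) (grid n) (drift_at n)"

lemma b_measurable [measurable]: "t \<in> {0..1} \<Longrightarrow> b t \<in> borel_measurable borel"
proof (rule borel_measurable_continuous_onI)
  assume t: "t \<in> {0..1}"
  have "continuous_on UNIV ((\<lambda>(t, x). b t x) \<circ> (\<lambda>x. (t, x)))"
    using t by (intro continuous_on_compose continuous_on_subset[OF cont_b] continuous_intros) auto
  then show "continuous_on UNIV (b t)" by (simp add: o_def)
qed

lemma path_continuous: "\<omega> \<in> space M \<Longrightarrow> continuous_on {0..1} \<omega>"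
  unfolding space_M space_borel_W mspace_W_metric by simp

lemma b\<^sub>W_continuous:
  assumes "\<omega> \<in> space M" shows "continuous_on {0..1} (\<lambda>t. b\<^sub>W t \<omega>)"
proof -
  have "continuous_on {0..1} ((\<lambda>(t, x). b t x) \<circ> (\<lambda>t. (t, \<omega> t)))"
    by (intro continuous_on_compose continuous_on_subset[OF cont_b] continuous_intros path_continuous assms) auto
  then show ?thesis by (simp add: o_def)
qed

lemma drift_at_measurable_F:
  assumes "k \<le> Suc n" "grid n k \<le> t"
  shows "drift_at n k \<in> borel_measurable (F t)"
  unfolding drift_at_def using grid_01[OF assms(1)] assms(2)
  by (intro measurable_compose[OF measurable_eval_usual b_measurable]) auto

lemma drift_at_bound: "k \<le> Suc n \<Longrightarrow> norm (drift_at n k \<omega>) \<le> B"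
  unfolding drift_at_def by (intro bound_b grid_01)

lemma elementary_steps_drift_at: "elementary_steps (Suc n) (grid n) (drift_at n)"
  unfolding elementary_steps_def elementary_def
proof (intro allI impI conjI)
  fix k assume k: "k < Suc n"
  show "0 \<le> grid n k" "grid n k \<le> grid n (Suc k)" "grid n (Suc k) \<le> 1"
    using grid_01[of k n] grid_01[of "Suc k" n] grid_mono[of k "Suc k" n] k by auto
  show "drift_at n k \<in> borel_measurable (F (grid n k))" using k by (intro drift_at_measurable_F) auto
  show "bounded (drift_at n k ` space M)" using k by (intro boundedI[of _ B]) (auto intro: drift_at_bound)
qed

lemma H_eq: "t \<in> {0<..1} \<Longrightarrow> H n t \<omega> = b\<^sub>W (grid n (cell n t)) \<omega>"
  unfolding simple_process_def by (subst sum_cells) (auto simp: drift_at_def)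

lemma H_bound:
  assumes "t \<in> {0<..1}" shows "norm (H n t \<omega>) \<le> B"
proof -
  have "cell n t \<le> Suc n" using cell(1)[OF assms, of n] by simp
  then show ?thesis unfolding H_eq[OF assms] by (intro bound_b grid_01)
qed

lemma H_tendsto:
  assumes w: "\<omega> \<in> space M" and t: "t \<in> {0<..1}"
  shows "(\<lambda>n. H n t \<omega>) \<longlonglongrightarrow> b\<^sub>W t \<omega>"
  unfolding H_eq[OF t]
proof (rule continuous_on_tendsto_compose[OF b\<^sub>W_continuous[OF w] grid_cell_tendsto[OF t]])
  show "t \<in> {0..1}" using t by auto
  have "grid n (cell n t) \<in> {0..1}" for n using cell(1)[OF t, of n] by (intro grid_01) simp
  then show "\<forall>\<^sub>F n in sequentially. grid n (cell n t) \<in> {0..1}" by simp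
qed

lemma joint_H: "jointly_measurable (H n)" by (rule elementary_steps_joint[OF elementary_steps_drift_at])

text \<open>On \<open>]0,1]\<close> the process is the pointwise limit of its discretizations.\<close>

lemma joint_b\<^sub>W: "jointly_measurable b\<^sub>W"
  unfolding jointly_measurable_def
proof (rule borel_measurable_LIMSEQ_metric)
  show "(\<lambda>(\<omega>, t). indicator {0<..1} t *\<^sub>R H n t \<omega>) \<in> borel_measurable (M \<Otimes>\<^sub>M borel)" for n
    using joint_H unfolding jointly_measurable_def .
  fix x assume "x \<in> space (M \<Otimes>\<^sub>M (borel :: real measure))"
  then obtain \<omega> t where x: "x = (\<omega>, t)" "\<omega> \<in> space M" by (auto simp: space_pair_measure)
  show "(\<lambda>n. case x of (\<omega>, t) \<Rightarrow> indicator {0<..1} t *\<^sub>R H n t \<omega>) \<longlonglongrightarrow> (case x of (\<omega>, t) \<Rightarrow> indicator {0<..1} t *\<^sub>R b\<^sub>W t \<omega>)"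
    using H_tendsto[OF x(2), of t] x(1) by (cases "t \<in> {0<..1}") auto
qed

lemma H_b\<^sub>W_bound:
  "t \<in> {0<..1} \<Longrightarrow> (norm (H n t \<omega> - b\<^sub>W t \<omega>))\<^sup>2 \<le> 4 * B\<^sup>2"
proof -
  assume t: "t \<in> {0<..1}"
  have "norm (H n t \<omega> - b\<^sub>W t \<omega>) \<le> 2 * B"
    using norm_triangle_ineq4[of "H n t \<omega>" "b\<^sub>W t \<omega>"] H_bound[OF t, of n \<omega>] bound_b[of t "\<omega> t"] t by simp
  then have "(norm (H n t \<omega> - b\<^sub>W t \<omega>))\<^sup>2 \<le> (2 * B)\<^sup>2" by (intro power_mono) auto
  then show ?thesis by (simp add: power_mult_distrib)
qed

lemma inner_H_le: "(\<integral>\<^sup>+t\<in>{0<..1}. ennreal ((norm (H n t \<omega> - b\<^sub>W t \<omega>))\<^sup>2) \<partial>lborel) \<le> ennreal (4 * B\<^sup>2)"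
proof -
  have "(\<integral>\<^sup>+t\<in>{0<..1}. ennreal ((norm (H n t \<omega> - b\<^sub>W t \<omega>))\<^sup>2) \<partial>lborel) \<le> (\<integral>\<^sup>+t. ennreal (4 * B\<^sup>2) * indicator {0<..1::real} t \<partial>lborel)"
    using H_b\<^sub>W_bound[of _ n \<omega>] by (intro nn_integral_mono) (auto simp: indicator_def intro!: ennreal_leI)
  also have "\<dots> = ennreal (4 * B\<^sup>2)" by (subst nn_integral_cmult_indicator) auto
  finally show ?thesis .
qed

lemma sq_dist_H_finite: "sq_dist (H n) b\<^sub>W < \<infinity>"
proof -
  have "sq_dist (H n) b\<^sub>W \<le> (\<integral>\<^sup>+\<omega>. ennreal (4 * B\<^sup>2) \<partial>M)"
    unfolding sq_dist_Ioc by (intro nn_integral_mono inner_H_le)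
  also have "\<dots> < \<infinity>" using emeasure_space_1 by (simp add: ennreal_mult_less_top)
  finally show ?thesis .
qed

lemma sq_dist_H_tendsto: "(\<lambda>n. sq_dist (H n) b\<^sub>W) \<longlonglongrightarrow> 0"
proof -
  let ?D = "\<lambda>n \<omega> t. ennreal ((norm (H n t \<omega> - b\<^sub>W t \<omega>))\<^sup>2) * indicator {0<..1} t"
  have in0: "(\<lambda>n. \<integral>\<^sup>+t. ?D n \<omega> t \<partial>lborel) \<longlonglongrightarrow> (\<integral>\<^sup>+t. 0 \<partial>(lborel :: real measure))" if w: "\<omega> \<in> space M" for \<omega>
  proof (rule nn_integral_dominated_convergence[where w="\<lambda>t. ennreal (4 * B\<^sup>2) * indicator {0<..1} t"])
    show "?D n \<omega> \<in> borel_measurable lborel" for n by (rule joint_section_measurable[OF joint_H joint_b\<^sub>W w])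
    show "AE t in lborel. ?D n \<omega> t \<le> ennreal (4 * B\<^sup>2) * indicator {0<..1} t" for n
      using H_b\<^sub>W_bound[of _ n \<omega>] by (intro AE_I2) (auto simp: indicator_def intro!: ennreal_leI)
    show "(\<integral>\<^sup>+t. ennreal (4 * B\<^sup>2) * indicator {0<..1::real} t \<partial>lborel) < \<infinity>"
      by (subst nn_integral_cmult_indicator) auto
    show "AE t in lborel. (\<lambda>n. ?D n \<omega> t) \<longlonglongrightarrow> 0"
    proof (rule AE_I2)
      fix t :: real
      show "(\<lambda>n. ?D n \<omega> t) \<longlonglongrightarrow> 0"
      proof (cases "t \<in> {0<..1}")
        case True
        have "(\<lambda>n. ennreal ((norm (H n t \<omega> - b\<^sub>W t \<omega>))\<^sup>2)) \<longlonglongrightarrow> ennreal ((norm (b\<^sub>W t \<omega> - b\<^sub>W t \<omega>))\<^sup>2)"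
          by (intro tendsto_intros H_tendsto[OF w True])
        then show ?thesis using True by simp
      qed simp
    qed
  qed simp_all
  have "(\<lambda>n. sq_dist (H n) b\<^sub>W) \<longlonglongrightarrow> (\<integral>\<^sup>+\<omega>. 0 \<partial>M)"
    unfolding sq_dist_Ioc
  proof (rule nn_integral_dominated_convergence[where w="\<lambda>_. ennreal (4 * B\<^sup>2)"])
    show "(\<lambda>\<omega>. \<integral>\<^sup>+t. ?D n \<omega> t \<partial>lborel) \<in> borel_measurable M" for n
      by (rule joint_inner_measurable[OF joint_H joint_b\<^sub>W])
    show "AE \<omega> in M. (\<integral>\<^sup>+t. ?D n \<omega> t \<partial>lborel) \<le> ennreal (4 * B\<^sup>2)" for n
      by (intro AE_I2 inner_H_le)
    show "(\<integral>\<^sup>+\<omega>. ennreal (4 * B\<^sup>2) \<partial>M) < \<infinity>"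
      using emeasure_space_1 by (simp add: ennreal_mult_less_top)
    show "AE \<omega> in M. (\<lambda>n. \<integral>\<^sup>+t. ?D n \<omega> t \<partial>lborel) \<longlonglongrightarrow> 0"
      using in0 by (intro AE_I2) simp
  qed simp_all
  then show ?thesis by simp
qed

lemma I_measurable_\<mu>: "I \<in> borel_measurable \<mu>"
  using ito unfolding is_ito_integral_def by blast

lemma I_measurable [measurable]: "I \<in> borel_measurable M"
  by (rule measurable_completion[OF I_measurable_\<mu>])

lemma L_measurable [measurable]: "L n \<in> borel_measurable M"
  by (rule simple_integral_measurable[OF elementary_steps_drift_at])

text \<open>Compare the Riemann sum with the simple processes that define the integral: by the isometry the
  distance of the integrals is the distance of the integrands, and these have a common limit.\<close>

lemma L_I_le: "(\<integral>\<^sup>+\<omega>. ennreal ((L m \<omega> - I \<omega>)\<^sup>2) \<partial>M) \<le> 4 * sq_dist (H m) b\<^sub>W"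
proof -
  obtain N s \<xi> where si: "\<And>n::nat. simple_integrand \<mu> (N n) (s n) (\<xi> n)"
    and l1: "(\<lambda>n. sq_dist (simple_process (N n) (s n) (\<xi> n)) b\<^sub>W) \<longlonglongrightarrow> 0"
    and l2: "(\<lambda>n. \<integral>\<^sup>+\<omega>. ennreal ((simple_integral (N n) (s n) (\<xi> n) \<omega> - I \<omega>)\<^sup>2) \<partial>M) \<longlonglongrightarrow> 0"
    using ito unfolding is_ito_integral_def sq_dist_def by blast
  let ?K = "\<lambda>n. simple_process (N n) (s n) (\<xi> n)" and ?S = "\<lambda>n. simple_integral (N n) (s n) (\<xi> n)"
  have el: "elementary_steps (N n) (s n) (\<xi> n)" for n by (rule simple_integrand_elems[OF si])
  have le: "(\<integral>\<^sup>+\<omega>. ennreal ((L m \<omega> - I \<omega>)\<^sup>2) \<partial>M)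
     \<le> 4 * sq_dist (H m) b\<^sub>W + (4 * sq_dist (?K n) b\<^sub>W + 2 * (\<integral>\<^sup>+\<omega>. ennreal ((?S n \<omega> - I \<omega>)\<^sup>2) \<partial>M))" for n
  proof -
    have [measurable]: "?S n \<in> borel_measurable M" by (rule simple_integral_measurable[OF el])
    have "(\<integral>\<^sup>+\<omega>. ennreal ((L m \<omega> - I \<omega>)\<^sup>2) \<partial>M)
      \<le> (\<integral>\<^sup>+\<omega>. 2 * ennreal ((L m \<omega> - ?S n \<omega>)\<^sup>2) + 2 * ennreal ((?S n \<omega> - I \<omega>)\<^sup>2) \<partial>M)"
      using ennreal_norm_diff_sq_le[where 'a=real] by (intro nn_integral_mono) simp
    also have "\<dots> = 2 * (\<integral>\<^sup>+\<omega>. ennreal ((L m \<omega> - ?S n \<omega>)\<^sup>2) \<partial>M) + 2 * (\<integral>\<^sup>+\<omega>. ennreal ((?S n \<omega> - I \<omega>)\<^sup>2) \<partial>M)"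
      by (subst nn_integral_add) (auto simp: nn_integral_cmult)
    also have "(\<integral>\<^sup>+\<omega>. ennreal ((L m \<omega> - ?S n \<omega>)\<^sup>2) \<partial>M) = sq_dist (H m) (?K n)"
      by (rule simple_isometry[OF elementary_steps_drift_at el])
    also have "2 * sq_dist (H m) (?K n) \<le> 2 * (2 * sq_dist (H m) b\<^sub>W + 2 * sq_dist b\<^sub>W (?K n))"
      by (intro mult_left_mono sq_dist_triangle joint_H joint_b\<^sub>W elementary_steps_joint[OF el]) auto
    also have "sq_dist b\<^sub>W (?K n) = sq_dist (?K n) b\<^sub>W" by (rule sq_dist_commute)
    finally show ?thesis
      by (simp add: distrib_left mult.assoc[symmetric] add.assoc add_right_mono)
  qed
  have "(\<lambda>n. 4 * sq_dist (H m) b\<^sub>W + (4 * sq_dist (?K n) b\<^sub>W + 2 * (\<integral>\<^sup>+\<omega>. ennreal ((?S n \<omega> - I \<omega>)\<^sup>2) \<partial>M)))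
    \<longlonglongrightarrow> 4 * sq_dist (H m) b\<^sub>W + (4 * 0 + 2 * 0)"
    by (intro tendsto_add tendsto_const ennreal_tendsto_cmult l1 l2) auto
  from LIMSEQ_le_const[OF this] le show ?thesis by simp
qed

lemma integrable_L_I: "integrable M (\<lambda>\<omega>. (L n \<omega> - I \<omega>)\<^sup>2)"
proof (rule integrableI_nonneg)
  have "4 * sq_dist (H n) b\<^sub>W < \<infinity>" using sq_dist_H_finite by (simp add: ennreal_mult_less_top)
  then show "(\<integral>\<^sup>+\<omega>. ennreal ((L n \<omega> - I \<omega>)\<^sup>2) \<partial>M) < \<infinity>" using L_I_le[of n] by (rule le_less_trans[rotated])
qed auto

lemma L_tendsto_subseq: "\<exists>r. strict_mono r \<and> (AE \<omega> in M. (\<lambda>n. L (r n) \<omega>) \<longlonglongrightarrow> I \<omega>)"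
proof -
  have up: "(\<lambda>n. 4 * sq_dist (H n) b\<^sub>W) \<longlonglongrightarrow> 0"
    using ennreal_tendsto_cmult[OF _ sq_dist_H_tendsto, of 4] by simp
  have "(\<lambda>n. \<integral>\<^sup>+\<omega>. ennreal ((L n \<omega> - I \<omega>)\<^sup>2) \<partial>M) \<longlonglongrightarrow> 0"
  proof (rule tendsto_sandwich[OF _ _ tendsto_const up])
    show "\<forall>\<^sub>F n in sequentially. (\<integral>\<^sup>+\<omega>. ennreal ((L n \<omega> - I \<omega>)\<^sup>2) \<partial>M) \<le> 4 * sq_dist (H n) b\<^sub>W"
      using L_I_le by (intro always_eventually allI)
  qed simp
  then have "(\<lambda>n. ennreal (\<integral>\<omega>. (L n \<omega> - I \<omega>)\<^sup>2 \<partial>M)) \<longlonglongrightarrow> ennreal 0"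
    by (subst (asm) nn_integral_eq_integral[OF integrable_L_I]) auto
  then have l: "(\<lambda>n. \<integral>\<omega>. norm ((L n \<omega> - I \<omega>)\<^sup>2) \<partial>M) \<longlonglongrightarrow> 0"
    by (simp add: ennreal_tendsto_0_iff)
  obtain r where r: "strict_mono r" "AE \<omega> in M. (\<lambda>n. (L (r n) \<omega> - I \<omega>)\<^sup>2) \<longlonglongrightarrow> 0"
    using tendsto_L1_AE_subseq[OF integrable_L_I l] by blast
  have "AE \<omega> in M. (\<lambda>n. L (r n) \<omega>) \<longlonglongrightarrow> I \<omega>"
    using r(2)
  proof eventually_elim
    fix \<omega> assume "(\<lambda>n. (L (r n) \<omega> - I \<omega>)\<^sup>2) \<longlonglongrightarrow> 0"
    from tendsto_real_sqrt[OF this] have "(\<lambda>n. \<bar>L (r n) \<omega> - I \<omega>\<bar>) \<longlonglongrightarrow> 0" by simp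
    then have "(\<lambda>n. L (r n) \<omega> - I \<omega>) \<longlonglongrightarrow> 0" by (rule tendsto_rabs_zero_cancel)
    then show "(\<lambda>n. L (r n) \<omega>) \<longlonglongrightarrow> I \<omega>" by (rule LIM_zero_cancel)
  qed
  then show ?thesis using r(1) by blast
qed

definition energy :: "path \<Rightarrow> real" where
  "energy \<omega> = (LBINT t:{0..1}. (norm (b\<^sub>W t \<omega>))\<^sup>2)"

definition energy_sum :: "nat \<Rightarrow> path \<Rightarrow> real" where
  "energy_sum n \<omega> = (\<Sum>k<Suc n. (norm (drift_at n k \<omega>))\<^sup>2 * (1 / real (Suc n)))"

text \<open>The sum is the integral of the squared discretized process, which converges boundedly.\<close>

lemma energy_sum_tendsto:
  assumes w: "\<omega> \<in> space M"
  shows "(\<lambda>n. energy_sum n \<omega>) \<longlonglongrightarrow> energy \<omega>"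
proof -
  have s: "energy_sum n \<omega> = (\<integral>t. indicator {0<..1} t * (norm (H n t \<omega>))\<^sup>2 \<partial>lborel)" for n
  proof -
    have "indicator {0<..1} t * (norm (H n t \<omega>))\<^sup>2
      = (\<Sum>k<Suc n. indicator {grid n k<..grid n (Suc k)} t *\<^sub>R (norm (drift_at n k \<omega>))\<^sup>2)" for t
    proof (cases "t \<in> {0<..1}")
      case True
      then show ?thesis by (subst sum_cells[OF True]) (simp add: H_eq[OF True] drift_at_def)
    next
      case False
      have "indicator {grid n k<..grid n (Suc k)} t = (0::real)" if "k < Suc n" for k
        using False grid_01[of k n] grid_01[of "Suc k" n] that by (auto simp: indicator_def)
      then show ?thesis using False by simp
    qed
    then have "(\<integral>t. indicator {0<..1} t * (norm (H n t \<omega>))\<^sup>2 \<partial>lborel)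
      = (\<Sum>k<Suc n. \<integral>t. indicator {grid n k<..grid n (Suc k)} t *\<^sub>R (norm (drift_at n k \<omega>))\<^sup>2 \<partial>lborel)"
      using grid_mono[of _ "Suc _" n] by (simp only:) (subst Bochner_Integration.integral_sum, auto)
    also have "\<dots> = energy_sum n \<omega>"
      unfolding energy_sum_def
    proof (intro sum.cong refl)
      fix k
      have "(\<integral>t. indicator {grid n k<..grid n (Suc k)} t *\<^sub>R (norm (drift_at n k \<omega>))\<^sup>2 \<partial>lborel)
        = (grid n (Suc k) - grid n k) * (norm (drift_at n k \<omega>))\<^sup>2"
        using grid_mono[of k "Suc k" n] by simp
      then show "(\<integral>t. indicator {grid n k<..grid n (Suc k)} t *\<^sub>R (norm (drift_at n k \<omega>))\<^sup>2 \<partial>lborel) = (norm (drift_at n k \<omega>))\<^sup>2 * (1 / real (Suc n))"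
        unfolding grid_step by (simp only: mult.commute)
    qed
    finally show ?thesis ..
  qed
  have e: "energy \<omega> = (\<integral>t. indicator {0<..1} t * (norm (b\<^sub>W t \<omega>))\<^sup>2 \<partial>lborel)"
    unfolding energy_def set_lebesgue_integral_def
  proof (rule integral_cong_AE)
    have "continuous_on {0..1} (\<lambda>t. (norm (b\<^sub>W t \<omega>))\<^sup>2)" by (intro continuous_intros b\<^sub>W_continuous w)
    then have m: "(\<lambda>t. indicator {0..1} t *\<^sub>R (norm (b\<^sub>W t \<omega>))\<^sup>2) \<in> borel_measurable borel"
      by (intro borel_measurable_continuous_on_indicator) simp_all
    then show "(\<lambda>t. indicator {0..1} t *\<^sub>R (norm (b\<^sub>W t \<omega>))\<^sup>2) \<in> borel_measurable lborel" by simp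
    have "(\<lambda>t. indicator {0<..1} t * (indicator {0..1} t *\<^sub>R (norm (b\<^sub>W t \<omega>))\<^sup>2)) \<in> borel_measurable borel"
      using m by measurable
    also have "(\<lambda>t. indicator {0<..1} t * (indicator {0..1} t *\<^sub>R (norm (b\<^sub>W t \<omega>))\<^sup>2)) = (\<lambda>t. indicator {0<..1} t * (norm (b\<^sub>W t \<omega>))\<^sup>2)"
      by (auto simp: indicator_def)
    finally show "(\<lambda>t. indicator {0<..1} t * (norm (b\<^sub>W t \<omega>))\<^sup>2) \<in> borel_measurable lborel" by simp
    have "AE t in lborel. t \<noteq> (0::real)" by (rule AE_lborel_singleton)
    then show "AE t in lborel. indicator {0..1} t *\<^sub>R (norm (b\<^sub>W t \<omega>))\<^sup>2 = indicator {0<..1} t * (norm (b\<^sub>W t \<omega>))\<^sup>2"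
      by eventually_elim (auto simp: indicator_def)
  qed
  show ?thesis unfolding s e
  proof (rule integral_dominated_convergence[where w="\<lambda>t. indicator {0<..1} t * B\<^sup>2"])
    show "integrable lborel (\<lambda>t::real. indicator {0<..1} t * B\<^sup>2)" by simp
    have m: "(\<lambda>t. indicator {0<..1} t *\<^sub>R K t \<omega>) \<in> borel_measurable borel" if "jointly_measurable K" for K
      using measurable_compose[OF measurable_Pair1'[OF w] that[unfolded jointly_measurable_def]] by simp
    have m2: "(\<lambda>t. indicator {0<..1} t * (norm (K t \<omega>))\<^sup>2) \<in> borel_measurable borel" if "jointly_measurable K" for K
    proof -
      have "(\<lambda>t. (norm (indicator {0<..1} t *\<^sub>R K t \<omega>))\<^sup>2) \<in> borel_measurable borel" using m[OF that] by measurable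
      also have "(\<lambda>t. (norm (indicator {0<..1} t *\<^sub>R K t \<omega>))\<^sup>2) = (\<lambda>t. indicator {0<..1} t * (norm (K t \<omega>))\<^sup>2)"
        by (auto simp: indicator_def)
      finally show ?thesis .
    qed
    show "(\<lambda>t. indicator {0<..1} t * (norm (H n t \<omega>))\<^sup>2) \<in> borel_measurable lborel" for n using m2[OF joint_H] by simp
    show "(\<lambda>t. indicator {0<..1} t * (norm (b\<^sub>W t \<omega>))\<^sup>2) \<in> borel_measurable lborel" using m2[OF joint_b\<^sub>W] by simp
    show "AE t in lborel. (\<lambda>n. indicator {0<..1} t * (norm (H n t \<omega>))\<^sup>2) \<longlonglongrightarrow> indicator {0<..1} t * (norm (b\<^sub>W t \<omega>))\<^sup>2"
    proof (rule AE_I2)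
      fix t :: real
      show "(\<lambda>n. indicator {0<..1} t * (norm (H n t \<omega>))\<^sup>2) \<longlonglongrightarrow> indicator {0<..1} t * (norm (b\<^sub>W t \<omega>))\<^sup>2"
        using H_tendsto[OF w, of t] by (cases "t \<in> {0<..1}") (auto intro!: tendsto_intros)
    qed
    show "AE t in lborel. norm (indicator {0<..1} t * (norm (H n t \<omega>))\<^sup>2) \<le> indicator {0<..1} t * B\<^sup>2" for n
      using H_bound[of _ n \<omega>] by (intro AE_I2) (auto simp: indicator_def intro!: power_mono)
  qed
qed

end

section \<open>The discrete Girsanov density\<close>

text \<open>A bound in \<open>L\<^sup>2\<close> makes the sequence uniformly integrable: \<open>|d| \<le> min(|d|,K) + d\<^sup>2/K\<close> reduces the
  claim to bounded convergence.\<close>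

lemma (in prob_space) L2_bounded_AE_convergence:
  fixes V :: "nat \<Rightarrow> 'a \<Rightarrow> real"
  assumes m [measurable]: "\<And>n. V n \<in> borel_measurable M" "V' \<in> borel_measurable M"
    and ae: "AE x in M. (\<lambda>n. V n x) \<longlonglongrightarrow> V' x"
    and C: "\<And>n. (\<integral>\<^sup>+x. ennreal ((V n x)\<^sup>2) \<partial>M) \<le> ennreal C" "C \<ge> 0"
  shows "integrable M V'" "(\<lambda>n. \<integral>x. V n x \<partial>M) \<longlonglongrightarrow> (\<integral>x. V' x \<partial>M)"
proof -
  have fat: "(\<integral>\<^sup>+x. ennreal ((V' x)\<^sup>2) \<partial>M) \<le> ennreal C"
  proof -
    have "(\<integral>\<^sup>+x. ennreal ((V' x)\<^sup>2) \<partial>M) = (\<integral>\<^sup>+x. liminf (\<lambda>n. ennreal ((V n x)\<^sup>2)) \<partial>M)"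
    proof (rule nn_integral_cong_AE)
      show "AE x in M. ennreal ((V' x)\<^sup>2) = liminf (\<lambda>n. ennreal ((V n x)\<^sup>2))"
        using ae
      proof eventually_elim
        fix x assume "(\<lambda>n. V n x) \<longlonglongrightarrow> V' x"
        then have "(\<lambda>n. ennreal ((V n x)\<^sup>2)) \<longlonglongrightarrow> ennreal ((V' x)\<^sup>2)" by (intro tendsto_intros)
        then show "ennreal ((V' x)\<^sup>2) = liminf (\<lambda>n. ennreal ((V n x)\<^sup>2))"
          by (intro lim_imp_Liminf[symmetric]) auto
      qed
    qed
    also have "\<dots> \<le> liminf (\<lambda>n. \<integral>\<^sup>+x. ennreal ((V n x)\<^sup>2) \<partial>M)" by (rule nn_integral_liminf) measurable
    also have "\<dots> \<le> liminf (\<lambda>n. ennreal C)" by (intro Liminf_mono always_eventually allI C)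
    finally show ?thesis by (simp add: Liminf_const)
  qed
  have sqi: "integrable M (\<lambda>x. (U x)\<^sup>2)" if "U \<in> borel_measurable M" "(\<integral>\<^sup>+x. ennreal ((U x)\<^sup>2) \<partial>M) \<le> ennreal C" for U :: "'a \<Rightarrow> real"
    using that by (intro integrableI_nonneg) (auto intro: le_less_trans)
  have le: "(\<integral>x. (U x)\<^sup>2 \<partial>M) \<le> C" if "U \<in> borel_measurable M" "(\<integral>\<^sup>+x. ennreal ((U x)\<^sup>2) \<partial>M) \<le> ennreal C" for U :: "'a \<Rightarrow> real"
    using that nn_integral_eq_integral[OF sqi[OF that]] C(2) by (simp add: ennreal_le_iff)
  show iV': "integrable M V'" by (rule square_integrable_imp_integrable[OF m(2) sqi[OF m(2) fat]])
  have iV: "integrable M (V n)" for n by (rule square_integrable_imp_integrable[OF m(1) sqi[OF m(1) C(1)]])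
  let ?D = "\<lambda>n x. \<bar>V n x - V' x\<bar>"
  have iD: "integrable M (?D n)" for n using iV iV' by simp
  have s1: "integrable M (\<lambda>x. (V n x)\<^sup>2)" for n by (rule sqi[OF m(1) C(1)])
  have s2: "integrable M (\<lambda>x. (V' x)\<^sup>2)" by (rule sqi[OF m(2) fat])
  have "(\<lambda>n. \<integral>x. ?D n x \<partial>M) \<longlonglongrightarrow> 0"
  proof (rule LIMSEQ_I)
    fix e :: real assume e: "e > 0"
    \<comment> \<open>The two square terms contribute at most \<open>4C/K\<close>, which has to stay below \<open>e/2\<close>.\<close>
    define K where "K = 8 * (C + 1) / e"
    have K: "K > 0" using e C(2) by (simp add: K_def)
    have "(\<lambda>n. \<integral>x. min (?D n x) K \<partial>M) \<longlonglongrightarrow> (\<integral>x. 0 \<partial>M)"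
    proof (rule integral_dominated_convergence[where w="\<lambda>_. K"])
      show "AE x in M. (\<lambda>n. min (?D n x) K) \<longlonglongrightarrow> 0"
        using ae
      proof eventually_elim
        fix x assume "(\<lambda>n. V n x) \<longlonglongrightarrow> V' x"
        then have "(\<lambda>n. min \<bar>V n x - V' x\<bar> K) \<longlonglongrightarrow> min \<bar>V' x - V' x\<bar> K" by (intro tendsto_intros)
        then show "(\<lambda>n. min (?D n x) K) \<longlonglongrightarrow> 0" using K by simp
      qed
      show "AE x in M. norm (min (?D n x) K) \<le> K" for n using K by (intro AE_I2) auto
    qed auto
    then have "(\<lambda>n. \<integral>x. min (?D n x) K \<partial>M) \<longlonglongrightarrow> 0" by simp
    from LIMSEQ_D[OF this, of "e/2"] e obtain n0 where n0: "\<And>n. n \<ge> n0 \<Longrightarrow> \<bar>\<integral>x. min (?D n x) K \<partial>M\<bar> < e / 2" by auto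
    show "\<exists>no. \<forall>n\<ge>no. norm ((\<integral>x. ?D n x \<partial>M) - 0) < e"
    proof (intro exI allI impI)
      fix n assume n: "n \<ge> n0"
      have im: "integrable M (\<lambda>x. min (?D n x) K)"
        using K by (intro integrable_const_bound[where B=K]) auto
      have pt: "?D n x \<le> min (?D n x) K + (2 * (V n x)\<^sup>2 + 2 * (V' x)\<^sup>2) / K" for x
      proof (cases "?D n x \<le> K")
        case True
        moreover have "0 \<le> (2 * (V n x)\<^sup>2 + 2 * (V' x)\<^sup>2) / K" using K by simp
        ultimately show ?thesis by simp
      next
        case False
        have "?D n x * K \<le> ?D n x * ?D n x" using False by (intro mult_left_mono) auto
        also have "\<dots> = (V n x - V' x)\<^sup>2" by (simp add: power2_eq_square)
        also have "\<dots> \<le> 2 * (V n x)\<^sup>2 + 2 * (V' x)\<^sup>2"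
          using norm_diff_sq_le[of "V n x" "V' x" 0] by simp
        finally have "?D n x \<le> (2 * (V n x)\<^sup>2 + 2 * (V' x)\<^sup>2) / K" using K by (simp add: pos_le_divide_eq)
        then show ?thesis using K False by simp
      qed
      have "(\<integral>x. ?D n x \<partial>M) \<le> (\<integral>x. min (?D n x) K + (2 * (V n x)\<^sup>2 + 2 * (V' x)\<^sup>2) / K \<partial>M)"
        by (intro integral_mono iD pt) (use im s1 s2 in auto)
      also have "\<dots> = (\<integral>x. min (?D n x) K \<partial>M) + (2 * (\<integral>x. (V n x)\<^sup>2 \<partial>M) + 2 * (\<integral>x. (V' x)\<^sup>2 \<partial>M)) / K"
        using im s1 s2 by simp
      also have "\<dots> \<le> (\<integral>x. min (?D n x) K \<partial>M) + (2 * C + 2 * C) / K"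
        using le[OF m(1) C(1)] le[OF m(2) fat] K by (intro add_left_mono divide_right_mono add_mono mult_left_mono) auto
      also have "\<dots> < e / 2 + e / 2"
      proof (rule add_less_le_mono)
        show "(\<integral>x. min (?D n x) K \<partial>M) < e / 2" using n0[OF n] by simp
        show "(2 * C + 2 * C) / K \<le> e / 2" using e C(2) by (simp add: K_def field_simps)
      qed
      finally have "(\<integral>x. ?D n x \<partial>M) < e" by simp
      moreover have "0 \<le> (\<integral>x. ?D n x \<partial>M)" by (intro integral_nonneg_AE) auto
      ultimately show "norm ((\<integral>x. ?D n x \<partial>M) - 0) < e" by simp
    qed
  qed
  then have "(\<lambda>n. \<integral>x. V n x - V' x \<partial>M) \<longlonglongrightarrow> 0"
    by (rule Lim_null_comparison[rotated]) (auto intro!: always_eventually integral_abs_bound)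
  then have "(\<lambda>n. (\<integral>x. V n x \<partial>M) - (\<integral>x. V' x \<partial>M)) \<longlonglongrightarrow> 0" using iV iV' by simp
  then show "(\<lambda>n. \<integral>x. V n x \<partial>M) \<longlonglongrightarrow> (\<integral>x. V' x \<partial>M)" by (rule LIM_zero_cancel)
qed

text \<open>A sum of increments that is switched off for good at some index telescopes up to that index.\<close>

lemma stopped_telescope:
  fixes f :: "nat \<Rightarrow> real" and G :: "nat \<Rightarrow> bool"
  assumes dec: "\<And>k. G (Suc k) \<Longrightarrow> G k"
  shows "\<exists>m\<ge>a. (\<Sum>k=a..<a+d. of_bool (G k) * (f (Suc k) - f k)) = f m - f a \<and> (m = a + d \<or> (m < a + d \<and> \<not> G m))"
proof (induction d)
  case 0 then show ?case by (intro exI[of _ a]) simp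
next
  case (Suc d)
  then obtain m where m: "m \<ge> a" "(\<Sum>k=a..<a+d. of_bool (G k) * (f (Suc k) - f k)) = f m - f a"
    "m = a + d \<or> (m < a + d \<and> \<not> G m)" by blast
  have mono: "\<not> G i \<Longrightarrow> i \<le> j \<Longrightarrow> \<not> G j" for i j
    by (rotate_tac 1, induction j rule: dec_induct) (use dec in auto)
  show ?case
  proof (cases "G (a + d)")
    case True
    then have "m = a + d" using m(3) mono[of m "a + d"] by auto
    then show ?thesis using m(1,2) True by (intro exI[of _ "Suc (a + d)"]) simp
  next
    case False
    then show ?thesis using m by (intro exI[of _ m]) auto
  qed
qed

context drifted begin

abbreviation mesh :: "nat \<Rightarrow> real" where "mesh n \<equiv> 1 / real (Suc n)"

lemma mesh_pos: "mesh n > 0" by simp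

definition Z_factor :: "nat \<Rightarrow> nat \<Rightarrow> path \<Rightarrow> real" where
  "Z_factor n k \<omega> = exp (- (drift_at n k \<omega> \<bullet> (\<omega> (grid n (Suc k)) - \<omega> (grid n k))) - (1/2) * (norm (drift_at n k \<omega>))\<^sup>2 * mesh n)"

text \<open>The density of the discretized measure, restricted to the first \<open>m\<close> steps.\<close>

definition Z :: "nat \<Rightarrow> nat \<Rightarrow> path \<Rightarrow> real" where
  "Z n m \<omega> = (\<Prod>k<m. Z_factor n k \<omega>)"

definition Zlim :: "path \<Rightarrow> real" where
  "Zlim \<omega> = exp (- I \<omega> - (1/2) * energy \<omega>)"

lemma Z_0 [simp]: "Z n 0 \<omega> = 1" and Z_Suc: "Z n (Suc k) \<omega> = Z n k \<omega> * Z_factor n k \<omega>"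
  by (simp_all add: Z_def)

lemma Z_pos: "Z n m \<omega> > 0"
  by (auto simp: Z_def Z_factor_def intro!: prod_pos)

lemma Z_full: "Z n (Suc n) \<omega> = exp (- L n \<omega> - (1/2) * energy_sum n \<omega>)"
  unfolding Z_def Z_factor_def exp_sum[OF finite_lessThan, symmetric]
  by (simp only: simple_integral_def energy_sum_def sum_subtractf sum_negf sum_distrib_left mult.assoc)

lemma Z_measurable_F:
  assumes "m \<le> Suc n" "grid n m \<le> t"
  shows "Z n m \<in> borel_measurable (F t)"
  unfolding Z_def
proof (rule borel_measurable_prod)
  fix k assume "k \<in> {..<m}"
  then have k: "Suc k \<le> m" "k \<le> Suc n" "Suc k \<le> Suc n" using assms by auto
  then have g: "grid n k \<le> t" "grid n (Suc k) \<le> t"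
    using assms(2) grid_mono[of k m n] grid_mono[of "Suc k" m n] by auto
  have [measurable]: "drift_at n k \<in> borel_measurable (F t)" using k g by (intro drift_at_measurable_F)
  have [measurable]: "(\<lambda>\<omega>. \<omega> (grid n k)) \<in> borel_measurable (F t)" "(\<lambda>\<omega>. \<omega> (grid n (Suc k))) \<in> borel_measurable (F t)"
    using k g grid_01 by (auto intro!: measurable_eval_usual)
  show "Z_factor n k \<in> borel_measurable (F t)" unfolding Z_factor_def by measurable
qed

lemma Z_measurable: "m \<le> Suc n \<Longrightarrow> Z n m \<in> borel_measurable M"
  using measurable_usual_completion[OF Z_measurable_F[OF _ order_refl]] .

lemma grid_increment:
  assumes "k < Suc n"
  shows "0 \<le> grid n k" "grid n k < grid n (Suc k)" "grid n (Suc k) \<le> 1" "grid n (Suc k) - grid n k = mesh n"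
  using assms grid_01[of k n] grid_01[of "Suc k" n] grid_less[of k "Suc k" n] grid_step by auto

text \<open>Given the past, the second moment of one factor is \<open>exp(|b|\<^sup>2h)\<close>.\<close>

lemma Z_sq_step:
  assumes k: "k < Suc n"
  shows "(\<integral>\<^sup>+\<omega>. ennreal ((Z n (Suc k) \<omega>)\<^sup>2) \<partial>M) \<le> ennreal (exp (B\<^sup>2 * mesh n)) * (\<integral>\<^sup>+\<omega>. ennreal ((Z n k \<omega>)\<^sup>2) \<partial>M)"
proof -
  note gi = grid_increment[OF k]
  have [measurable]: "Z n k \<in> borel_measurable (F (grid n k))" "drift_at n k \<in> borel_measurable (F (grid n k))"
    using k by (auto intro!: Z_measurable_F drift_at_measurable_F)
  let ?e = "\<lambda>\<omega> z. exp (- (drift_at n k \<omega> \<bullet> z) - (1/2) * (norm (drift_at n k \<omega>))\<^sup>2 * mesh n)"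
  let ?\<Phi> = "\<lambda>\<omega> z. ennreal ((Z n k \<omega>)\<^sup>2) * ennreal ((?e \<omega> z)\<^sup>2)"
  have m: "(\<lambda>(\<omega>, z). ?\<Phi> \<omega> z) \<in> borel_measurable (F (grid n k) \<Otimes>\<^sub>M borel)" by measurable
  have "(\<integral>\<^sup>+\<omega>. ennreal ((Z n (Suc k) \<omega>)\<^sup>2) \<partial>M) = (\<integral>\<^sup>+\<omega>. ?\<Phi> \<omega> (\<omega> (grid n (Suc k)) - \<omega> (grid n k)) \<partial>M)"
    by (intro nn_integral_cong) (simp add: Z_Suc Z_factor_def power_mult_distrib ennreal_mult)
  also have "\<dots> = (\<integral>\<^sup>+\<omega>. (\<integral>\<^sup>+z. ?\<Phi> \<omega> z \<partial>gauss (mesh n)) \<partial>M)"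
    using nn_integral_indep[OF gi(1-3) m] unfolding gi(4) .
  also have "\<dots> = (\<integral>\<^sup>+\<omega>. ennreal ((Z n k \<omega>)\<^sup>2) * ennreal (exp ((norm (drift_at n k \<omega>))\<^sup>2 * mesh n)) \<partial>M)"
  proof (intro nn_integral_cong)
    fix \<omega>
    have "(\<integral>\<^sup>+z. ?\<Phi> \<omega> z \<partial>gauss (mesh n)) = ennreal ((Z n k \<omega>)\<^sup>2) * (\<integral>\<^sup>+z. ennreal ((?e \<omega> z)\<^sup>2) \<partial>gauss (mesh n))"
      by (rule nn_integral_cmult) measurable
    then show "(\<integral>\<^sup>+z. ?\<Phi> \<omega> z \<partial>gauss (mesh n)) = ennreal ((Z n k \<omega>)\<^sup>2) * ennreal (exp ((norm (drift_at n k \<omega>))\<^sup>2 * mesh n))"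
      using nn_integral_gauss_exp_sq[OF mesh_pos[of n], of "drift_at n k \<omega>"] by (simp only:)
  qed
  also have "\<dots> \<le> (\<integral>\<^sup>+\<omega>. ennreal (exp (B\<^sup>2 * mesh n)) * ennreal ((Z n k \<omega>)\<^sup>2) \<partial>M)"
  proof (intro nn_integral_mono)
    fix \<omega>
    have "(norm (drift_at n k \<omega>))\<^sup>2 \<le> B\<^sup>2" using k by (intro power_mono drift_at_bound) auto
    then have "exp ((norm (drift_at n k \<omega>))\<^sup>2 * mesh n) \<le> exp (B\<^sup>2 * mesh n)" by (simp add: divide_right_mono)
    then show "ennreal ((Z n k \<omega>)\<^sup>2) * ennreal (exp ((norm (drift_at n k \<omega>))\<^sup>2 * mesh n)) \<le> ennreal (exp (B\<^sup>2 * mesh n)) * ennreal ((Z n k \<omega>)\<^sup>2)"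
      by (subst mult.commute, intro mult_right_mono ennreal_leI) auto
  qed
  also have "\<dots> = ennreal (exp (B\<^sup>2 * mesh n)) * (\<integral>\<^sup>+\<omega>. ennreal ((Z n k \<omega>)\<^sup>2) \<partial>M)"
    using k Z_measurable[of k n] by (subst nn_integral_cmult) auto
  finally show ?thesis .
qed

lemma Z_sq:
  assumes m: "m \<le> Suc n"
  shows "(\<integral>\<^sup>+\<omega>. ennreal ((Z n m \<omega>)\<^sup>2) \<partial>M) \<le> ennreal (exp (B\<^sup>2))"
proof -
  have "(\<integral>\<^sup>+\<omega>. ennreal ((Z n m \<omega>)\<^sup>2) \<partial>M) \<le> ennreal (exp (B\<^sup>2 * mesh n * real m))" using m
  proof (induction m)
    case 0 then show ?case using emeasure_space_1 by simp
  next
    case (Suc m)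
    have "(\<integral>\<^sup>+\<omega>. ennreal ((Z n (Suc m) \<omega>)\<^sup>2) \<partial>M) \<le> ennreal (exp (B\<^sup>2 * mesh n)) * (\<integral>\<^sup>+\<omega>. ennreal ((Z n m \<omega>)\<^sup>2) \<partial>M)"
      using Suc by (intro Z_sq_step) simp
    also have "\<dots> \<le> ennreal (exp (B\<^sup>2 * mesh n)) * ennreal (exp (B\<^sup>2 * mesh n * real m))"
      using Suc by (intro mult_left_mono) auto
    also have "\<dots> = ennreal (exp (B\<^sup>2 * mesh n * real (Suc m)))"
      by (simp add: ennreal_mult[symmetric] mult_exp_exp[symmetric] algebra_simps del: mult_exp_exp) (simp add: mult_exp_exp add_divide_distrib algebra_simps)
    finally show ?case .
  qed
  also have "\<dots> \<le> ennreal (exp (B\<^sup>2))"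
  proof (intro ennreal_leI)
    have "mesh n * real m \<le> 1" using m by (simp add: divide_le_eq)
    then have "B\<^sup>2 * (mesh n * real m) \<le> B\<^sup>2 * 1" by (intro mult_left_mono) auto
    then show "exp (B\<^sup>2 * mesh n * real m) \<le> exp (B\<^sup>2)" by (simp add: mult.assoc)
  qed
  finally show ?thesis .
qed

lemma Z_integrable: "m \<le> Suc n \<Longrightarrow> integrable M (Z n m)"
proof (rule square_integrable_imp_integrable)
  assume m: "m \<le> Suc n"
  then show "Z n m \<in> borel_measurable M" by (rule Z_measurable)
  then show "integrable M (\<lambda>\<omega>. (Z n m \<omega>)\<^sup>2)"
    using Z_sq[OF m] by (intro integrableI_nonneg) (auto intro: le_less_trans)
qed

lemma Z_mult_integrable:
  assumes "m \<le> Suc n" "Y \<in> borel_measurable M" "\<And>\<omega>. \<bar>Y \<omega>\<bar> \<le> C"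
  shows "integrable M (\<lambda>\<omega>. Z n m \<omega> * Y \<omega>)"
proof (rule Bochner_Integration.integrable_bound)
  show "integrable M (\<lambda>\<omega>. C * Z n m \<omega>)" using Z_integrable[OF assms(1)] by simp
  show "(\<lambda>\<omega>. Z n m \<omega> * Y \<omega>) \<in> borel_measurable M" using assms Z_measurable by simp
  show "AE \<omega> in M. norm (Z n m \<omega> * Y \<omega>) \<le> norm (C * Z n m \<omega>)"
  proof (rule AE_I2)
    fix \<omega>
    have "0 \<le> C" using order_trans[OF abs_ge_zero assms(3)] .
    then show "norm (Z n m \<omega> * Y \<omega>) \<le> norm (C * Z n m \<omega>)"
      using assms(3)[of \<omega>] Z_pos[of n m \<omega>] by (simp add: abs_mult mult.commute mult_right_mono)
  qed
qed

text \<open>Conditionally on the past, the factor turns the increment into a Gaussian variable with mean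
  \<open>-bh\<close>; all other terms are known at the beginning of the step.\<close>

lemma Z_step:
  fixes Y :: "path \<Rightarrow> real" and g0 g1 :: "real^3 \<Rightarrow> real"
  assumes k: "k < Suc n" and Y [measurable]: "Y \<in> borel_measurable (F (grid n k))" "\<And>\<omega>. \<bar>Y \<omega>\<bar> \<le> C"
    and g [measurable]: "g0 \<in> borel_measurable borel" "g1 \<in> borel_measurable borel"
    and gb: "\<And>x. \<bar>g0 x\<bar> \<le> D" "\<And>x. \<bar>g1 x\<bar> \<le> D"
  shows "(\<integral>\<omega>. Z n (Suc k) \<omega> * (Y \<omega> * (g1 (\<omega> (grid n (Suc k))) - g0 (\<omega> (grid n k)))) \<partial>M)
    = (\<integral>\<omega>. Z n k \<omega> * (Y \<omega> * (\<integral>z. g1 (\<omega> (grid n k) - mesh n *\<^sub>R drift_at n k \<omega> + z) - g0 (\<omega> (grid n k)) \<partial>gauss (mesh n))) \<partial>M)" (is ?A)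
   and "integrable M (\<lambda>\<omega>. Z n (Suc k) \<omega> * (Y \<omega> * (g1 (\<omega> (grid n (Suc k))) - g0 (\<omega> (grid n k)))))" (is ?B)
proof -
  note gi = grid_increment[OF k]
  have [measurable]: "Z n k \<in> borel_measurable (F (grid n k))" "drift_at n k \<in> borel_measurable (F (grid n k))"
    "(\<lambda>\<omega>. \<omega> (grid n k)) \<in> borel_measurable (F (grid n k))"
    using k grid_01[of k n] by (auto intro!: Z_measurable_F drift_at_measurable_F measurable_eval_usual)
  have YM: "Y \<in> borel_measurable M" by (rule measurable_usual_completion[OF Y(1)])
  have C0: "0 \<le> C" using order_trans[OF abs_ge_zero Y(2)] .
  let ?e = "\<lambda>\<omega> z. exp (- (drift_at n k \<omega> \<bullet> z) - (1/2) * (norm (drift_at n k \<omega>))\<^sup>2 * mesh n)"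
  let ?\<Phi> = "\<lambda>\<omega> z. Z n k \<omega> * Y \<omega> * (?e \<omega> z * (g1 (\<omega> (grid n k) + z) - g0 (\<omega> (grid n k))))"
  have m: "(\<lambda>(\<omega>, z). ?\<Phi> \<omega> z) \<in> borel_measurable (F (grid n k) \<Otimes>\<^sub>M borel)" by measurable
  have eM: "(\<lambda>\<omega>. \<omega> (grid n k)) \<in> borel_measurable M" "(\<lambda>\<omega>. \<omega> (grid n (Suc k))) \<in> borel_measurable M"
    using k grid_01 by (auto intro!: measurable_eval_M)
  show ?B
  proof (rule Z_mult_integrable)
    show "(\<lambda>\<omega>. Y \<omega> * (g1 (\<omega> (grid n (Suc k))) - g0 (\<omega> (grid n k)))) \<in> borel_measurable M"
      using YM measurable_compose[OF eM(1) g(1)] measurable_compose[OF eM(2) g(2)] by measurable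
    fix \<omega>
    have "\<bar>g1 (\<omega> (grid n (Suc k))) - g0 (\<omega> (grid n k))\<bar> \<le> 2 * D"
      using gb(1)[of "\<omega> (grid n k)"] gb(2)[of "\<omega> (grid n (Suc k))"] by linarith
    then show "\<bar>Y \<omega> * (g1 (\<omega> (grid n (Suc k))) - g0 (\<omega> (grid n k)))\<bar> \<le> C * (2 * D)"
      unfolding abs_mult using Y(2)[of \<omega>] C0 by (intro mult_mono) auto
  qed (use k in auto)
  have eq: "?\<Phi> \<omega> (\<omega> (grid n (Suc k)) - \<omega> (grid n k)) = Z n (Suc k) \<omega> * (Y \<omega> * (g1 (\<omega> (grid n (Suc k))) - g0 (\<omega> (grid n k))))" for \<omega>
    by (simp add: Z_Suc Z_factor_def)
  have "(\<integral>\<omega>. Z n (Suc k) \<omega> * (Y \<omega> * (g1 (\<omega> (grid n (Suc k))) - g0 (\<omega> (grid n k)))) \<partial>M)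
    = (\<integral>\<omega>. (\<integral>z. ?\<Phi> \<omega> z \<partial>gauss (grid n (Suc k) - grid n k)) \<partial>M)"
    using integral_indep[OF gi(1-3) m] \<open>?B\<close> unfolding eq by blast
  also have "\<dots> = (\<integral>\<omega>. (\<integral>z. ?\<Phi> \<omega> z \<partial>gauss (mesh n)) \<partial>M)" unfolding gi(4) ..
  also have "\<dots> = (\<integral>\<omega>. Z n k \<omega> * (Y \<omega> * (\<integral>z. g1 (\<omega> (grid n k) - mesh n *\<^sub>R drift_at n k \<omega> + z) - g0 (\<omega> (grid n k)) \<partial>gauss (mesh n))) \<partial>M)"
  proof (intro Bochner_Integration.integral_cong refl)
    fix \<omega>
    have "(\<integral>z. ?\<Phi> \<omega> z \<partial>gauss (mesh n)) = Z n k \<omega> * Y \<omega> * (\<integral>z. ?e \<omega> z * (g1 (\<omega> (grid n k) + z) - g0 (\<omega> (grid n k))) \<partial>gauss (mesh n))"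
      by (rule integral_mult_right_zero)
    also have "(\<integral>z. ?e \<omega> z * (g1 (\<omega> (grid n k) + z) - g0 (\<omega> (grid n k))) \<partial>gauss (mesh n))
      = (\<integral>z. g1 (\<omega> (grid n k) + (z - mesh n *\<^sub>R drift_at n k \<omega>)) - g0 (\<omega> (grid n k)) \<partial>gauss (mesh n))"
      by (rule integral_gauss_tilt[OF mesh_pos]) measurable
    finally show "(\<integral>z. ?\<Phi> \<omega> z \<partial>gauss (mesh n)) = Z n k \<omega> * (Y \<omega> * (\<integral>z. g1 (\<omega> (grid n k) - mesh n *\<^sub>R drift_at n k \<omega> + z) - g0 (\<omega> (grid n k)) \<partial>gauss (mesh n)))"
      by (simp add: algebra_simps)
  qed
  finally show ?A .
qed

text \<open>This is \<open>Z_step\<close> for an increment that is constantly 1.\<close>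

lemma Z_martingale_step:
  assumes k: "k < Suc n" and Y: "Y \<in> borel_measurable (F (grid n k))" "\<And>\<omega>. \<bar>Y \<omega>\<bar> \<le> C"
  shows "(\<integral>\<omega>. Z n (Suc k) \<omega> * Y \<omega> \<partial>M) = (\<integral>\<omega>. Z n k \<omega> * Y \<omega> \<partial>M)"
proof -
  interpret G: prob_space "gauss (mesh n)" by (rule prob_space_gauss[OF mesh_pos])
  have "measure (gauss (mesh n)) UNIV = 1" using G.prob_space by simp
  then show ?thesis
  using Z_step(1)[OF k Y, of "\<lambda>_. 0" "\<lambda>_. 1" 1] by simp
qed

lemma Z_martingale:
  assumes m: "m \<le> Suc n" and Y: "Y \<in> borel_measurable (F (grid n m))" "\<And>\<omega>. \<bar>Y \<omega>\<bar> \<le> C"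
  shows "(\<integral>\<omega>. Z n (Suc n) \<omega> * Y \<omega> \<partial>M) = (\<integral>\<omega>. Z n m \<omega> * Y \<omega> \<partial>M)"
  using m Y(1)
proof (induction m rule: inc_induct)
  case (step k)
  have "Y \<in> borel_measurable (F (grid n (Suc k)))"
    by (rule measurable_usual_mono[OF step.prems grid_mono]) simp
  then show ?case using step.IH Z_martingale_step[OF _ step.prems Y(2)] step.hyps by simp
qed simp

lemma Z_expectation: "m \<le> Suc n \<Longrightarrow> (\<integral>\<omega>. Z n m \<omega> \<partial>M) = 1"
proof (induction m)
  case (Suc m)
  then show ?case using Z_martingale_step[of m n "\<lambda>_. 1" 1] by simp
next
  case 0
  have "Z n 0 = (\<lambda>_. 1)" by auto
  then show ?case using prob_space by simp
qed

text \<open>Convergence in \<open>L\<^sup>2\<close> gives almost sure convergence only along a subsequence. It is fixed once and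
  for all.\<close>

definition ae_subseq :: "nat \<Rightarrow> nat" where
  "ae_subseq = (SOME r. strict_mono r \<and> (AE \<omega> in M. (\<lambda>n. L (r n) \<omega>) \<longlonglongrightarrow> I \<omega>))"

lemma ae_subseq: "strict_mono ae_subseq" "AE \<omega> in M. (\<lambda>n. L (ae_subseq n) \<omega>) \<longlonglongrightarrow> I \<omega>"
  using someI_ex[OF L_tendsto_subseq] unfolding ae_subseq_def by auto

lemma sub_at_top: "filterlim ae_subseq sequentially sequentially"
  by (rule filterlim_subseq[OF ae_subseq(1)])

lemma Z_tendsto: "AE \<omega> in M. (\<lambda>n. Z (ae_subseq n) (Suc (ae_subseq n)) \<omega>) \<longlonglongrightarrow> Zlim \<omega>"
  using ae_subseq(2) AE_space
proof eventually_elim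
  fix \<omega> assume l: "(\<lambda>n. L (ae_subseq n) \<omega>) \<longlonglongrightarrow> I \<omega>" and w: "\<omega> \<in> space M"
  have "(\<lambda>n. energy_sum (ae_subseq n) \<omega>) \<longlonglongrightarrow> energy \<omega>"
    by (rule filterlim_compose[OF energy_sum_tendsto[OF w] sub_at_top])
  then show "(\<lambda>n. Z (ae_subseq n) (Suc (ae_subseq n)) \<omega>) \<longlonglongrightarrow> Zlim \<omega>"
    unfolding Z_full Zlim_def by (intro tendsto_intros l)
qed

lemma energy_measurable_\<mu>: "energy \<in> borel_measurable \<mu>"
proof (rule borel_measurable_LIMSEQ_metric)
  show "energy_sum n \<in> borel_measurable \<mu>" for n
  proof -
    have [measurable]: "drift_at n k \<in> borel_measurable \<mu>" if "k < Suc n" for k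
      unfolding drift_at_def using that grid_01[of k n] by (intro measurable_compose[OF measurable_eval_\<mu> b_measurable]) auto
    show ?thesis unfolding energy_sum_def by (intro borel_measurable_sum) auto
  qed
  show "(\<lambda>n. energy_sum n \<omega>) \<longlonglongrightarrow> energy \<omega>" if "\<omega> \<in> space \<mu>" for \<omega>
    using energy_sum_tendsto that by simp
qed

lemma Zlim_measurable_\<mu>: "Zlim \<in> borel_measurable \<mu>"
  using I_measurable_\<mu> energy_measurable_\<mu> unfolding Zlim_def by measurable

lemma Zlim_measurable [measurable]: "Zlim \<in> borel_measurable M"
  by (rule measurable_completion[OF Zlim_measurable_\<mu>])

lemma Zlim_pos: "Zlim \<omega> > 0" by (simp add: Zlim_def)

lemma Z_limit:
  assumes Y [measurable]: "\<And>n. Y n \<in> borel_measurable M" "Y' \<in> borel_measurable M"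
    and b: "\<And>n \<omega>. \<bar>Y n \<omega>\<bar> \<le> C" and l: "AE \<omega> in M. (\<lambda>n. Y n \<omega>) \<longlonglongrightarrow> Y' \<omega>"
  shows "integrable M (\<lambda>\<omega>. Zlim \<omega> * Y' \<omega>)"
    "(\<lambda>n. \<integral>\<omega>. Z (ae_subseq n) (Suc (ae_subseq n)) \<omega> * Y n \<omega> \<partial>M) \<longlonglongrightarrow> (\<integral>\<omega>. Zlim \<omega> * Y' \<omega> \<partial>M)"
proof -
  have [measurable]: "Z n (Suc n) \<in> borel_measurable M" for n by (rule Z_measurable) simp
  have ae: "AE \<omega> in M. (\<lambda>n. Z (ae_subseq n) (Suc (ae_subseq n)) \<omega> * Y n \<omega>) \<longlonglongrightarrow> Zlim \<omega> * Y' \<omega>"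
    using Z_tendsto l by eventually_elim (rule tendsto_mult)
  have le: "(\<integral>\<^sup>+\<omega>. ennreal ((Z (ae_subseq n) (Suc (ae_subseq n)) \<omega> * Y n \<omega>)\<^sup>2) \<partial>M) \<le> ennreal (C\<^sup>2 * exp (B\<^sup>2))" for n
  proof -
    have "(\<integral>\<^sup>+\<omega>. ennreal ((Z (ae_subseq n) (Suc (ae_subseq n)) \<omega> * Y n \<omega>)\<^sup>2) \<partial>M)
      \<le> (\<integral>\<^sup>+\<omega>. ennreal (C\<^sup>2) * ennreal ((Z (ae_subseq n) (Suc (ae_subseq n)) \<omega>)\<^sup>2) \<partial>M)"
    proof (intro nn_integral_mono)
      fix \<omega>
      have "(Y n \<omega>)\<^sup>2 \<le> C\<^sup>2" using b[of n \<omega>] power_mono[of "\<bar>Y n \<omega>\<bar>" C 2] by simp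
      then show "ennreal ((Z (ae_subseq n) (Suc (ae_subseq n)) \<omega> * Y n \<omega>)\<^sup>2) \<le> ennreal (C\<^sup>2) * ennreal ((Z (ae_subseq n) (Suc (ae_subseq n)) \<omega>)\<^sup>2)"
        by (simp add: ennreal_mult[symmetric] power_mult_distrib mult.commute mult_right_mono)
    qed
    also have "\<dots> = ennreal (C\<^sup>2) * (\<integral>\<^sup>+\<omega>. ennreal ((Z (ae_subseq n) (Suc (ae_subseq n)) \<omega>)\<^sup>2) \<partial>M)"
      by (rule nn_integral_cmult) measurable
    also have "\<dots> \<le> ennreal (C\<^sup>2) * ennreal (exp (B\<^sup>2))" by (intro mult_left_mono Z_sq) auto
    finally show ?thesis by (simp add: ennreal_mult)
  qed
  show "integrable M (\<lambda>\<omega>. Zlim \<omega> * Y' \<omega>)"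
    "(\<lambda>n. \<integral>\<omega>. Z (ae_subseq n) (Suc (ae_subseq n)) \<omega> * Y n \<omega> \<partial>M) \<longlonglongrightarrow> (\<integral>\<omega>. Zlim \<omega> * Y' \<omega> \<partial>M)"
    by (rule L2_bounded_AE_convergence[OF _ _ ae le]; measurable)+
qed

lemma Zlim_mult_integrable:
  assumes "Y \<in> borel_measurable M" "\<And>\<omega>. \<bar>Y \<omega>\<bar> \<le> C"
  shows "integrable M (\<lambda>\<omega>. Zlim \<omega> * Y \<omega>)"
  using Z_limit(1)[of "\<lambda>_. Y" Y C] assms by simp

lemma Zlim_integrable: "integrable M Zlim"
  using Zlim_mult_integrable[of "\<lambda>_. 1" 1] by simp

lemma Zlim_expectation: "(\<integral>\<omega>. Zlim \<omega> \<partial>M) = 1"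
proof -
  have "(\<lambda>n. \<integral>\<omega>. Z (ae_subseq n) (Suc (ae_subseq n)) \<omega> * 1 \<partial>M) \<longlonglongrightarrow> (\<integral>\<omega>. Zlim \<omega> * 1 \<partial>M)"
    by (rule Z_limit(2)[where C=1]) auto
  then have "(\<lambda>n. 1) \<longlonglongrightarrow> (\<integral>\<omega>. Zlim \<omega> \<partial>M)" by (simp add: Z_expectation)
  then show ?thesis by (simp add: LIMSEQ_const_iff)
qed

end

section \<open>The martingale property from a one-step estimate\<close>

text \<open>The index of the first grid point at or after \<open>s\<close>. Rounding upwards keeps events of the past at
  \<open>s\<close> measurable at the grid point.\<close>

definition grid_above :: "nat \<Rightarrow> real \<Rightarrow> nat" where
  "grid_above n s = nat \<lceil>s * real (Suc n)\<rceil>"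

lemma upper_le: "s \<le> 1 \<Longrightarrow> grid_above n s \<le> Suc n"
proof -
  assume "s \<le> 1"
  then have "s * real (Suc n) \<le> 1 * real (Suc n)" by (intro mult_right_mono) auto
  then show ?thesis by (simp add: grid_above_def ceiling_le_iff del: of_nat_Suc)
qed

lemma upper_mono: "s \<le> t \<Longrightarrow> grid_above n s \<le> grid_above n t"
  unfolding grid_above_def by (intro nat_mono ceiling_mono mult_right_mono) auto

lemma grid_upper:
  assumes "0 \<le> s"
  shows "s \<le> grid n (grid_above n s)" "grid n (grid_above n s) \<le> s + 1 / real (Suc n)"
proof -
  have "0 \<le> s * real (Suc n)" using assms by simp
  then have "real (grid_above n s) = of_int \<lceil>s * real (Suc n)\<rceil>"
    unfolding grid_above_def by (subst of_nat_nat) (auto simp: less_le_trans[of "-1" 0])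
  then have "s * real (Suc n) \<le> real (grid_above n s)" "real (grid_above n s) \<le> s * real (Suc n) + 1"
    by linarith+
  then show "s \<le> grid n (grid_above n s)" "grid n (grid_above n s) \<le> s + 1 / real (Suc n)"
    by (simp_all add: grid_def field_simps del: of_nat_Suc)
qed

lemma grid_upper_tendsto:
  assumes "0 \<le> s" shows "(\<lambda>n. grid n (grid_above n s)) \<longlonglongrightarrow> s"
proof (rule real_tendsto_sandwich[of "\<lambda>_. s" _ _ "\<lambda>n. s + 1 / real (Suc n)"])
  have "(\<lambda>n. s + inverse (real (Suc n))) \<longlonglongrightarrow> s + 0" by (intro tendsto_intros LIMSEQ_inverse_real_of_nat)
  then show "(\<lambda>n. s + 1 / real (Suc n)) \<longlonglongrightarrow> s" by (simp add: inverse_eq_divide)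
qed (use grid_upper[OF assms] in auto)

text \<open>The last assumption says that \<open>f\<close> solves the backward equation in a weak, one-step sense:
  along one Euler step of the drifted Brownian motion its mean changes by \<open>o(h)\<close>, locally uniformly.\<close>

locale backward_harmonic = drifted +
  fixes f :: "real \<Rightarrow> real^3 \<Rightarrow> real" and C :: real
  assumes cont_f: "continuous_on slab (\<lambda>(t, x). f t x)"
    and bound_f: "\<And>t x. t \<in> {0..1} \<Longrightarrow> \<bar>f t x\<bar> \<le> C"
    and one_step: "\<And>R \<epsilon>. \<epsilon> > 0 \<Longrightarrow> \<exists>\<delta>>0. \<forall>h t x. 0 < h \<longrightarrow> h < \<delta> \<longrightarrow> 0 \<le> t \<longrightarrow> t + h \<le> 1 \<longrightarrow> norm x \<le> R \<longrightarrow>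
       \<bar>\<integral>z. f (t + h) (x - h *\<^sub>R b t x + z) - f t x \<partial>gauss h\<bar> \<le> \<epsilon> * h"
begin

lemma C_nonneg: "0 \<le> C"
  using order_trans[OF abs_ge_zero bound_f[of 0 0]] by simp

lemma f_measurable: "t \<in> {0..1} \<Longrightarrow> f t \<in> borel_measurable borel"
proof (rule borel_measurable_continuous_onI)
  assume t: "t \<in> {0..1}"
  have "continuous_on UNIV ((\<lambda>(t, x). f t x) \<circ> (\<lambda>x. (t, x)))"
    using t by (intro continuous_on_compose continuous_on_subset[OF cont_f] continuous_intros) auto
  then show "continuous_on UNIV (f t)" by (simp add: o_def)
qed

lemma f_path_continuous:
  assumes "\<omega> \<in> space M" shows "continuous_on {0..1} (\<lambda>t. f t (\<omega> t))"
proof -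
  have "continuous_on {0..1} ((\<lambda>(t, x). f t x) \<circ> (\<lambda>t. (t, \<omega> t)))"
    by (intro continuous_on_compose continuous_on_subset[OF cont_f] continuous_intros path_continuous assms) auto
  then show ?thesis by (simp add: o_def)
qed

lemma f_eval_measurable_F: "r \<in> {0..1} \<Longrightarrow> r \<le> t \<Longrightarrow> (\<lambda>\<omega>. f r (\<omega> r)) \<in> borel_measurable (F t)"
  by (rule measurable_compose[OF measurable_eval_usual f_measurable])

lemma f_eval_measurable: "r \<in> {0..1} \<Longrightarrow> (\<lambda>\<omega>. f r (\<omega> r)) \<in> borel_measurable M"
  by (rule measurable_compose[OF measurable_eval_M f_measurable])

definition f_grid :: "nat \<Rightarrow> nat \<Rightarrow> path \<Rightarrow> real" where
  "f_grid n k \<omega> = f (grid n k) (\<omega> (grid n k))"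

definition inside :: "real \<Rightarrow> nat \<Rightarrow> nat \<Rightarrow> path \<Rightarrow> bool" where
  "inside R n k \<omega> \<longleftrightarrow> (\<forall>j\<in>{..k}. norm (\<omega> (grid n j)) \<le> R)"

text \<open>Only countably many grid points are inspected, so this is an event; by continuity it says that
  the path leaves the ball.\<close>

definition escape :: "real \<Rightarrow> path set" where
  "escape R = {\<omega>\<in>space M. \<exists>n. \<not> inside R n (Suc n) \<omega>}"

lemma inside_measurable_F:
  assumes "k \<le> Suc n" "grid n k \<le> t"
  shows "Measurable.pred (F t) (inside R n k)"
proof -
  have "Measurable.pred (F t) (\<lambda>\<omega>. norm (\<omega> (grid n j)) \<le> R)" if "j \<in> {..k}" for j
  proof -
    have [measurable]: "(\<lambda>\<omega>. \<omega> (grid n j)) \<in> borel_measurable (F t)"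
      using that assms grid_01[of j n] grid_mono[of j k n] by (intro measurable_eval_usual) auto
    show ?thesis by measurable
  qed
  then show ?thesis unfolding inside_def[abs_def] by (intro pred_intros_finite) auto
qed

lemma inside_measurable: "k \<le> Suc n \<Longrightarrow> Measurable.pred M (inside R n k)"
  using measurable_usual_completion[OF inside_measurable_F[OF _ order_refl]] .

lemma escape_measurable [measurable]: "escape R \<in> sets M"
proof -
  have "Measurable.pred M (\<lambda>\<omega>. \<exists>n. \<not> inside R n (Suc n) \<omega>)"
    using inside_measurable[of "Suc n" n R for n] by (intro pred_intros_countable pred_intros_logic) auto
  then show ?thesis unfolding escape_def pred_def .
qed

lemma path_bounded:
  assumes w: "\<omega> \<in> space M" shows "\<exists>R. \<forall>r\<ge>R. \<omega> \<notin> escape r"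
proof -
  have "bounded (\<omega> ` {0..1})"
    by (intro compact_imp_bounded compact_continuous_image path_continuous[OF w]) auto
  then obtain R where "\<forall>x\<in>\<omega> ` {0..1}. norm x \<le> R" unfolding bounded_iff by blast
  then have R: "\<And>t. t \<in> {0..1} \<Longrightarrow> norm (\<omega> t) \<le> R" by blast
  have "\<omega> \<notin> escape r" if "r \<ge> R" for r
    using order_trans[OF R that] grid_01 unfolding escape_def inside_def by auto
  then show ?thesis by blast
qed

lemma escape_prob_tendsto: "(\<lambda>r::nat. \<integral>\<omega>. Zlim \<omega> * indicator (escape (real r)) \<omega> \<partial>M) \<longlonglongrightarrow> 0"
proof -
  have "(\<lambda>r::nat. \<integral>\<omega>. Zlim \<omega> * indicator (escape (real r)) \<omega> \<partial>M) \<longlonglongrightarrow> (\<integral>\<omega>. 0 \<partial>M)"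
  proof (rule integral_dominated_convergence[where w=Zlim])
    show "AE \<omega> in M. (\<lambda>r. Zlim \<omega> * indicator (escape (real r)) \<omega>) \<longlonglongrightarrow> 0"
    proof (rule AE_I2)
      fix \<omega> assume "\<omega> \<in> space M"
      then obtain R where R: "\<And>r. r \<ge> R \<Longrightarrow> \<omega> \<notin> escape r" using path_bounded by blast
      obtain N :: nat where N: "R \<le> real N" using real_arch_simple by blast
      have "\<forall>\<^sub>F r in sequentially. Zlim \<omega> * indicator (escape (real r)) \<omega> = 0"
        using eventually_ge_at_top[of N]
      proof eventually_elim
        fix r assume "N \<le> r"
        then have "\<omega> \<notin> escape (real r)" using N by (intro R) linarith
        then show "Zlim \<omega> * indicator (escape (real r)) \<omega> = 0" by simp
      qed
      then show "(\<lambda>r. Zlim \<omega> * indicator (escape (real r)) \<omega>) \<longlonglongrightarrow> 0" by (rule tendsto_eventually)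
    qed
    show "AE \<omega> in M. norm (Zlim \<omega> * indicator (escape (real r)) \<omega>) \<le> Zlim \<omega>" for r
      using Zlim_pos by (intro AE_I2) (auto simp: indicator_def less_imp_le)
  qed (auto intro: Zlim_integrable)
  then show ?thesis by simp
qed

lemma f_grid_bound: "k \<le> Suc n \<Longrightarrow> \<bar>f_grid n k \<omega>\<bar> \<le> C"
  unfolding f_grid_def by (intro bound_f grid_01)

lemma f_grid_measurable: "k \<le> Suc n \<Longrightarrow> f_grid n k \<in> borel_measurable M"
  unfolding f_grid_def using f_eval_measurable grid_01 by blast

definition stopped_sum :: "real \<Rightarrow> nat \<Rightarrow> nat \<Rightarrow> nat \<Rightarrow> path \<Rightarrow> real" where
  "stopped_sum R n a d \<omega> = (\<Sum>k=a..<a+d. of_bool (inside R n k \<omega>) * (f_grid n (Suc k) \<omega> - f_grid n k \<omega>))"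

text \<open>Off the escape event nothing is stopped; on it four values of \<open>f\<close> are compared, each bounded by \<open>C\<close>.\<close>

lemma stopped_sum_close:
  assumes ad: "a + d \<le> Suc n" and w: "\<omega> \<in> space M"
  shows "\<bar>stopped_sum R n a d \<omega> - (f_grid n (a + d) \<omega> - f_grid n a \<omega>)\<bar> \<le> 4 * C * indicator (escape R) \<omega>"
proof -
  have dec: "inside R n (Suc k) \<omega> \<Longrightarrow> inside R n k \<omega>" for k by (auto simp: inside_def)
  obtain m where m: "m \<ge> a" "stopped_sum R n a d \<omega> = f_grid n m \<omega> - f_grid n a \<omega>" "m = a + d \<or> (m < a + d \<and> \<not> inside R n m \<omega>)"
    using stopped_telescope[where G="\<lambda>k. inside R n k \<omega>" and f="\<lambda>k. f_grid n k \<omega>", OF dec, of a d]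
    unfolding stopped_sum_def by blast
  show ?thesis
  proof (cases "m = a + d")
    case True then show ?thesis using m C_nonneg by (simp add: indicator_def)
  next
    case False
    then have "m < a + d" "\<not> inside R n m \<omega>" using m by auto
    then have "\<not> inside R n (Suc n) \<omega>" using ad unfolding inside_def by (meson atMost_iff le_trans less_imp_le)
    then have "\<omega> \<in> escape R" using w by (auto simp: escape_def)
    moreover have "\<bar>f_grid n m \<omega>\<bar> \<le> C" "\<bar>f_grid n (a + d) \<omega>\<bar> \<le> C" "\<bar>f_grid n a \<omega>\<bar> \<le> C"
      using \<open>m < a + d\<close> ad by (auto intro!: f_grid_bound)
    ultimately show ?thesis using m(2) C_nonneg by simp
  qed
qed

text \<open>Stopping makes the one-step estimate applicable: a step counts only if it starts in the ball. There
  are at most \<open>n + 1\<close> steps, each with an error of at most \<open>\<epsilon>\<close> times the mesh.\<close>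

lemma stopped_sum_expectation:
  assumes \<epsilon>: "\<epsilon> > 0" and A: "A \<in> sets (F s)" and s: "s \<le> grid n a" and ad: "a + d \<le> Suc n"
   and \<delta>: "\<And>h t x. 0 < h \<Longrightarrow> h < \<delta> \<Longrightarrow> 0 \<le> t \<Longrightarrow> t + h \<le> 1 \<Longrightarrow> norm x \<le> R \<Longrightarrow>
       \<bar>\<integral>z. f (t + h) (x - h *\<^sub>R b t x + z) - f t x \<partial>gauss h\<bar> \<le> \<epsilon> * h" and n: "mesh n < \<delta>"
  shows "\<bar>\<integral>\<omega>. Z n (Suc n) \<omega> * (indicator A \<omega> * stopped_sum R n a d \<omega>) \<partial>M\<bar> \<le> \<epsilon>"
    and "integrable M (\<lambda>\<omega>. Z n (Suc n) \<omega> * (indicator A \<omega> * stopped_sum R n a d \<omega>))"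
proof -
  let ?Y = "\<lambda>k \<omega>. indicator A \<omega> * of_bool (inside R n k \<omega>) :: real"
  let ?T = "\<lambda>k \<omega>. ?Y k \<omega> * (f_grid n (Suc k) \<omega> - f_grid n k \<omega>)"
  let ?k = "{a..<a+d}"
  have mid: "(\<integral>\<omega>. Z n (Suc n) \<omega> * ?T k \<omega> \<partial>M) = (\<integral>\<omega>. Z n (Suc k) \<omega> * ?T k \<omega> \<partial>M)"
    and bd: "\<bar>\<integral>\<omega>. Z n (Suc k) \<omega> * ?T k \<omega> \<partial>M\<bar> \<le> \<epsilon> * mesh n"
    and int: "integrable M (\<lambda>\<omega>. Z n (Suc n) \<omega> * ?T k \<omega>)" if k: "k \<in> ?k" for k
  proof -
    have k': "k < Suc n" "a \<le> k" using k ad by auto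
    note gi = grid_increment[OF k'(1)]
    have As: "A \<in> sets (F (grid n k))" using A usual_mono[of s "grid n k"] s grid_mono[OF k'(2), of n] by auto
    have [measurable]: "A \<in> sets (F (grid n k))" by (rule As)
    have [measurable]: "Measurable.pred (F (grid n k)) (inside R n k)" using k' by (intro inside_measurable_F) auto
    have Y: "?Y k \<in> borel_measurable (F (grid n k))" by measurable
    have Yb: "\<bar>?Y k \<omega>\<bar> \<le> 1" for \<omega> by (simp add: indicator_def)
    have YF: "?Y k \<in> borel_measurable (F (grid n (Suc k)))"
      by (rule measurable_usual_mono[OF Y]) (use gi in simp)
    have ff: "f_grid n (Suc k) \<in> borel_measurable (F (grid n (Suc k)))" "f_grid n k \<in> borel_measurable (F (grid n (Suc k)))"
      unfolding f_grid_def using k' grid_01[of k n] grid_01[of "Suc k" n] gi by (auto intro!: f_eval_measurable_F)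
    have Tm: "?T k \<in> borel_measurable (F (grid n (Suc k)))" using YF ff by measurable
    have Tb: "\<bar>?T k \<omega>\<bar> \<le> 2 * C" for \<omega>
    proof -
      have "\<bar>f_grid n (Suc k) \<omega> - f_grid n k \<omega>\<bar> \<le> 2 * C"
        using f_grid_bound[of "Suc k" n \<omega>] f_grid_bound[of k n \<omega>] k' by simp
      then show ?thesis using C_nonneg by (simp add: indicator_def)
    qed
    show "(\<integral>\<omega>. Z n (Suc n) \<omega> * ?T k \<omega> \<partial>M) = (\<integral>\<omega>. Z n (Suc k) \<omega> * ?T k \<omega> \<partial>M)"
      by (rule Z_martingale[OF _ Tm Tb]) (use k' in simp)
    show "integrable M (\<lambda>\<omega>. Z n (Suc n) \<omega> * ?T k \<omega>)"
      by (rule Z_mult_integrable[OF order_refl measurable_usual_completion[OF Tm] Tb])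
    let ?D = "\<lambda>\<omega>. \<integral>z. f (grid n (Suc k)) (\<omega> (grid n k) - mesh n *\<^sub>R drift_at n k \<omega> + z) - f (grid n k) (\<omega> (grid n k)) \<partial>gauss (mesh n)"
    have g01: "grid n k \<in> {0..1}" "grid n (Suc k) \<in> {0..1}" using k' by (intro grid_01; simp)+
    define g0 where "g0 = f (grid n k)"
    define g1 where "g1 = f (grid n (Suc k))"
    have "(\<integral>\<omega>. Z n (Suc k) \<omega> * ?T k \<omega> \<partial>M) = (\<integral>\<omega>. Z n k \<omega> * (?Y k \<omega> * ?D \<omega>) \<partial>M)"
      unfolding f_grid_def g0_def[symmetric] g1_def[symmetric]
      by (rule Z_step(1)[OF k'(1) Y Yb, of _ _ C]) (use g01 bound_f f_measurable in \<open>auto simp: g0_def g1_def\<close>)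
    moreover have "\<bar>\<integral>\<omega>. Z n k \<omega> * (?Y k \<omega> * ?D \<omega>) \<partial>M\<bar> \<le> (\<integral>\<omega>. Z n k \<omega> * (\<epsilon> * mesh n) \<partial>M)"
    proof (rule order_trans[OF integral_abs_bound], rule integral_mono')
      show "integrable M (\<lambda>\<omega>. Z n k \<omega> * (\<epsilon> * mesh n))" using k' by (intro integrable_mult_left Z_integrable) auto
      fix \<omega>
      show "0 \<le> Z n k \<omega> * (\<epsilon> * mesh n)" using Z_pos[of n k \<omega>] \<epsilon> by (simp add: less_imp_le)
      have "\<bar>?Y k \<omega> * ?D \<omega>\<bar> \<le> \<epsilon> * mesh n"
      proof (cases "inside R n k \<omega>")
        case True
        then have nr: "norm (\<omega> (grid n k)) \<le> R" by (auto simp: inside_def)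
        have gs: "grid n k + mesh n = grid n (Suc k)" using gi by simp
        have "\<bar>?D \<omega>\<bar> \<le> \<epsilon> * mesh n"
          using \<delta>[OF mesh_pos n, of "grid n k" "\<omega> (grid n k)"] gi nr unfolding gs drift_at_def by blast
        moreover have "0 \<le> \<epsilon> * mesh n" using \<epsilon> by simp
        ultimately show ?thesis by (cases "\<omega> \<in> A") auto
      next
        case False
        then show ?thesis using \<epsilon> by simp
      qed
      then show "\<bar>Z n k \<omega> * (?Y k \<omega> * ?D \<omega>)\<bar> \<le> Z n k \<omega> * (\<epsilon> * mesh n)"
        unfolding abs_mult[of "Z n k \<omega>"] using Z_pos[of n k \<omega>] by (simp only: abs_of_pos) (intro mult_left_mono, auto)
    qed
    moreover have "(\<integral>\<omega>. Z n k \<omega> * (\<epsilon> * mesh n) \<partial>M) = \<epsilon> * mesh n" using Z_expectation[of k n] k' by simp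
    ultimately show "\<bar>\<integral>\<omega>. Z n (Suc k) \<omega> * ?T k \<omega> \<partial>M\<bar> \<le> \<epsilon> * mesh n" by (simp only:)
  qed
  have eq: "Z n (Suc n) \<omega> * (indicator A \<omega> * stopped_sum R n a d \<omega>) = (\<Sum>k\<in>?k. Z n (Suc n) \<omega> * ?T k \<omega>)" for \<omega>
    unfolding stopped_sum_def sum_distrib_left by (simp only: mult.assoc)
  show "integrable M (\<lambda>\<omega>. Z n (Suc n) \<omega> * (indicator A \<omega> * stopped_sum R n a d \<omega>))"
    unfolding eq by (intro Bochner_Integration.integrable_sum int)
  have "(\<integral>\<omega>. Z n (Suc n) \<omega> * (indicator A \<omega> * stopped_sum R n a d \<omega>) \<partial>M) = (\<Sum>k\<in>?k. \<integral>\<omega>. Z n (Suc n) \<omega> * ?T k \<omega> \<partial>M)"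
    unfolding eq by (rule Bochner_Integration.integral_sum[OF int])
  also have "\<bar>\<dots>\<bar> \<le> (\<Sum>k\<in>?k. \<epsilon> * mesh n)"
    by (rule order_trans[OF sum_abs sum_mono]) (use mid bd in auto)
  also have "\<dots> = real d * (\<epsilon> * mesh n)" by simp
  also have "\<dots> \<le> real (Suc n) * (\<epsilon> * mesh n)" using ad \<epsilon> by (intro mult_right_mono) auto
  also have "\<dots> = \<epsilon>" by simp
  finally show "\<bar>\<integral>\<omega>. Z n (Suc n) \<omega> * (indicator A \<omega> * stopped_sum R n a d \<omega>) \<partial>M\<bar> \<le> \<epsilon>" .
qed

lemma grid_upper_01: "s \<in> {0..1} \<Longrightarrow> grid n (grid_above n s) \<in> {0..1}"
  using upper_le by (intro grid_01) auto

lemma f_grid_upper_tendsto: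
  assumes w: "\<omega> \<in> space M" and s: "s \<in> {0..1}"
  shows "(\<lambda>n. f_grid (ae_subseq n) (grid_above (ae_subseq n) s) \<omega>) \<longlonglongrightarrow> f s (\<omega> s)"
proof -
  have "(\<lambda>n. grid (ae_subseq n) (grid_above (ae_subseq n) s)) \<longlonglongrightarrow> s"
    by (rule filterlim_compose[OF grid_upper_tendsto sub_at_top]) (use s in auto)
  from continuous_on_tendsto_compose[OF f_path_continuous[OF w] this s]
  show ?thesis unfolding f_grid_def using grid_upper_01[OF s] by simp
qed

text \<open>First the mesh tends to 0 along the subsequence for a fixed radius, then the radius tends to
  infinity.\<close>

theorem martingale_identity:
  assumes st: "s \<in> {0..1}" "t \<in> {0..1}" "s \<le> t" and A: "A \<in> sets (F s)"
  shows "(\<integral>\<omega>. Zlim \<omega> * (indicator A \<omega> * (f t (\<omega> t) - f s (\<omega> s))) \<partial>M) = 0"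
proof -
  let ?I = "\<integral>\<omega>. Zlim \<omega> * (indicator A \<omega> * (f t (\<omega> t) - f s (\<omega> s))) \<partial>M"
  have AM [measurable]: "A \<in> sets M" using A sets_usual_completion[of s] by auto
  let ?U = "\<lambda>n \<omega>. indicator A \<omega> * (f_grid (ae_subseq n) (grid_above (ae_subseq n) t) \<omega> - f_grid (ae_subseq n) (grid_above (ae_subseq n) s) \<omega>)"
  have Um: "?U n \<in> borel_measurable M" for n
  proof -
    have le: "grid_above (ae_subseq n) s \<le> Suc (ae_subseq n)" "grid_above (ae_subseq n) t \<le> Suc (ae_subseq n)" using st by (auto intro!: upper_le)
    note [measurable] = f_grid_measurable[OF le(1)] f_grid_measurable[OF le(2)]
    show ?thesis by measurable
  qed
  have Ub: "\<bar>?U n \<omega>\<bar> \<le> 2 * C" for n \<omega>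
    using f_grid_bound[of "grid_above (ae_subseq n) s" "ae_subseq n" \<omega>] f_grid_bound[of "grid_above (ae_subseq n) t" "ae_subseq n" \<omega>] C_nonneg st upper_le
    by (auto simp: indicator_def)
  have U'm: "(\<lambda>\<omega>. indicator A \<omega> * (f t (\<omega> t) - f s (\<omega> s))) \<in> borel_measurable M"
    using f_eval_measurable[OF st(1)] f_eval_measurable[OF st(2)] AM by measurable
  have lim: "(\<lambda>n. \<integral>\<omega>. Z (ae_subseq n) (Suc (ae_subseq n)) \<omega> * ?U n \<omega> \<partial>M) \<longlonglongrightarrow> ?I"
    by (rule Z_limit(2)[OF Um U'm Ub]) (intro AE_I2 tendsto_intros f_grid_upper_tendsto st)
  have bound: "\<bar>?I\<bar> \<le> \<epsilon> + 4 * C * (\<integral>\<omega>. Zlim \<omega> * indicator (escape R) \<omega> \<partial>M)" if \<epsilon>: "\<epsilon> > 0" for \<epsilon> R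
  proof -
    obtain \<delta> where \<delta>: "\<delta> > 0" "\<And>h t x. 0 < h \<Longrightarrow> h < \<delta> \<Longrightarrow> 0 \<le> t \<Longrightarrow> t + h \<le> 1 \<Longrightarrow> norm x \<le> R \<Longrightarrow>
       \<bar>\<integral>z. f (t + h) (x - h *\<^sub>R b t x + z) - f t x \<partial>gauss h\<bar> \<le> \<epsilon> * h"
      using one_step[OF \<epsilon>, of R] by blast
    have "(\<lambda>n. mesh (ae_subseq n)) \<longlonglongrightarrow> 0"
      using filterlim_compose[OF LIMSEQ_inverse_real_of_nat sub_at_top] by (simp add: inverse_eq_divide)
    from order_tendstoD(2)[OF this \<delta>(1)] have ev: "\<forall>\<^sub>F n in sequentially. mesh (ae_subseq n) < \<delta>" .
    have le: "\<bar>\<integral>\<omega>. Z n (Suc n) \<omega> * (indicator A \<omega> * (f_grid n (grid_above n t) \<omega> - f_grid n (grid_above n s) \<omega>)) \<partial>M\<bar>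
       \<le> \<epsilon> + 4 * C * (\<integral>\<omega>. Z n (Suc n) \<omega> * indicator (escape R) \<omega> \<partial>M)" if n: "mesh n < \<delta>" for n
    proof -
      define a where "a = grid_above n s"
      define d where "d = grid_above n t - grid_above n s"
      have ad: "a + d = grid_above n t" "a + d \<le> Suc n"
        using upper_mono[OF st(3), of n] upper_le[of t n] st by (auto simp: a_def d_def)
      have sa: "s \<le> grid n a" unfolding a_def using st by (intro grid_upper) auto
      have ss: "\<bar>\<integral>\<omega>. Z n (Suc n) \<omega> * (indicator A \<omega> * stopped_sum R n a d \<omega>) \<partial>M\<bar> \<le> \<epsilon>"
        "integrable M (\<lambda>\<omega>. Z n (Suc n) \<omega> * (indicator A \<omega> * stopped_sum R n a d \<omega>))"
        by (rule stopped_sum_expectation[OF \<epsilon> A sa ad(2) \<delta>(2) n]; assumption)+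
      let ?V = "\<lambda>\<omega>. Z n (Suc n) \<omega> * (indicator A \<omega> * (f_grid n (a + d) \<omega> - f_grid n a \<omega>))"
      let ?S = "\<lambda>\<omega>. Z n (Suc n) \<omega> * (indicator A \<omega> * stopped_sum R n a d \<omega>)"
      have iV: "integrable M ?V"
      proof (rule Z_mult_integrable)
        show "(\<lambda>\<omega>. indicator A \<omega> * (f_grid n (a + d) \<omega> - f_grid n a \<omega>)) \<in> borel_measurable M"
        proof -
          have le: "a \<le> Suc n" "a + d \<le> Suc n" using ad by auto
          note [measurable] = f_grid_measurable[OF le(1)] f_grid_measurable[OF le(2)]
          show ?thesis by measurable
        qed
        show "\<bar>indicator A \<omega> * (f_grid n (a + d) \<omega> - f_grid n a \<omega>)\<bar> \<le> 2 * C" for \<omega>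
          using f_grid_bound[of "a + d" n \<omega>] f_grid_bound[of a n \<omega>] C_nonneg ad(2) by (auto simp: indicator_def)
      qed simp
      have iE: "integrable M (\<lambda>\<omega>. Z n (Suc n) \<omega> * indicator (escape R) \<omega>)"
        by (rule Z_mult_integrable[where C=1]) (auto simp: indicator_def)
      have "\<bar>(\<integral>\<omega>. ?V \<omega> \<partial>M) - (\<integral>\<omega>. ?S \<omega> \<partial>M)\<bar> = \<bar>\<integral>\<omega>. ?V \<omega> - ?S \<omega> \<partial>M\<bar>"
        using iV ss(2) by simp
      also have "\<dots> \<le> (\<integral>\<omega>. 4 * C * (Z n (Suc n) \<omega> * indicator (escape R) \<omega>) \<partial>M)"
      proof (rule order_trans[OF integral_abs_bound], rule integral_mono')
        show "integrable M (\<lambda>\<omega>. 4 * C * (Z n (Suc n) \<omega> * indicator (escape R) \<omega>))" using iE by simp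
        fix \<omega> assume w: "\<omega> \<in> space M"
        show "0 \<le> 4 * C * (Z n (Suc n) \<omega> * indicator (escape R) \<omega>)"
          using Z_pos[of n "Suc n" \<omega>] C_nonneg by (simp add: less_imp_le)
        have "\<bar>?V \<omega> - ?S \<omega>\<bar> = Z n (Suc n) \<omega> * (indicator A \<omega> * \<bar>stopped_sum R n a d \<omega> - (f_grid n (a + d) \<omega> - f_grid n a \<omega>)\<bar>)"
          unfolding right_diff_distrib[symmetric] abs_mult using Z_pos[of n "Suc n" \<omega>] by (simp add: abs_minus_commute)
        also have "\<dots> \<le> Z n (Suc n) \<omega> * (1 * (4 * C * indicator (escape R) \<omega>))"
          using Z_pos[of n "Suc n" \<omega>] stopped_sum_close[OF ad(2) w, of R]
          by (intro mult_left_mono mult_mono) (auto simp: indicator_def)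
        finally show "\<bar>?V \<omega> - ?S \<omega>\<bar> \<le> 4 * C * (Z n (Suc n) \<omega> * indicator (escape R) \<omega>)" by (simp add: mult_ac)
      qed
      finally have "\<bar>(\<integral>\<omega>. ?V \<omega> \<partial>M) - (\<integral>\<omega>. ?S \<omega> \<partial>M)\<bar> \<le> 4 * C * (\<integral>\<omega>. Z n (Suc n) \<omega> * indicator (escape R) \<omega> \<partial>M)"
        by simp
      then have "\<bar>\<integral>\<omega>. ?V \<omega> \<partial>M\<bar> \<le> \<epsilon> + 4 * C * (\<integral>\<omega>. Z n (Suc n) \<omega> * indicator (escape R) \<omega> \<partial>M)"
        using ss(1) by linarith
      then show ?thesis unfolding ad(1) unfolding a_def .
    qed
    have l2: "(\<lambda>n. \<integral>\<omega>. Z (ae_subseq n) (Suc (ae_subseq n)) \<omega> * indicator (escape R) \<omega> \<partial>M) \<longlonglongrightarrow> (\<integral>\<omega>. Zlim \<omega> * indicator (escape R) \<omega> \<partial>M)"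
      by (rule Z_limit(2)[where C=1]) (auto simp: indicator_def)
    show ?thesis
    proof (rule tendsto_le[OF trivial_limit_sequentially _ tendsto_rabs[OF lim]])
      show "(\<lambda>n. \<epsilon> + 4 * C * (\<integral>\<omega>. Z (ae_subseq n) (Suc (ae_subseq n)) \<omega> * indicator (escape R) \<omega> \<partial>M))
        \<longlonglongrightarrow> \<epsilon> + 4 * C * (\<integral>\<omega>. Zlim \<omega> * indicator (escape R) \<omega> \<partial>M)"
        by (intro tendsto_intros l2)
      show "\<forall>\<^sub>F n in sequentially. \<bar>\<integral>\<omega>. Z (ae_subseq n) (Suc (ae_subseq n)) \<omega> * ?U n \<omega> \<partial>M\<bar>
        \<le> \<epsilon> + 4 * C * (\<integral>\<omega>. Z (ae_subseq n) (Suc (ae_subseq n)) \<omega> * indicator (escape R) \<omega> \<partial>M)"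
        using ev by eventually_elim (rule le)
    qed
  qed
  have le: "\<bar>?I\<bar> \<le> \<epsilon>" if "\<epsilon> > 0" for \<epsilon>
  proof (rule LIMSEQ_le_const)
    show "(\<lambda>r::nat. \<epsilon> + 4 * C * (\<integral>\<omega>. Zlim \<omega> * indicator (escape (real r)) \<omega> \<partial>M)) \<longlonglongrightarrow> \<epsilon>"
      using tendsto_add[OF tendsto_const tendsto_mult[OF tendsto_const escape_prob_tendsto], of \<epsilon> "4 * C"] by simp
  qed (use bound[OF that] in blast)
  have "\<bar>?I\<bar> \<le> 0"
  proof (rule field_le_epsilon)
    fix e :: real assume "e > 0"
    from le[OF this] show "\<bar>?I\<bar> \<le> 0 + e" by (simp only: add_0)
  qed
  then show ?thesis by simp
qed

end

section \<open>The one-step estimate\<close>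

lemma norm3_sq: "(norm (w::real^3))\<^sup>2 = (w $ 1)\<^sup>2 + (w $ 2)\<^sup>2 + (w $ 3)\<^sup>2"
  unfolding power2_norm_eq_inner inner_vec_def by (simp add: sum_3 power2_eq_square)

lemma uniform_on_slab:
  fixes \<phi> :: "real \<Rightarrow> real^3 \<Rightarrow> 'b::real_normed_vector"
  assumes c: "continuous_on slab (\<lambda>(t, x). \<phi> t x)" and \<eta>: "\<eta> > 0"
  shows "\<exists>\<rho>>0. \<rho> \<le> 1 \<and> (\<forall>t\<in>{0..1}. \<forall>t'\<in>{0..1}. \<forall>x x'. norm x \<le> R \<longrightarrow> \<bar>t' - t\<bar> \<le> \<rho> \<longrightarrow> norm (x' - x) \<le> \<rho> \<longrightarrow> norm (\<phi> t' x' - \<phi> t x) \<le> \<eta>)"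
proof -
  let ?K = "{0..1::real} \<times> cball (0::real^3) (R + 1)"
  have "uniformly_continuous_on ?K (\<lambda>(t, x). \<phi> t x)"
    by (intro compact_uniformly_continuous continuous_on_subset[OF c] compact_Times) auto
  then obtain d where d: "d > 0" "\<And>p q. p \<in> ?K \<Longrightarrow> q \<in> ?K \<Longrightarrow> dist q p < d \<Longrightarrow> dist (case q of (t, x) \<Rightarrow> \<phi> t x) (case p of (t, x) \<Rightarrow> \<phi> t x) < \<eta>"
    using \<eta> unfolding uniformly_continuous_on_def by metis
  define \<rho> where "\<rho> = min 1 (d / 3)"
  have \<rho>: "\<rho> > 0" "\<rho> \<le> 1" "2 * \<rho> < d" using d(1) by (auto simp: \<rho>_def)
  show ?thesis
  proof (intro exI[of _ \<rho>] conjI ballI allI impI \<rho>(1,2))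
    fix t t' x x' assume t: "t \<in> {0..1::real}" "t' \<in> {0..1::real}" and x: "norm (x::real^3) \<le> R" and
      n: "\<bar>t' - t\<bar> \<le> \<rho>" "norm (x' - x) \<le> \<rho>"
    have "norm x' \<le> R + 1" using norm_triangle_sub[of x' x] x n \<rho> by linarith
    then have k: "(t, x) \<in> ?K" "(t', x') \<in> ?K" using t x by auto
    have "dist (t', x') (t, x) \<le> \<bar>dist t' t\<bar> + \<bar>dist x' x\<bar>"
      unfolding dist_Pair_Pair by (rule sqrt_sum_squares_le_sum_abs)
    also have "\<dots> < d" using n \<rho>(3) by (simp add: dist_norm)
    finally show "norm (\<phi> t' x' - \<phi> t x) \<le> \<eta>" using d(2)[OF k] by (simp add: dist_norm)
  qed
qed

lemma bounded_on_slab: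
  fixes \<phi> :: "real \<Rightarrow> real^3 \<Rightarrow> 'b::real_normed_vector"
  assumes c: "continuous_on slab (\<lambda>(t, x). \<phi> t x)"
  shows "\<exists>K\<ge>0. \<forall>t\<in>{0..1}. \<forall>x. norm x \<le> R \<longrightarrow> norm (\<phi> t x) \<le> K"
proof -
  have "compact ((\<lambda>(t, x). \<phi> t x) ` ({0..1} \<times> cball 0 R))"
    by (intro compact_continuous_image continuous_on_subset[OF c] compact_Times) auto
  then have "bounded ((\<lambda>(t, x). \<phi> t x) ` ({0..1} \<times> cball 0 R))" by (rule compact_imp_bounded)
  then obtain K where K: "K > 0" "\<forall>y\<in>(\<lambda>(t, x). \<phi> t x) ` ({0..1} \<times> cball 0 R). norm y \<le> K"
    unfolding bounded_pos by blast
  then show ?thesis by (intro exI[of _ K]) force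
qed

lemma
  assumes h: "h > 0"
  shows integrable_gauss_shift1: "integrable (gauss h) (\<lambda>z. z $ i - c)"
    and integral_gauss_shift1: "(\<integral>z. z $ i - c \<partial>gauss h) = - c"
    and integrable_gauss_shift2: "integrable (gauss h) (\<lambda>z. (z $ i - c)\<^sup>2)"
    and integral_gauss_shift2: "(\<integral>z. (z $ i - c)\<^sup>2 \<partial>gauss h) = h + c\<^sup>2"
    and integrable_gauss_shift11: "integrable (gauss h) (\<lambda>z. (z $ i - c) * (z $ j - d))"
    and integral_gauss_shift11: "i \<noteq> j \<Longrightarrow> (\<integral>z. (z $ i - c) * (z $ j - d) \<partial>gauss h) = c * d"
proof -
  interpret prob_space "gauss h" by (rule prob_space_gauss[OF h])
  have one: "measure (gauss h) UNIV = 1" using prob_space by simp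
  note [simp] = integrable_gauss_coord[OF h] integral_gauss_coord[OF h] integrable_gauss_coord_power[OF h]
    integral_gauss_coord_sq[OF h] integrable_gauss_coord_mult[OF h] one
  show "integrable (gauss h) (\<lambda>z. z $ i - c)" "(\<integral>z. z $ i - c \<partial>gauss h) = - c" by simp_all
  have e: "(z $ i - c)\<^sup>2 = (z $ i)\<^sup>2 - 2 * c * z $ i + c\<^sup>2" for z :: "real^3" by (simp add: power2_eq_square algebra_simps)
  show "integrable (gauss h) (\<lambda>z. (z $ i - c)\<^sup>2)" "(\<integral>z. (z $ i - c)\<^sup>2 \<partial>gauss h) = h + c\<^sup>2"
    unfolding e by simp_all
  have e: "(z $ i - c) * (z $ j - d) = z $ i * z $ j - d * z $ i - c * z $ j + c * d" for z :: "real^3" by (simp add: algebra_simps)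
  show "integrable (gauss h) (\<lambda>z. (z $ i - c) * (z $ j - d))" unfolding e by simp
  show "i \<noteq> j \<Longrightarrow> (\<integral>z. (z $ i - c) * (z $ j - d) \<partial>gauss h) = c * d"
    unfolding e by (simp add: integral_gauss_coord_mult[OF h])
qed

lemma
  assumes h: "h > 0"
  shows integrable_gauss_norm2: "integrable (gauss h) (\<lambda>z. (norm z)\<^sup>2)"
    and integral_gauss_norm2: "(\<integral>z. (norm z)\<^sup>2 \<partial>gauss h) = 3 * h"
    and integrable_gauss_norm4: "integrable (gauss h) (\<lambda>z. (norm z)^4)"
    and integral_gauss_norm4: "(\<integral>z. (norm z)^4 \<partial>gauss h) \<le> 27 * h\<^sup>2"
proof -
  note [simp] = integrable_gauss_coord_power[OF h] integral_gauss_coord_sq[OF h] integral_gauss_coord_4[OF h]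
  show "integrable (gauss h) (\<lambda>z. (norm z)\<^sup>2)" "(\<integral>z. (norm z)\<^sup>2 \<partial>gauss h) = 3 * h"
    unfolding norm3_sq by simp_all
  have le: "(norm z)^4 \<le> 3 * (z $ 1)^4 + 3 * (z $ 2)^4 + 3 * (z $ 3)^4" for z :: "real^3"
  proof -
    define a b c where "a = (z $ 1)\<^sup>2" and "b = (z $ 2)\<^sup>2" and "c = (z $ 3)\<^sup>2"
    have "(a + b + c)\<^sup>2 \<le> 3 * a\<^sup>2 + 3 * b\<^sup>2 + 3 * c\<^sup>2"
      using sum_squares_bound[of a b] sum_squares_bound[of a c] sum_squares_bound[of b c]
      by (simp add: power2_eq_square algebra_simps)
    moreover have "(norm z)^4 = (a + b + c)\<^sup>2"
      unfolding a_def b_def c_def norm3_sq[symmetric] by simp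
    ultimately show ?thesis by (simp add: a_def b_def c_def)
  qed
  have i: "integrable (gauss h) (\<lambda>z. 3 * (z $ 1)^4 + 3 * (z $ 2)^4 + 3 * (z $ 3)^4)" by simp
  show "integrable (gauss h) (\<lambda>z. (norm z)^4)"
    by (rule Bochner_Integration.integrable_bound[OF i]) (auto simp: le)
  then have "(\<integral>z. (norm z)^4 \<partial>gauss h) \<le> (\<integral>z. 3 * (z $ 1)^4 + 3 * (z $ 2)^4 + 3 * (z $ 3)^4 \<partial>gauss h)"
    by (rule integral_mono[OF _ i le])
  also have "\<dots> = 27 * h\<^sup>2" by simp
  finally show "(\<integral>z. (norm z)^4 \<partial>gauss h) \<le> 27 * h\<^sup>2" .
qed

text \<open>The second order Taylor polynomial. Each mixed derivative occurs once, in the order in which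
  the coordinates are changed one after the other.\<close>

definition quad_poly :: "real \<Rightarrow> (3 \<Rightarrow> real) \<Rightarrow> (3 \<Rightarrow> 3 \<Rightarrow> real) \<Rightarrow> real^3 \<Rightarrow> real" where
  "quad_poly q p c w = q + (\<Sum>i\<in>UNIV. p i * w $ i) + (\<Sum>i\<in>UNIV. c i i / 2 * (w $ i)\<^sup>2)
     + c 2 1 * (w $ 1 * w $ 2) + c 3 1 * (w $ 1 * w $ 3) + c 3 2 * (w $ 2 * w $ 3)"

lemma
  assumes h: "h > 0"
  shows integrable_quad_poly: "integrable (gauss h) (\<lambda>z. quad_poly q p c (z - h *\<^sub>R \<beta>))"
    and integral_quad_poly: "(\<integral>z. quad_poly q p c (z - h *\<^sub>R \<beta>) \<partial>gauss h)
       = q + h * ((\<Sum>i\<in>UNIV. c i i) / 2 - (\<Sum>i\<in>UNIV. \<beta> $ i * p i)) + h\<^sup>2 * quad_poly 0 (\<lambda>_. 0) c \<beta>"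
proof -
  interpret prob_space "gauss h" by (rule prob_space_gauss[OF h])
  have one: "measure (gauss h) UNIV = 1" using prob_space by simp
  have n: "(1::3) \<noteq> 2" "(1::3) \<noteq> 3" "(2::3) \<noteq> 3" by simp_all
  note [simp] = integrable_gauss_shift1[OF h] integral_gauss_shift1[OF h]
    integrable_gauss_shift2[OF h] integral_gauss_shift2[OF h] integrable_gauss_shift11[OF h]
    integral_gauss_shift11[OF h n(1)] integral_gauss_shift11[OF h n(2)] integral_gauss_shift11[OF h n(3)] one
  have e: "quad_poly q p c (z - h *\<^sub>R \<beta>) = q + (\<Sum>i\<in>UNIV. p i * (z $ i - h * \<beta> $ i)) + (\<Sum>i\<in>UNIV. c i i / 2 * (z $ i - h * \<beta> $ i)\<^sup>2)
     + c 2 1 * ((z $ 1 - h * \<beta> $ 1) * (z $ 2 - h * \<beta> $ 2)) + c 3 1 * ((z $ 1 - h * \<beta> $ 1) * (z $ 3 - h * \<beta> $ 3))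
     + c 3 2 * ((z $ 2 - h * \<beta> $ 2) * (z $ 3 - h * \<beta> $ 3))" for z
    by (simp add: quad_poly_def)
  show "integrable (gauss h) (\<lambda>z. quad_poly q p c (z - h *\<^sub>R \<beta>))" unfolding e by simp
  have "(\<integral>z. quad_poly q p c (z - h *\<^sub>R \<beta>) \<partial>gauss h) = q + (\<Sum>i\<in>UNIV. p i * (- (h * \<beta> $ i))) + (\<Sum>i\<in>UNIV. c i i / 2 * (h + (h * \<beta> $ i)\<^sup>2))
     + c 2 1 * ((h * \<beta> $ 1) * (h * \<beta> $ 2)) + c 3 1 * ((h * \<beta> $ 1) * (h * \<beta> $ 3)) + c 3 2 * ((h * \<beta> $ 2) * (h * \<beta> $ 3))"
    unfolding e by simp
  also have "\<dots> = q + h * ((\<Sum>i\<in>UNIV. c i i) / 2 - (\<Sum>i\<in>UNIV. \<beta> $ i * p i)) + h\<^sup>2 * quad_poly 0 (\<lambda>_. 0) c \<beta>"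
    by (simp add: quad_poly_def sum_3 power2_eq_square) (simp add: algebra_simps add_divide_distrib)
  finally show "(\<integral>z. quad_poly q p c (z - h *\<^sub>R \<beta>) \<partial>gauss h)
       = q + h * ((\<Sum>i\<in>UNIV. c i i) / 2 - (\<Sum>i\<in>UNIV. \<beta> $ i * p i)) + h\<^sup>2 * quad_poly 0 (\<lambda>_. 0) c \<beta>" .
qed

lemma cross_le: "\<bar>a * b\<bar> \<le> (a\<^sup>2 + b\<^sup>2) / 2" for a b :: real
  using sum_squares_bound[of "\<bar>a\<bar>" "\<bar>b\<bar>"] by (simp add: abs_mult)

lemma quad_poly_bound:
  assumes q: "\<bar>q\<bar> \<le> k" and p: "\<And>i. \<bar>p i\<bar> \<le> k" and c: "\<And>i j. \<bar>c i j\<bar> \<le> k"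
  shows "\<bar>quad_poly q p c w\<bar> \<le> k * (1 + 3 * norm w + 2 * (norm w)\<^sup>2)"
proof -
  have k: "0 \<le> k" using q by simp
  have "\<bar>quad_poly q p c w\<bar> \<le> \<bar>q\<bar> + (\<bar>p 1 * w $ 1\<bar> + \<bar>p 2 * w $ 2\<bar> + \<bar>p 3 * w $ 3\<bar>)
    + (\<bar>c 1 1 / 2 * (w $ 1)\<^sup>2\<bar> + \<bar>c 2 2 / 2 * (w $ 2)\<^sup>2\<bar> + \<bar>c 3 3 / 2 * (w $ 3)\<^sup>2\<bar>)
    + \<bar>c 2 1 * (w $ 1 * w $ 2)\<bar> + \<bar>c 3 1 * (w $ 1 * w $ 3)\<bar> + \<bar>c 3 2 * (w $ 2 * w $ 3)\<bar>"
    unfolding quad_poly_def sum_3 by (intro order_trans[OF abs_triangle_ineq] add_mono order_refl)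
  also have "\<dots> \<le> k + (k * norm w + k * norm w + k * norm w)
    + (k / 2 * (w $ 1)\<^sup>2 + k / 2 * (w $ 2)\<^sup>2 + k / 2 * (w $ 3)\<^sup>2)
    + k * (((w $ 1)\<^sup>2 + (w $ 2)\<^sup>2) / 2) + k * (((w $ 1)\<^sup>2 + (w $ 3)\<^sup>2) / 2) + k * (((w $ 2)\<^sup>2 + (w $ 3)\<^sup>2) / 2)"
  proof -
    have "\<bar>p i * w $ i\<bar> \<le> k * norm w" for i
      unfolding abs_mult using p[of i] component_le_norm_cart[of w i] k by (intro mult_mono) auto
    moreover have "\<bar>c i i / 2 * (w $ i)\<^sup>2\<bar> \<le> k / 2 * (w $ i)\<^sup>2" for i
      using c[of i i] by (simp add: abs_mult divide_right_mono mult_right_mono)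
    moreover have "\<bar>c i j * (w $ l * w $ m)\<bar> \<le> k * (((w $ l)\<^sup>2 + (w $ m)\<^sup>2) / 2)" for i j l m
      unfolding abs_mult[of "c i j"] using c[of i j] cross_le k by (intro mult_mono) auto
    ultimately show ?thesis using q by (intro add_mono) auto
  qed
  also have "\<dots> = k * (1 + 3 * norm w + 3/2 * (norm w)\<^sup>2)" unfolding norm3_sq by (simp add: algebra_simps add_divide_distrib)
  also have "\<dots> \<le> k * (1 + 3 * norm w + 2 * (norm w)\<^sup>2)" using k by (intro mult_left_mono) auto
  finally show ?thesis .
qed

lemma second_order_line:
  fixes g g1 g2 :: "real \<Rightarrow> real"
  assumes "\<And>r. (g has_real_derivative g1 r) (at r)" "\<And>r. (g1 has_real_derivative g2 r) (at r)"
  shows "\<exists>r. \<bar>r\<bar> \<le> \<bar>s\<bar> \<and> g s = g 0 + s * g1 0 + g2 r / 2 * s\<^sup>2"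
proof -
  define diff where "diff = (\<lambda>m::nat. if m = 0 then g else if m = 1 then g1 else g2)"
  have "\<exists>t. \<bar>t\<bar> \<le> \<bar>s\<bar> \<and> g s = (\<Sum>m<2. diff m 0 / fact m * s ^ m) + diff 2 t / fact 2 * s ^ 2"
    by (rule Maclaurin_bi_le) (auto simp: diff_def less_2_cases_iff assms)
  then show ?thesis by (auto simp: diff_def numeral_2_eq_2 lessThan_Suc algebra_simps)
qed

lemma first_order_line:
  fixes g g1 :: "real \<Rightarrow> real"
  assumes "\<And>r. (g has_real_derivative g1 r) (at r)"
  shows "\<exists>r. \<bar>r\<bar> \<le> \<bar>s\<bar> \<and> g s = g 0 + s * g1 r"
proof -
  define diff where "diff = (\<lambda>m::nat. if m = 0 then g else g1)"
  have "\<exists>t. \<bar>t\<bar> \<le> \<bar>s\<bar> \<and> g s = (\<Sum>m<1. diff m 0 / fact m * s ^ m) + diff 1 t / fact 1 * s ^ 1"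
    by (rule Maclaurin_bi_le) (auto simp: diff_def assms)
  then show ?thesis by (auto simp: diff_def algebra_simps)
qed

text \<open>One component of the velocity field with its derivatives up to second order in space. The equation
  is stated in the original direction of time.\<close>

locale C12_scalar =
  fixes v vt :: "real \<Rightarrow> real^3 \<Rightarrow> real" and v1 :: "3 \<Rightarrow> real \<Rightarrow> real^3 \<Rightarrow> real"
    and v2 :: "3 \<Rightarrow> 3 \<Rightarrow> real \<Rightarrow> real^3 \<Rightarrow> real" and \<beta> :: "real \<Rightarrow> real^3 \<Rightarrow> real^3" and C B :: real
  assumes Dt: "\<And>t x. t \<in> {0..1} \<Longrightarrow> ((\<lambda>s. v s x) has_real_derivative vt t x) (at t within {0..1})"
    and D1: "\<And>i t x. t \<in> {0..1} \<Longrightarrow> ((\<lambda>h. v t (x + h *\<^sub>R axis i 1)) has_real_derivative v1 i t x) (at 0)"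
    and D2: "\<And>i j t x. t \<in> {0..1} \<Longrightarrow> ((\<lambda>h. v1 i t (x + h *\<^sub>R axis j 1)) has_real_derivative v2 i j t x) (at 0)"
    and cont: "continuous_on slab (\<lambda>(t, x). v t x)" "continuous_on slab (\<lambda>(t, x). vt t x)"
      "\<And>i. continuous_on slab (\<lambda>(t, x). v1 i t x)" "\<And>i j. continuous_on slab (\<lambda>(t, x). v2 i j t x)"
    and bounds: "\<And>t x. t \<in> {0..1} \<Longrightarrow> \<bar>v t x\<bar> \<le> C" "\<And>t x. t \<in> {0..1} \<Longrightarrow> norm (\<beta> t x) \<le> B"
    and pde: "\<And>t x. t \<in> {0..1} \<Longrightarrow> vt t x + (\<Sum>i\<in>UNIV. \<beta> t x $ i * v1 i t x) = (\<Sum>i\<in>UNIV. v2 i i t x) / 2"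
begin

lemma partials_along_axis:
  assumes t: "t \<in> {0..1}"
  shows "((\<lambda>h. v t (x + h *\<^sub>R axis i 1)) has_real_derivative v1 i t (x + r *\<^sub>R axis i 1)) (at r)"
    "((\<lambda>h. v1 j t (x + h *\<^sub>R axis i 1)) has_real_derivative v2 j i t (x + r *\<^sub>R axis i 1)) (at r)"
proof -
  have e: "x + r *\<^sub>R axis i 1 + h *\<^sub>R axis i 1 = x + (h + r) *\<^sub>R axis i 1" for h
    by (simp add: algebra_simps)
  show "((\<lambda>h. v t (x + h *\<^sub>R axis i 1)) has_real_derivative v1 i t (x + r *\<^sub>R axis i 1)) (at r)"
    using D1[OF t, of "x + r *\<^sub>R axis i 1" i] DERIV_shift[of "\<lambda>h. v t (x + h *\<^sub>R axis i 1)" _ 0 r] unfolding e by simp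
  show "((\<lambda>h. v1 j t (x + h *\<^sub>R axis i 1)) has_real_derivative v2 j i t (x + r *\<^sub>R axis i 1)) (at r)"
    using D2[OF t, of j "x + r *\<^sub>R axis i 1" i] DERIV_shift[of "\<lambda>h. v1 j t (x + h *\<^sub>R axis i 1)" _ 0 r] unfolding e by simp
qed

lemma taylor_line:
  assumes t: "t \<in> {0..1}"
  shows "\<exists>r. \<bar>r\<bar> \<le> \<bar>s\<bar> \<and> v t (x + s *\<^sub>R axis i 1) = v t x + s * v1 i t x + v2 i i t (x + r *\<^sub>R axis i 1) / 2 * s\<^sup>2"
    "\<exists>r. \<bar>r\<bar> \<le> \<bar>s\<bar> \<and> v1 j t (x + s *\<^sub>R axis i 1) = v1 j t x + s * v2 j i t (x + r *\<^sub>R axis i 1)"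
  using second_order_line[OF partials_along_axis(1)[OF t, where x=x and i=i] partials_along_axis(2)[OF t, where x=x and i=i and j=i], of s]
    first_order_line[OF partials_along_axis(2)[OF t, where x=x and i=i and j=j], of s] by auto

text \<open>Move from \<open>x\<close> to \<open>x + w\<close> along the three axes in turn. Along an axis the expansion is
  one-dimensional, and the first derivatives met at the intermediate corners are brought back to \<open>x\<close> by
  the mean value theorem. Hence partial derivatives suffice.\<close>

lemma taylor_space:
  assumes t: "t \<in> {0..1}"
    and close: "\<And>i j y. norm (y - x) \<le> 3 * norm w \<Longrightarrow> \<bar>v2 i j t y - v2 i j t x\<bar> \<le> \<eta>"
  shows "\<bar>v t (x + w) - v t x - quad_poly 0 (\<lambda>i. v1 i t x) (\<lambda>i j. v2 i j t x) w\<bar> \<le> 2 * \<eta> * (norm w)\<^sup>2"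
proof -
  define x1 where "x1 = x + (w $ 1) *\<^sub>R axis 1 1"
  define x2 where "x2 = x1 + (w $ 2) *\<^sub>R axis 2 1"
  have x3: "x + w = x2 + (w $ 3) *\<^sub>R axis 3 1"
    by (simp add: x1_def x2_def vec_eq_iff forall_3 axis_def)
  have wi: "\<bar>w $ i\<bar> \<le> norm w" for i by (rule component_le_norm_cart)
  have na: "norm (r *\<^sub>R axis i (1::real) :: real^3) = \<bar>r\<bar>" for r i by simp
  have n1: "norm (x1 + r *\<^sub>R axis i 1 - x) \<le> 3 * norm w" if "\<bar>r\<bar> \<le> norm w" for r i
  proof -
    have "norm ((w $ 1) *\<^sub>R axis 1 1 + r *\<^sub>R axis i (1::real)) \<le> \<bar>w $ 1\<bar> + \<bar>r\<bar>"
      using norm_triangle_ineq[of "(w $ 1) *\<^sub>R axis 1 (1::real)" "r *\<^sub>R axis i 1"] by (simp only: na)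
    then show ?thesis using wi[of 1] that norm_ge_zero[of w] unfolding x1_def by (simp add: algebra_simps)
  qed
  have n0: "norm (x + r *\<^sub>R axis i 1 - x) \<le> 3 * norm w" if "\<bar>r\<bar> \<le> norm w" for r i
    using that norm_ge_zero[of w] by simp
  have n2: "norm (x2 + r *\<^sub>R axis i 1 - x) \<le> 3 * norm w" if "\<bar>r\<bar> \<le> norm w" for r i
  proof -
    have "norm ((w $ 1) *\<^sub>R axis 1 1 + (w $ 2) *\<^sub>R axis 2 1 + r *\<^sub>R axis i (1::real)) \<le> \<bar>w $ 1\<bar> + \<bar>w $ 2\<bar> + \<bar>r\<bar>"
      using norm_triangle_ineq[of "(w $ 1) *\<^sub>R axis 1 (1::real) :: real^3" "(w $ 2) *\<^sub>R axis 2 1"]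
        norm_triangle_ineq[of "(w $ 1) *\<^sub>R axis 1 (1::real) + (w $ 2) *\<^sub>R axis 2 1" "r *\<^sub>R axis i 1"] by (simp only: na)
    then show ?thesis using wi[of 1] wi[of 2] that norm_ge_zero[of w] unfolding x2_def x1_def by (simp add: algebra_simps)
  qed
  have abl: "\<bar>r\<bar> \<le> norm w" if "\<bar>r\<bar> \<le> \<bar>w $ i\<bar>" for r i using that wi[of i] by simp
  obtain r1 where r1: "\<bar>r1\<bar> \<le> \<bar>w $ 1\<bar>" "v t x1 = v t x + w $ 1 * v1 1 t x + v2 1 1 t (x + r1 *\<^sub>R axis 1 1) / 2 * (w $ 1)\<^sup>2"
    using taylor_line(1)[OF t, of "w $ 1" x 1] unfolding x1_def by blast
  obtain r2 where r2: "\<bar>r2\<bar> \<le> \<bar>w $ 2\<bar>" "v t x2 = v t x1 + w $ 2 * v1 2 t x1 + v2 2 2 t (x1 + r2 *\<^sub>R axis 2 1) / 2 * (w $ 2)\<^sup>2"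
    using taylor_line(1)[OF t, of "w $ 2" x1 2] unfolding x2_def by blast
  obtain r3 where r3: "\<bar>r3\<bar> \<le> \<bar>w $ 3\<bar>" "v t (x + w) = v t x2 + w $ 3 * v1 3 t x2 + v2 3 3 t (x2 + r3 *\<^sub>R axis 3 1) / 2 * (w $ 3)\<^sup>2"
    using taylor_line(1)[OF t, of "w $ 3" x2 3] unfolding x3 by blast
  obtain q21 where q21: "\<bar>q21\<bar> \<le> \<bar>w $ 1\<bar>" "v1 2 t x1 = v1 2 t x + w $ 1 * v2 2 1 t (x + q21 *\<^sub>R axis 1 1)"
    using taylor_line(2)[OF t, of "w $ 1" 2 x 1] unfolding x1_def by blast
  obtain q31 where q31: "\<bar>q31\<bar> \<le> \<bar>w $ 1\<bar>" "v1 3 t x1 = v1 3 t x + w $ 1 * v2 3 1 t (x + q31 *\<^sub>R axis 1 1)"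
    using taylor_line(2)[OF t, of "w $ 1" 3 x 1] unfolding x1_def by blast
  obtain q32 where q32: "\<bar>q32\<bar> \<le> \<bar>w $ 2\<bar>" "v1 3 t x2 = v1 3 t x1 + w $ 2 * v2 3 2 t (x1 + q32 *\<^sub>R axis 2 1)"
    using taylor_line(2)[OF t, of "w $ 2" 3 x1 2] unfolding x2_def by blast
  define c where "c = (\<lambda>(i::3) (j::3). if i = 1 \<and> j = 1 then v2 1 1 t (x + r1 *\<^sub>R axis 1 1) - v2 1 1 t x
     else if i = 2 \<and> j = 2 then v2 2 2 t (x1 + r2 *\<^sub>R axis 2 1) - v2 2 2 t x
     else if i = 3 \<and> j = 3 then v2 3 3 t (x2 + r3 *\<^sub>R axis 3 1) - v2 3 3 t x
     else if i = 2 \<and> j = 1 then v2 2 1 t (x + q21 *\<^sub>R axis 1 1) - v2 2 1 t x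
     else if i = 3 \<and> j = 1 then v2 3 1 t (x + q31 *\<^sub>R axis 1 1) - v2 3 1 t x
     else if i = 3 \<and> j = 2 then v2 3 2 t (x1 + q32 *\<^sub>R axis 2 1) - v2 3 2 t x else 0)"
  have \<eta>0: "0 \<le> \<eta>" using close[of x 1 1] by simp
  have abs_if_le: "\<bar>if P then a else e\<bar> \<le> \<eta>" if "\<bar>a\<bar> \<le> \<eta>" "\<bar>e\<bar> \<le> \<eta>" for P a e
    using that by simp
  have z: "\<bar>0\<bar> \<le> \<eta>" using \<eta>0 by simp
  have cb: "\<bar>c i j\<bar> \<le> \<eta>" for i j
    unfolding c_def
    by (intro abs_if_le z close n0[OF abl[OF r1(1)]] n1[OF abl[OF r2(1)]] n2[OF abl[OF r3(1)]]
      n0[OF abl[OF q21(1)]] n0[OF abl[OF q31(1)]] n1[OF abl[OF q32(1)]])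
  have "v t (x + w) - v t x - quad_poly 0 (\<lambda>i. v1 i t x) (\<lambda>i j. v2 i j t x) w = quad_poly 0 (\<lambda>_. 0) c w"
    unfolding r3(2) r2(2) r1(2) q32(2) q31(2) q21(2) quad_poly_def sum_3
    by (simp add: c_def power2_eq_square) (simp add: field_simps)
  also have "\<bar>\<dots>\<bar> \<le> 2 * \<eta> * (norm w)\<^sup>2"
  proof -
    have "\<bar>quad_poly 0 (\<lambda>_. 0) c w\<bar> \<le> \<bar>c 1 1 / 2 * (w $ 1)\<^sup>2\<bar> + \<bar>c 2 2 / 2 * (w $ 2)\<^sup>2\<bar> + \<bar>c 3 3 / 2 * (w $ 3)\<^sup>2\<bar>
      + \<bar>c 2 1 * (w $ 1 * w $ 2)\<bar> + \<bar>c 3 1 * (w $ 1 * w $ 3)\<bar> + \<bar>c 3 2 * (w $ 2 * w $ 3)\<bar>"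
    proof -
      have "quad_poly 0 (\<lambda>_. 0) c w = c 1 1 / 2 * (w $ 1)\<^sup>2 + c 2 2 / 2 * (w $ 2)\<^sup>2 + c 3 3 / 2 * (w $ 3)\<^sup>2
        + c 2 1 * (w $ 1 * w $ 2) + c 3 1 * (w $ 1 * w $ 3) + c 3 2 * (w $ 2 * w $ 3)"
        by (simp add: quad_poly_def sum_3)
      then show ?thesis by (simp only:)
    qed
    also have "\<dots> \<le> \<eta> / 2 * (w $ 1)\<^sup>2 + \<eta> / 2 * (w $ 2)\<^sup>2 + \<eta> / 2 * (w $ 3)\<^sup>2
      + \<eta> * (((w $ 1)\<^sup>2 + (w $ 2)\<^sup>2) / 2) + \<eta> * (((w $ 1)\<^sup>2 + (w $ 3)\<^sup>2) / 2) + \<eta> * (((w $ 2)\<^sup>2 + (w $ 3)\<^sup>2) / 2)"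
    proof -
      have "\<bar>c i i / 2 * (w $ i)\<^sup>2\<bar> \<le> \<eta> / 2 * (w $ i)\<^sup>2" for i
        using cb[of i i] by (simp add: abs_mult divide_right_mono mult_right_mono)
      moreover have "\<bar>c i j * (w $ l * w $ m)\<bar> \<le> \<eta> * (((w $ l)\<^sup>2 + (w $ m)\<^sup>2) / 2)" for i j l m
        unfolding abs_mult[of "c i j"] using cb[of i j] cross_le \<eta>0 by (intro mult_mono) auto
      ultimately show ?thesis by (intro add_mono) auto
    qed
    also have "\<dots> = 3/2 * \<eta> * (norm w)\<^sup>2" unfolding norm3_sq by (simp add: algebra_simps add_divide_distrib)
    also have "\<dots> \<le> 2 * \<eta> * (norm w)\<^sup>2" using \<eta>0 by (intro mult_right_mono) auto
    finally show ?thesis .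
  qed
  finally show ?thesis .
qed

lemma taylor_time:
  assumes h: "0 < h" "h \<le> \<tau>" "\<tau> \<le> 1"
  shows "\<exists>\<xi>\<in>{\<tau> - h..\<tau>}. v (\<tau> - h) y - v \<tau> y = - (h * vt \<xi> y)"
proof -
  have "\<exists>\<xi>\<in>{\<tau> - h<..<\<tau>}. v \<tau> y - v (\<tau> - h) y = (\<lambda>d. vt \<xi> y * d) (\<tau> - (\<tau> - h))"
  proof (rule mvt_simple)
    fix s assume "\<tau> - h \<le> s" "s \<le> \<tau>"
    then have "((\<lambda>s. v s y) has_real_derivative vt s y) (at s within {\<tau> - h..\<tau>})"
      using h by (intro DERIV_subset[OF Dt]) auto
    then show "((\<lambda>s. v s y) has_derivative (\<lambda>d. vt s y * d)) (at s within {\<tau> - h..\<tau>})"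
      by (simp add: has_field_derivative_def)
  qed (use h in simp)
  then obtain \<xi> where "\<xi> \<in> {\<tau> - h<..<\<tau>}" "v \<tau> y - v (\<tau> - h) y = vt \<xi> y * h" by auto
  then show ?thesis by (intro bexI[of _ \<xi>]) (auto simp: algebra_simps)
qed

lemma pow_le_pow4:
  fixes r \<rho> :: real
  assumes "0 < \<rho>" "\<rho> \<le> 1" "\<rho> \<le> r" "k \<le> 4"
  shows "r ^ k \<le> r ^ 4 / \<rho> ^ 4"
proof -
  have r: "0 < r" using assms by simp
  have "\<rho> ^ 4 \<le> \<rho> ^ (4 - k)" using assms by (intro power_decreasing) auto
  also have "\<dots> \<le> r ^ (4 - k)" using assms by (intro power_mono) auto
  finally have "r ^ k * \<rho> ^ 4 \<le> r ^ k * r ^ (4 - k)" using r by (intro mult_left_mono) auto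
  also have "\<dots> = r ^ 4" using assms(4) by (simp add: power_add[symmetric])
  finally show ?thesis using assms by (simp add: pos_le_divide_eq)
qed

text \<open>Near \<open>x\<close> the increment is its Taylor polynomial up to \<open>\<eta>(h + 2|w|\<^sup>2)\<close>. Far from \<open>x\<close> the derivatives are
  not controlled, but there boundedness of \<open>v\<close> gives an error of at most \<open>D|w|\<^sup>4\<close>, whose Gaussian mean
  is of order \<open>h\<^sup>2\<close>. In the mean of the Taylor polynomial the terms of order \<open>h\<close> cancel by the equation.\<close>

lemma one_step_estimate:
  assumes \<epsilon>: "\<epsilon> > 0"
  shows "\<exists>\<delta>>0. \<forall>h \<tau> x. 0 < h \<longrightarrow> h < \<delta> \<longrightarrow> h \<le> \<tau> \<longrightarrow> \<tau> \<le> 1 \<longrightarrow> norm x \<le> R \<longrightarrow>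
     \<bar>\<integral>z. v (\<tau> - h) (x - h *\<^sub>R \<beta> \<tau> x + z) - v \<tau> x \<partial>gauss h\<bar> \<le> \<epsilon> * h"
proof -
  have B0: "0 \<le> B" using order_trans[OF norm_ge_zero bounds(2)[of 0 0]] by simp
  have C0: "0 \<le> C" using order_trans[OF abs_ge_zero bounds(1)[of 0 0]] by simp
  \<comment> \<open>Bundling all derivatives gives one modulus of continuity and one bound for them.\<close>
  define \<Phi> where "\<Phi> = (\<lambda>t x. (vt t x, (\<chi> i j. v2 i j t x) :: real^3^3, (\<chi> i. v1 i t x) :: real^3))"
  have c\<Phi>: "continuous_on slab (\<lambda>(t, x). \<Phi> t x)"
    unfolding \<Phi>_def split_beta'
    by (intro continuous_on_Pair continuous_on_vec_lambda cont[unfolded split_beta'])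
  have comp: "\<bar>vt t x - vt t' x'\<bar> \<le> norm (\<Phi> t x - \<Phi> t' x')" "\<bar>v2 i j t x - v2 i j t' x'\<bar> \<le> norm (\<Phi> t x - \<Phi> t' x')"
    "\<bar>vt t x\<bar> \<le> norm (\<Phi> t x)" "\<bar>v2 i j t x\<bar> \<le> norm (\<Phi> t x)" "\<bar>v1 i t x\<bar> \<le> norm (\<Phi> t x)" for t x t' x' i j
  proof -
    have 1: "\<bar>fst p\<bar> \<le> norm p" "\<bar>fst (snd p) $ i $ j\<bar> \<le> norm p" "\<bar>snd (snd p) $ i\<bar> \<le> norm p" for p :: "real \<times> (real^3^3) \<times> (real^3)"
    proof -
      show "\<bar>fst p\<bar> \<le> norm p" using norm_fst_le[of "fst p" "snd p"] by simp
      have s: "norm (snd p) \<le> norm p" using norm_snd_le[of "snd p" "fst p"] by simp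
      have s1: "norm (fst (snd p)) \<le> norm (snd p)" using norm_fst_le[of "fst (snd p)" "snd (snd p)"] by simp
      have s2: "norm (snd (snd p)) \<le> norm (snd p)" using norm_snd_le[of "snd (snd p)" "fst (snd p)"] by simp
      have "\<bar>fst (snd p) $ i $ j\<bar> \<le> norm (fst (snd p) $ i)" by (rule component_le_norm_cart)
      also have "\<dots> \<le> norm (fst (snd p))" by (rule Finite_Cartesian_Product.norm_nth_le)
      finally show "\<bar>fst (snd p) $ i $ j\<bar> \<le> norm p" using s s1 by linarith
      have "\<bar>snd (snd p) $ i\<bar> \<le> norm (snd (snd p))" by (rule component_le_norm_cart)
      then show "\<bar>snd (snd p) $ i\<bar> \<le> norm p" using s s2 by linarith
    qed
    show "\<bar>vt t x - vt t' x'\<bar> \<le> norm (\<Phi> t x - \<Phi> t' x')" "\<bar>v2 i j t x - v2 i j t' x'\<bar> \<le> norm (\<Phi> t x - \<Phi> t' x')"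
      using 1[of "\<Phi> t x - \<Phi> t' x'"] by (simp_all add: \<Phi>_def)
    show "\<bar>vt t x\<bar> \<le> norm (\<Phi> t x)" "\<bar>v2 i j t x\<bar> \<le> norm (\<Phi> t x)" "\<bar>v1 i t x\<bar> \<le> norm (\<Phi> t x)"
      using 1[of "\<Phi> t x"] by (simp_all add: \<Phi>_def)
  qed
  obtain K where K: "K \<ge> 0" "\<And>t x. t \<in> {0..1} \<Longrightarrow> norm x \<le> R \<Longrightarrow> norm (\<Phi> t x) \<le> K"
    using bounded_on_slab[OF c\<Phi>, of R] by blast
  \<comment> \<open>The mean of \<open>h + 2|w|\<^sup>2\<close> is at most \<open>(13 + 4B\<^sup>2)h\<close>, so these errors use up half of \<open>\<epsilon>h\<close>.\<close>
  define \<eta> where "\<eta> = \<epsilon> / (2 * (13 + 4 * B\<^sup>2))"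
  have pos13: "0 < 13 + 4 * B\<^sup>2" by (intro add_pos_nonneg) auto
  have \<eta>: "\<eta> > 0" using \<epsilon> pos13 by (simp add: \<eta>_def)
  obtain \<rho>' where \<rho>': "\<rho>' > 0" "\<rho>' \<le> 1" "\<And>t t' x x'. t \<in> {0..1} \<Longrightarrow> t' \<in> {0..1} \<Longrightarrow> norm x \<le> R \<Longrightarrow> \<bar>t' - t\<bar> \<le> \<rho>' \<Longrightarrow> norm (x' - x) \<le> \<rho>' \<Longrightarrow> norm (\<Phi> t' x' - \<Phi> t x) \<le> \<eta>"
    using uniform_on_slab[OF c\<Phi> \<eta>, of R] by blast
  \<comment> \<open>The corners of the path along the axes stay within \<open>3|w|\<close> of \<open>x\<close>.\<close>
  define \<rho> where "\<rho> = \<rho>' / 3"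
  have \<rho>: "\<rho> > 0" "\<rho> \<le> 1" "3 * \<rho> = \<rho>'" using \<rho>' by (auto simp: \<rho>_def)
  define D where "D = (2 * C + 6 * K) / \<rho> ^ 4"
  have D0: "D \<ge> 0" using C0 K \<rho> by (simp add: D_def)
  \<comment> \<open>The coefficient of the terms of order \<open>h\<^sup>2\<close>; they use up the other half.\<close>
  define S where "S = 8 * D * (27 + B ^ 4) + K * (1 + 3 * B + 2 * B\<^sup>2)"
  have S0: "S \<ge> 0" using D0 K(1) B0 by (simp add: S_def)
  define \<delta> where "\<delta> = min \<rho> (\<epsilon> / (2 * (S + 1)))"
  have \<delta>: "\<delta> > 0" "\<delta> \<le> \<rho>" "S * \<delta> \<le> \<epsilon> / 2"
  proof -
    show "\<delta> > 0" "\<delta> \<le> \<rho>" using \<rho> \<epsilon> S0 by (auto simp: \<delta>_def)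
    have "S * \<delta> \<le> (S + 1) * (\<epsilon> / (2 * (S + 1)))" using S0 \<epsilon> \<open>\<delta> > 0\<close> by (intro mult_mono) (auto simp: \<delta>_def)
    also have "\<dots> = \<epsilon> / 2" using S0 by (simp add: field_simps)
    finally show "S * \<delta> \<le> \<epsilon> / 2" .
  qed
  show ?thesis
  proof (intro exI[of _ \<delta>] conjI allI impI \<delta>(1))
    fix h \<tau> x assume h: "0 < h" "h < \<delta>" "h \<le> \<tau>" "\<tau> \<le> 1" and x: "norm (x :: real^3) \<le> R"
    interpret G: prob_space "gauss h" by (rule prob_space_gauss[OF h(1)])
    have one: "measure (gauss h) UNIV = 1" using G.prob_space by simp
    have \<tau>: "\<tau> \<in> {0..1}" "\<tau> - h \<in> {0..1}" using h by auto
    have h1: "h \<le> 1" "h \<le> \<rho>" "h \<le> \<rho>'" using h \<delta>(2) \<rho> \<rho>' by auto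
    define \<beta>0 where "\<beta>0 = \<beta> \<tau> x"
    have \<beta>0: "norm \<beta>0 \<le> B" using bounds(2)[OF \<tau>(1)] by (simp add: \<beta>0_def)
    let ?Q = "quad_poly (- (h * vt \<tau> x)) (\<lambda>i. v1 i \<tau> x) (\<lambda>i j. v2 i j \<tau> x)"
    let ?\<Delta> = "\<lambda>w. v (\<tau> - h) (x + w) - v \<tau> x"
    have Kb: "norm (\<Phi> \<tau> x) \<le> K" by (rule K(2)[OF \<tau>(1) x])
    have pw: "\<bar>?\<Delta> w - ?Q w\<bar> \<le> \<eta> * (h + 2 * (norm w)\<^sup>2) + D * (norm w)^4" for w
    proof (cases "norm w \<le> \<rho>")
      case True
      have "\<bar>v2 i j \<tau> y - v2 i j \<tau> x\<bar> \<le> \<eta>" if "norm (y - x) \<le> 3 * norm w" for i j y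
        using comp(2)[of i j \<tau> y \<tau> x] \<rho>'(3)[OF \<tau>(1) \<tau>(1) x, of y] that True \<rho> \<rho>'(1) by force
      from taylor_space[OF \<tau>(1) this]
      have sp: "\<bar>v \<tau> (x + w) - v \<tau> x - quad_poly 0 (\<lambda>i. v1 i \<tau> x) (\<lambda>i j. v2 i j \<tau> x) w\<bar> \<le> 2 * \<eta> * (norm w)\<^sup>2" .
      obtain \<xi> where \<xi>: "\<xi> \<in> {\<tau> - h..\<tau>}" "v (\<tau> - h) (x + w) - v \<tau> (x + w) = - (h * vt \<xi> (x + w))"
        using taylor_time[OF h(1,3,4), of "x + w"] by blast
      have "norm (\<Phi> \<xi> (x + w) - \<Phi> \<tau> x) \<le> \<eta>"
        by (rule \<rho>'(3)[OF \<tau>(1) _ x]) (use \<xi>(1) h h1 True \<rho> \<rho>' in auto)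
      then have "\<bar>vt \<xi> (x + w) - vt \<tau> x\<bar> \<le> \<eta>" using comp(1)[of \<xi> "x + w" \<tau> x] by simp
      then have "h * \<bar>vt \<xi> (x + w) - vt \<tau> x\<bar> \<le> h * \<eta>" using h by (intro mult_left_mono) auto
      moreover have "- (h * vt \<xi> (x + w)) + h * vt \<tau> x = - (h * (vt \<xi> (x + w) - vt \<tau> x))" by (simp add: algebra_simps)
      ultimately have tm: "\<bar>- (h * vt \<xi> (x + w)) + h * vt \<tau> x\<bar> \<le> \<eta> * h"
        using h by (simp only: abs_minus_cancel abs_mult abs_of_pos mult.commute)
      have q: "?Q w = - (h * vt \<tau> x) + quad_poly 0 (\<lambda>i. v1 i \<tau> x) (\<lambda>i j. v2 i j \<tau> x) w" by (simp add: quad_poly_def)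
      have "\<bar>?\<Delta> w - ?Q w\<bar> \<le> \<eta> * h + 2 * \<eta> * (norm w)\<^sup>2" unfolding q using sp tm \<xi>(2) by linarith
      also have "\<dots> \<le> \<eta> * (h + 2 * (norm w)\<^sup>2) + D * (norm w)^4" using D0 by (simp add: algebra_simps)
      finally show ?thesis .
    next
      case False
      then have w: "\<rho> \<le> norm w" by simp
      have "\<bar>?Q w\<bar> \<le> K * (1 + 3 * norm w + 2 * (norm w)\<^sup>2)"
      proof (rule quad_poly_bound)
        have "h * \<bar>vt \<tau> x\<bar> \<le> 1 * K" using h h1 comp(3)[of \<tau> x] Kb K(1) by (intro mult_mono) auto
        then show "\<bar>- (h * vt \<tau> x)\<bar> \<le> K" using h by (simp add: abs_mult)
      qed (use comp(4)[of _ _ \<tau> x] comp(5)[of _ \<tau> x] Kb in \<open>auto intro: order_trans\<close>)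
      also have "\<dots> \<le> K * (norm w ^ 4 / \<rho> ^ 4 + 3 * (norm w ^ 4 / \<rho> ^ 4) + 2 * (norm w ^ 4 / \<rho> ^ 4))"
        using pow_le_pow4[OF \<rho>(1,2) w, of 0] pow_le_pow4[OF \<rho>(1,2) w, of 1] pow_le_pow4[OF \<rho>(1,2) w, of 2] K(1)
        by (intro mult_left_mono add_mono) auto
      finally have Q: "\<bar>?Q w\<bar> \<le> 6 * K * (norm w ^ 4 / \<rho> ^ 4)" by (simp add: algebra_simps)
      have "\<bar>?\<Delta> w\<bar> \<le> 2 * C * 1" using bounds(1)[OF \<tau>(1), of x] bounds(1)[OF \<tau>(2), of "x + w"] by simp
      also have "\<dots> \<le> 2 * C * (norm w ^ 4 / \<rho> ^ 4)"
        using pow_le_pow4[OF \<rho>(1,2) w, of 0] C0 by (intro mult_left_mono) auto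
      finally have "\<bar>?\<Delta> w - ?Q w\<bar> \<le> 2 * C * (norm w ^ 4 / \<rho> ^ 4) + 6 * K * (norm w ^ 4 / \<rho> ^ 4)"
        using Q by linarith
      also have "\<dots> = D * norm w ^ 4" by (simp add: D_def add_divide_distrib algebra_simps)
      also have "\<dots> \<le> \<eta> * (h + 2 * (norm w)\<^sup>2) + D * (norm w)^4" using \<eta> h by simp
      finally show ?thesis .
    qed
    let ?w = "\<lambda>z. z - h *\<^sub>R \<beta>0"
    have sq: "(norm (?w z))\<^sup>2 \<le> 2 * (norm z)\<^sup>2 + 2 * h * B\<^sup>2" for z
    proof -
      have "(norm (z - h *\<^sub>R \<beta>0))\<^sup>2 \<le> 2 * (norm z)\<^sup>2 + 2 * (norm (h *\<^sub>R \<beta>0))\<^sup>2"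
        using norm_diff_sq_le[of z "h *\<^sub>R \<beta>0" 0] by simp
      also have "(norm (h *\<^sub>R \<beta>0))\<^sup>2 \<le> h * B\<^sup>2"
      proof -
        have "h\<^sup>2 \<le> h" using h h1 by (simp add: power2_eq_square mult_le_one mult_left_le)
        moreover have "(norm \<beta>0)\<^sup>2 \<le> B\<^sup>2" using \<beta>0 by (intro power_mono) auto
        ultimately have "h\<^sup>2 * (norm \<beta>0)\<^sup>2 \<le> h * B\<^sup>2" using h by (intro mult_mono) auto
        then show ?thesis by (simp add: power_mult_distrib)
      qed
      finally show ?thesis by (simp add: algebra_simps)
    qed
    have p4: "(norm (?w z))^4 \<le> 8 * (norm z)^4 + 8 * h\<^sup>2 * B^4" for z
    proof -
      have "(norm (?w z))^4 = ((norm (?w z))\<^sup>2)\<^sup>2" by simp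
      also have "\<dots> \<le> (2 * (norm z)\<^sup>2 + 2 * h * B\<^sup>2)\<^sup>2" by (intro power_mono sq) auto
      also have "\<dots> \<le> 2 * (2 * (norm z)\<^sup>2)\<^sup>2 + 2 * (2 * h * B\<^sup>2)\<^sup>2"
        using sum_squares_bound[of "2 * (norm z)\<^sup>2" "2 * h * B\<^sup>2"] by (simp add: power2_sum)
      also have "\<dots> = 8 * (norm z)^4 + 8 * h\<^sup>2 * B^4" by (simp add: power_mult_distrib)
      finally show ?thesis .
    qed
    have m: "(\<lambda>z. v (\<tau> - h) (x + ?w z)) \<in> borel_measurable borel"
    proof (rule borel_measurable_continuous_onI)
      have "continuous_on UNIV ((\<lambda>(t, x). v t x) \<circ> (\<lambda>z. (\<tau> - h, x + ?w z)))"
        using \<tau>(2) by (intro continuous_on_compose continuous_on_subset[OF cont(1)] continuous_intros) auto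
      then show "continuous_on UNIV (\<lambda>z. v (\<tau> - h) (x + ?w z))" by (simp add: o_def)
    qed
    have i\<Delta>: "integrable (gauss h) (\<lambda>z. ?\<Delta> (?w z))"
    proof (intro Bochner_Integration.integrable_diff G.integrable_const_bound[where B=C])
      show "AE z in gauss h. norm (v (\<tau> - h) (x + ?w z)) \<le> C" using bounds(1)[OF \<tau>(2)] by simp
    qed (use m bounds(1)[OF \<tau>(1), of x] in auto)
    have iQ: "integrable (gauss h) (\<lambda>z. ?Q (?w z))" by (rule integrable_quad_poly[OF h(1)])
    have "\<bar>(\<integral>z. ?\<Delta> (?w z) \<partial>gauss h) - (\<integral>z. ?Q (?w z) \<partial>gauss h)\<bar> = \<bar>\<integral>z. ?\<Delta> (?w z) - ?Q (?w z) \<partial>gauss h\<bar>"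
      using i\<Delta> iQ by simp
    also have "\<dots> \<le> (\<integral>z. \<eta> * (h + 2 * (2 * (norm z)\<^sup>2 + 2 * h * B\<^sup>2)) + D * (8 * (norm z)^4 + 8 * h\<^sup>2 * B^4) \<partial>gauss h)"
    proof (rule order_trans[OF integral_abs_bound], rule integral_mono')
      show "integrable (gauss h) (\<lambda>z. \<eta> * (h + 2 * (2 * (norm z)\<^sup>2 + 2 * h * B\<^sup>2)) + D * (8 * (norm z)^4 + 8 * h\<^sup>2 * B^4))"
        using integrable_gauss_norm2[OF h(1)] integrable_gauss_norm4[OF h(1)] by simp
      fix z :: "real^3"
      show "0 \<le> \<eta> * (h + 2 * (2 * (norm z)\<^sup>2 + 2 * h * B\<^sup>2)) + D * (8 * (norm z)^4 + 8 * h\<^sup>2 * B^4)"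
        using \<eta> h D0 B0 by simp
      have "\<bar>?\<Delta> (?w z) - ?Q (?w z)\<bar> \<le> \<eta> * (h + 2 * (norm (?w z))\<^sup>2) + D * (norm (?w z))^4" by (rule pw)
      also have "\<dots> \<le> \<eta> * (h + 2 * (2 * (norm z)\<^sup>2 + 2 * h * B\<^sup>2)) + D * (8 * (norm z)^4 + 8 * h\<^sup>2 * B^4)"
        using sq[of z] p4[of z] \<eta> D0 by (intro add_mono mult_left_mono) auto
      finally show "\<bar>?\<Delta> (?w z) - ?Q (?w z)\<bar> \<le> \<eta> * (h + 2 * (2 * (norm z)\<^sup>2 + 2 * h * B\<^sup>2)) + D * (8 * (norm z)^4 + 8 * h\<^sup>2 * B^4)" .
    qed
    also have "\<dots> = \<eta> * (h + 2 * (2 * (3 * h) + 2 * h * B\<^sup>2)) + D * (8 * (\<integral>z. (norm z)^4 \<partial>gauss h) + 8 * h\<^sup>2 * B^4)"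
      using integrable_gauss_norm2[OF h(1)] integrable_gauss_norm4[OF h(1)] by (simp add: integral_gauss_norm2[OF h(1)] one)
    also have "\<dots> \<le> \<eta> * (h + 2 * (2 * (3 * h) + 2 * h * B\<^sup>2)) + D * (8 * (27 * h\<^sup>2) + 8 * h\<^sup>2 * B^4)"
      using integral_gauss_norm4[OF h(1)] D0 \<eta> h(1) by (intro add_mono mult_left_mono) auto
    also have "\<dots> = h * (\<eta> * (13 + 4 * B\<^sup>2)) + h\<^sup>2 * (8 * D * (27 + B^4))" by (simp add: algebra_simps)
    also have "\<eta> * (13 + 4 * B\<^sup>2) = \<epsilon> / 2" using pos13 by (simp add: \<eta>_def field_simps)
    finally have d1: "\<bar>(\<integral>z. ?\<Delta> (?w z) \<partial>gauss h) - (\<integral>z. ?Q (?w z) \<partial>gauss h)\<bar> \<le> h * (\<epsilon> / 2) + h\<^sup>2 * (8 * D * (27 + B^4))" .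
    have "(\<integral>z. ?Q (?w z) \<partial>gauss h) = h\<^sup>2 * quad_poly 0 (\<lambda>_. 0) (\<lambda>i j. v2 i j \<tau> x) \<beta>0"
    proof -
      have "(\<Sum>i\<in>UNIV. v2 i i \<tau> x) / 2 - (\<Sum>i\<in>UNIV. \<beta>0 $ i * v1 i \<tau> x) = vt \<tau> x" using pde[OF \<tau>(1), of x] by (simp add: \<beta>0_def)
      then show ?thesis unfolding integral_quad_poly[OF h(1)] by simp
    qed
    moreover have "\<bar>quad_poly 0 (\<lambda>_. 0) (\<lambda>i j. v2 i j \<tau> x) \<beta>0\<bar> \<le> K * (1 + 3 * B + 2 * B\<^sup>2)"
    proof -
      have "\<bar>quad_poly 0 (\<lambda>_. 0) (\<lambda>i j. v2 i j \<tau> x) \<beta>0\<bar> \<le> K * (1 + 3 * norm \<beta>0 + 2 * (norm \<beta>0)\<^sup>2)"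
        by (rule quad_poly_bound) (use K(1) comp(4)[of _ _ \<tau> x] Kb in \<open>auto intro: order_trans\<close>)
      also have "\<dots> \<le> K * (1 + 3 * B + 2 * B\<^sup>2)"
        using \<beta>0 K(1) by (intro mult_left_mono add_mono power_mono) auto
      finally show ?thesis .
    qed
    then have "\<bar>h\<^sup>2 * quad_poly 0 (\<lambda>_. 0) (\<lambda>i j. v2 i j \<tau> x) \<beta>0\<bar> \<le> h\<^sup>2 * (K * (1 + 3 * B + 2 * B\<^sup>2))"
      unfolding abs_mult by (simp add: mult_left_mono)
    ultimately have "\<bar>\<integral>z. ?Q (?w z) \<partial>gauss h\<bar> \<le> h\<^sup>2 * (K * (1 + 3 * B + 2 * B\<^sup>2))" by simp
    then have "\<bar>\<integral>z. ?\<Delta> (?w z) \<partial>gauss h\<bar> \<le> h * (\<epsilon> / 2) + h\<^sup>2 * (8 * D * (27 + B^4)) + h\<^sup>2 * (K * (1 + 3 * B + 2 * B\<^sup>2))"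
      using d1 by linarith
    also have "\<dots> = h * (\<epsilon> / 2) + h * (S * h)" by (simp add: S_def power2_eq_square algebra_simps)
    also have "\<dots> \<le> h * (\<epsilon> / 2) + h * (\<epsilon> / 2)"
    proof (intro add_left_mono mult_left_mono)
      have "S * h \<le> S * \<delta>" using S0 h by (intro mult_left_mono) auto
      then show "S * h \<le> \<epsilon> / 2" using \<delta>(3) by simp
    qed (use h in simp)
    finally have "\<bar>\<integral>z. ?\<Delta> (?w z) \<partial>gauss h\<bar> \<le> \<epsilon> * h" by (simp add: algebra_simps)
    moreover have "x + ?w z = x - h *\<^sub>R \<beta> \<tau> x + z" for z by (simp add: \<beta>0_def)
    ultimately show "\<bar>\<integral>z. v (\<tau> - h) (x - h *\<^sub>R \<beta> \<tau> x + z) - v \<tau> x \<partial>gauss h\<bar> \<le> \<epsilon> * h" by simp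
  qed
qed

end

section \<open>The theorem\<close>

lemma usual_augmentation_cong:
  assumes "null_sets (completion \<nu>) = null_sets (completion \<nu>')"
  shows "usual_augmentation \<nu> = usual_augmentation \<nu>'"
  unfolding usual_augmentation_def assms ..

lemma cadlag_continuous:
  fixes g :: "real \<Rightarrow> real"
  assumes "continuous_on {0..1} g" shows "cadlag g"
  unfolding cadlag_def
proof (intro conjI ballI)
  fix t :: real assume t: "t \<in> {0..<1}"
  have "(g \<longlongrightarrow> g t) (at t within {0..1})" using assms t by (auto simp: continuous_on_def)
  then have "(g \<longlongrightarrow> g t) (at t within {t..1})" by (rule tendsto_within_subset) (use t in auto)
  then show "(g \<longlongrightarrow> g t) (at_right t)" using t by (simp add: at_within_Icc_at_right)
next
  fix t :: real assume t: "t \<in> {0<..1}"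
  have "(g \<longlongrightarrow> g t) (at t within {0..1})" using assms t by (auto simp: continuous_on_def)
  then have "(g \<longlongrightarrow> g t) (at t within {0..t})" by (rule tendsto_within_subset) (use t in auto)
  then show "\<exists>l. (g \<longlongrightarrow> l) (at_left t)" using t by (auto simp: at_within_Icc_at_left)
qed

context backward_harmonic begin

abbreviation P where "P \<equiv> density \<mu> (\<lambda>\<omega>. ennreal (Zlim \<omega>))"

text \<open>The density is positive, so \<open>P\<close> and \<open>\<mu>\<close> have the same null sets and hence the same augmented
  filtration.\<close>

lemma completion_P: "completion P = density M (\<lambda>\<omega>. ennreal (Zlim \<omega>))"
  by (rule completion_density_eq) (use Zlim_pos Zlim_measurable_\<mu> in auto)

lemma usual_P: "usual_augmentation P = F"
proof (rule usual_augmentation_cong)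
  show "null_sets (completion P) = null_sets M"
  proof (intro set_eqI iffI)
    fix A assume "A \<in> null_sets (completion P)"
    then have A: "A \<in> sets M" "AE \<omega> in M. \<omega> \<in> A \<longrightarrow> ennreal (Zlim \<omega>) = 0"
      unfolding completion_P by (auto simp: null_sets_density_iff)
    from A(2) have "AE \<omega> in M. \<omega> \<notin> A"
      by eventually_elim (use Zlim_pos in \<open>auto simp: ennreal_eq_0_iff not_le[symmetric]\<close>)
    then show "A \<in> null_sets M" using A(1) by (simp add: AE_iff_null_sets)
  next
    fix A assume A: "A \<in> null_sets M"
    then have "AE \<omega> in M. \<omega> \<notin> A" by (rule AE_not_in)
    then show "A \<in> null_sets (completion P)" using A
      unfolding completion_P by (subst null_sets_density_iff) (auto elim: eventually_mono)
  qed
qed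

lemma prob_space_P: "prob_space (completion P)"
proof
  have "emeasure (completion P) (space (completion P)) = (\<integral>\<^sup>+\<omega>. ennreal (Zlim \<omega>) \<partial>M)"
    unfolding completion_P by (subst emeasure_density) (auto intro!: nn_integral_cong)
  also have "\<dots> = 1"
    using nn_integral_eq_integral[OF Zlim_integrable] Zlim_pos Zlim_expectation by (simp add: less_imp_le)
  finally show "emeasure (completion P) (space (completion P)) = 1" .
qed

lemma integral_P:
  fixes Y :: "path \<Rightarrow> real"
  assumes "Y \<in> borel_measurable M"
  shows "(\<integral>\<omega>. Y \<omega> \<partial>completion P) = (\<integral>\<omega>. Zlim \<omega> * Y \<omega> \<partial>M)"
  unfolding completion_P using assms Zlim_pos
  by (subst integral_density) (auto simp: less_imp_le)

lemma martingale_P: "martingale (completion P) F (\<lambda>t \<omega>. - f t (\<omega> t))"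
  unfolding martingale_def
proof (intro conjI ballI impI)
  interpret P: prob_space "completion P" by (rule prob_space_P)
  have sub: "subalgebra (completion P) (F t)" for t
    using subalgebra_usual[of t] unfolding completion_P by (simp add: subalgebra_def)
  have meas: "(\<lambda>\<omega>. - f t (\<omega> t)) \<in> borel_measurable M" if "t \<in> {0..1}" for t
    using f_eval_measurable[OF that] by simp
  have measP: "(\<lambda>\<omega>. - f t (\<omega> t)) \<in> borel_measurable (completion P)" if "t \<in> {0..1}" for t
    unfolding completion_P using meas[OF that] by simp
  have measF: "(\<lambda>\<omega>. - f t (\<omega> t)) \<in> borel_measurable (F t)" if "t \<in> {0..1}" for t
    using f_eval_measurable_F[OF that order_refl] by simp
  show "adapted F (\<lambda>t \<omega>. - f t (\<omega> t))" unfolding adapted_def using measF by blast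
  show int: "integrable (completion P) (\<lambda>\<omega>. - f t (\<omega> t))" if "t \<in> {0..1}" for t
    using bound_f[OF that] measP[OF that] by (intro P.integrable_const_bound[where B=C]) auto
  fix s t :: real assume st: "s \<in> {0..1}" "t \<in> {0..1}" "s \<le> t"
  interpret S: finite_measure_subalgebra "completion P" "F s"
    by unfold_locales (rule sub)
  show "AE \<omega> in completion P. real_cond_exp (completion P) (F s) (\<lambda>\<omega>. - f t (\<omega> t)) \<omega> = - f s (\<omega> s)"
  proof (rule S.real_cond_exp_charact)
    fix A assume A: "A \<in> sets (F s)"
    have AM: "A \<in> sets M" using A sets_usual_completion[of s] by auto
    have m: "(\<lambda>\<omega>. indicator A \<omega> * (- f r (\<omega> r))) \<in> borel_measurable M" if "r \<in> {0..1}" for r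
      using meas[OF that] AM by measurable
    have i: "integrable M (\<lambda>\<omega>. Zlim \<omega> * (indicator A \<omega> * f r (\<omega> r)))" if "r \<in> {0..1}" for r
    proof (rule Zlim_mult_integrable)
      show "(\<lambda>\<omega>. indicator A \<omega> * f r (\<omega> r)) \<in> borel_measurable M" using f_eval_measurable[OF that] AM by measurable
      show "\<bar>indicator A \<omega> * f r (\<omega> r)\<bar> \<le> C" for \<omega>
        using bound_f[OF that, of "\<omega> r"] C_nonneg by (simp add: indicator_def)
    qed
    have e: "(\<integral>\<omega>\<in>A. - f r (\<omega> r) \<partial>completion P) = - (\<integral>\<omega>. Zlim \<omega> * (indicator A \<omega> * f r (\<omega> r)) \<partial>M)" if "r \<in> {0..1}" for r
      unfolding set_lebesgue_integral_def using integral_P[OF m[OF that]] by simp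
    have "(\<integral>\<omega>. Zlim \<omega> * (indicator A \<omega> * f t (\<omega> t)) \<partial>M) - (\<integral>\<omega>. Zlim \<omega> * (indicator A \<omega> * f s (\<omega> s)) \<partial>M) = 0"
      using martingale_identity[OF st A] i[OF st(1)] i[OF st(2)] by (simp add: right_diff_distrib)
    then show "(\<integral>\<omega>\<in>A. - f t (\<omega> t) \<partial>completion P) = (\<integral>\<omega>\<in>A. - f s (\<omega> s) \<partial>completion P)"
      unfolding e[OF st(1)] e[OF st(2)] by simp
  qed (use int st measF in auto)
qed

theorem local_martingale_P:
  "local_martingale (completion P) (usual_augmentation P) (\<lambda>t \<omega>. - f t (\<omega> t))"
  unfolding local_martingale_def usual_P
proof (intro conjI)
  have sp: "space (completion P) = space borel_W" by (simp add: space_\<nu>)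
  show "prob_space (completion P)" by (rule prob_space_P)
  show "filtration (space (completion P)) F" unfolding sp by (rule filtration_usual)
  show "\<forall>t\<in>{0..1}. subalgebra (completion P) (F t)"
    using subalgebra_usual unfolding completion_P by (simp add: subalgebra_def)
  show "adapted F (\<lambda>t \<omega>. - f t (\<omega> t))" using martingale_P by (simp add: martingale_def)
  show "\<forall>\<omega>\<in>space (completion P). cadlag (\<lambda>t. - f t (\<omega> t))"
    by (intro ballI cadlag_continuous continuous_on_minus f_path_continuous) simp
  show "\<exists>T :: nat \<Rightarrow> path \<Rightarrow> real.
        (\<forall>n. stopping_time F (T n)) \<and>
        (\<forall>n. \<forall>\<omega>\<in>space (completion P). T n \<omega> \<in> {0..1}) \<and>
        (\<forall>\<omega>\<in>space (completion P). incseq (\<lambda>n. T n \<omega>)) \<and>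
        (AE \<omega> in completion P. \<forall>\<^sub>F n in sequentially. T n \<omega> = 1) \<and>
        (\<forall>n. martingale (completion P) F
           (\<lambda>t \<omega>. indicator {\<omega>. T n \<omega> > 0} \<omega> * (- f (min t (T n \<omega>)) (\<omega> (min t (T n \<omega>))))))"
  \<comment> \<open>The process is bounded, hence a martingale up to the terminal time.\<close>
  proof (intro exI[of _ "\<lambda>_ _. 1"] conjI allI)
    show "stopping_time F (\<lambda>_. 1)" by (rule stopping_time_const)
    have "martingale (completion P) F X = martingale (completion P) F Y"
      if "\<And>t. t \<in> {0..1} \<Longrightarrow> X t = Y t" for X Y
      unfolding martingale_def adapted_def using that by simp
    from this[of _ "\<lambda>t \<omega>. - f t (\<omega> t)"]
    show "martingale (completion P) F (\<lambda>t \<omega>. indicator {\<omega>. (0::real) < 1} \<omega> * (- f (min t 1) (\<omega> (min t 1))))"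
      using martingale_P by (simp add: min_def)
  qed (auto simp: incseq_def)
qed

end

lemma C12_component_derivs:
  fixes u :: "real \<Rightarrow> real^3 \<Rightarrow> real^3"
  assumes u: "C12 u" and t: "t \<in> {0..1}"
  shows "((\<lambda>s. u s x $ k) has_real_derivative dt u t x $ k) (at t within {0..1})"
    "((\<lambda>h. u t (x + h *\<^sub>R axis i 1) $ k) has_real_derivative dx i u t x $ k) (at 0)"
    "((\<lambda>h. dx i u t (x + h *\<^sub>R axis j 1) $ k) has_real_derivative dx j (dx i u) t x $ k) (at 0)"
proof -
  have comp: "((\<lambda>s. g s $ k) has_real_derivative vector_derivative g (at r within S) $ k) (at r within S)"
    if "g differentiable (at r within S)" for g :: "real \<Rightarrow> real^3" and r S
    unfolding has_real_derivative_iff_has_vector_derivative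
    by (rule bounded_linear.has_vector_derivative[OF bounded_linear_vec_nth])
       (use that in \<open>simp add: vector_derivative_works\<close>)
  show "((\<lambda>s. u s x $ k) has_real_derivative dt u t x $ k) (at t within {0..1})"
    unfolding dt_def by (rule comp) (use u t in \<open>auto simp: C12_def has_partial_def\<close>)
  show "((\<lambda>h. u t (x + h *\<^sub>R axis i 1) $ k) has_real_derivative dx i u t x $ k) (at 0)"
    unfolding dx_def by (rule comp) (use u t in \<open>auto simp: C12_def has_partial_def\<close>)
  show "((\<lambda>h. dx i u t (x + h *\<^sub>R axis j 1) $ k) has_real_derivative dx j (dx i u) t x $ k) (at 0)"
    unfolding dx_def[of j] by (rule comp) (use u t in \<open>auto simp: C12_def has_partial_def\<close>)
qed

lemma cont_slab_component: "cont_slab u \<Longrightarrow> continuous_on slab (\<lambda>(t, x). u t x $ k)" for u :: "real \<Rightarrow> real^3 \<Rightarrow> real^3"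
  unfolding cont_slab_def split_beta' by (intro continuous_intros)

lemma pressure_invariant:
  assumes "\<And>a. p t (x + a *\<^sub>R axis i 1) = p t x"
  shows "grad p t x $ i = 0"
  using assms by (simp add: grad_def dx_def)

lemma navier_stokes_component:
  assumes "navier_stokes u p" "t \<in> {0..1}" "grad p t x $ k = 0"
  shows "dt u t x $ k + (\<Sum>i\<in>UNIV. u t x $ i * dx i u t x $ k) = (\<Sum>i\<in>UNIV. dx i (dx i u) t x $ k) / 2"
proof -
  have "(dt u t x + advection u t x) $ k = (- grad p t x + (1/2) *\<^sub>R laplacian u t x) $ k"
    using assms by (simp add: navier_stokes_def)
  then show ?thesis using assms(3) by (simp add: advection_def laplacian_def)
qed

theorem mainTheorem5:
  fixes p :: "real \<Rightarrow> real^3 \<Rightarrow> real"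
    and u :: "real \<Rightarrow> real^3 \<Rightarrow> real^3"
    and \<mu> :: "path measure"
    and I :: "path \<Rightarrow> real"
  assumes "\<And>t x. t \<in> {0..1} \<Longrightarrow> 0 \<le> p t x"
    and "smooth_bounded p"
    and "u \<in> C12_b_div"
    and "navier_stokes u p"
    and "\<And>a t x. t \<in> {0..1} \<Longrightarrow> p t (x + a *\<^sub>R axis 3 1) = p t x"
    and "wiener_measure \<mu>"
    and "is_ito_integral \<mu> (\<lambda>t \<omega>. u (1 - t) (\<omega> t)) I"
  shows "local_martingale (completion (P_measure \<mu> u I)) (usual_augmentation (P_measure \<mu> u I))
           (\<lambda>t \<omega>. drift u t \<omega> \<bullet> axis 3 1)"
proof -
  have C: "C12 u" and bd: "bounded_slab u" using assms(3) by (auto simp: C12_b_div_def)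
  have cu: "cont_slab u" and ct: "cont_slab (dt u)" and c1: "cont_slab (dx i u)" and c2: "cont_slab (dx j (dx i u))" for i j
    using C by (auto simp: C12_def)
  obtain B where "\<forall>y\<in>(\<lambda>(t, x). u t x) ` slab. norm y \<le> B" using bd unfolding bounded_slab_def bounded_iff by blast
  then have B: "norm (u t x) \<le> B" if "t \<in> {0..1}" for t x using that by force
  have Bk: "\<bar>u t x $ k\<bar> \<le> B" if "t \<in> {0..1}" for t x k
    using order_trans[OF component_le_norm_cart B[OF that]] .
  interpret S: C12_scalar "\<lambda>t x. u t x $ 3" "\<lambda>t x. dt u t x $ 3" "\<lambda>i t x. dx i u t x $ 3" "\<lambda>i j t x. dx j (dx i u) t x $ 3" u B B
  proof unfold_locales
    fix t :: real and x :: "real^3" assume t: "t \<in> {0..1}"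
    have "grad p t x $ 3 = 0" by (rule pressure_invariant) (rule assms(5)[OF t])
    then show "dt u t x $ 3 + (\<Sum>i\<in>UNIV. u t x $ i * dx i u t x $ 3) = (\<Sum>i\<in>UNIV. dx i (dx i u) t x $ 3) / 2"
      by (rule navier_stokes_component[OF assms(4) t])
  qed (fact C12_component_derivs[OF C] cont_slab_component[OF cu] cont_slab_component[OF ct] cont_slab_component[OF c1] cont_slab_component[OF c2] Bk B)+
  \<comment> \<open>Time reversal turns the equation for \<open>u\<close> into the backward equation for \<open>u(1-t,x)\<close>.\<close>
  have rev: "continuous_on slab (\<lambda>(t, x). g (1 - t) x)" if "continuous_on slab (\<lambda>(t, x). g t x)"
    for g :: "real \<Rightarrow> real^3 \<Rightarrow> 'b::real_normed_vector"
  proof -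
    have "continuous_on slab ((\<lambda>(t, x). g t x) \<circ> (\<lambda>q. (1 - fst q, snd q)))"
      by (intro continuous_on_compose continuous_on_subset[OF that] continuous_intros) auto
    then show ?thesis by (simp add: o_def split_beta')
  qed
  interpret H: backward_harmonic \<mu> "\<lambda>t x. u (1 - t) x" B I "\<lambda>t x. u (1 - t) x $ 3" B
  proof unfold_locales
    show "wiener_measure \<mu>" "is_ito_integral \<mu> (\<lambda>t \<omega>. u (1 - t) (\<omega> t)) I" by fact+
    show "continuous_on slab (\<lambda>(t, x). u (1 - t) x)" using cu unfolding cont_slab_def by (rule rev)
    show "continuous_on slab (\<lambda>(t, x). u (1 - t) x $ 3)" by (rule rev[OF cont_slab_component[OF cu]])
    show "norm (u (1 - t) x) \<le> B" "\<bar>u (1 - t) x $ 3\<bar> \<le> B" if "t \<in> {0..1}" for t x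
      using that by (auto intro!: B Bk)
    fix R \<epsilon> :: real assume "\<epsilon> > 0"
    then obtain \<delta> where \<delta>: "\<delta> > 0" and est: "\<And>h \<tau> x. 0 < h \<Longrightarrow> h < \<delta> \<Longrightarrow> h \<le> \<tau> \<Longrightarrow> \<tau> \<le> 1 \<Longrightarrow> norm x \<le> R \<Longrightarrow>
     \<bar>\<integral>z. u (\<tau> - h) (x - h *\<^sub>R u \<tau> x + z) $ 3 - u \<tau> x $ 3 \<partial>gauss h\<bar> \<le> \<epsilon> * h"
      using S.one_step_estimate[of \<epsilon> R] by blast
    show "\<exists>\<delta>>0. \<forall>h t x. 0 < h \<longrightarrow> h < \<delta> \<longrightarrow> 0 \<le> t \<longrightarrow> t + h \<le> 1 \<longrightarrow> norm x \<le> R \<longrightarrow>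
       \<bar>\<integral>z. u (1 - (t + h)) (x - h *\<^sub>R u (1 - t) x + z) $ 3 - u (1 - t) x $ 3 \<partial>gauss h\<bar> \<le> \<epsilon> * h"
    proof (intro exI[of _ \<delta>] conjI allI impI \<delta>)
      fix h t x assume "0 < h" "h < \<delta>" "0 \<le> t" "t + h \<le> 1" "norm (x::real^3) \<le> R"
      then show "\<bar>\<integral>z. u (1 - (t + h)) (x - h *\<^sub>R u (1 - t) x + z) $ 3 - u (1 - t) x $ 3 \<partial>gauss h\<bar> \<le> \<epsilon> * h"
        using est[of h "1 - t" x] by (simp add: diff_diff_eq)
    qed
  qed
  have "P_measure \<mu> u I = H.P"
    by (simp add: P_measure_def H.Zlim_def H.energy_def)
  moreover have "drift u t \<omega> \<bullet> axis 3 1 = - (u (1 - t) (\<omega> t) $ 3)" for t \<omega>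
    by (simp add: drift_def inner_axis)
  ultimately show ?thesis using H.local_martingale_P by simp
qed

end
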